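(* Let $\mathfrak g$ be a finite-dimensional simple Lie algebra over $\mathbb C$, let $V$ be a finite-dimensional faithful highest weight $\mathfrak g$-module with highest weight $\lambda$, let $v_\lambda$ be a highest weight vector, and let $V_{\mathbb Z}=\mathcal U_{\mathbb Z}\cdot v_\lambda$ be the admissible lattice of $V$ generated by $v_\lambda$. Let $\beta_{j_1},\dots,\beta_{j_n}$ (with $n=|\Delta^+|$) be the positive roots listed in a fixed linear order compatible with height. For $s_{j_i}\in\mathbb Q$, $i=1,\dots,n$, let $$u=\prod_{i=1}^{n}\chi_{\beta_{j_i}}(s_{j_i})\in U(\mathbb Q)$$ be the unique expression of an element $u\in U(\mathbb Q)$ as such an ordered product. If $u\cdot V_{\mathbb Z}\subseteq V_{\mathbb Z}$, then $s_{j_i}\in\mathbb Z$ for all $1\le i\le n$.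
   Context: Fix a Cartan subalgebra $\mathfrak h$ of $\mathfrak g$, the root system $\Delta\subset\mathfrak h^*$, positive roots $\Delta^+$, simple roots $\alpha_i$ ($i\in I$), coroots $h_\alpha=\alpha^\vee$ with $h_i=h_{\alpha_i}$, and a Chevalley basis $\{x_\alpha,h_i\mid \alpha\in\Delta,\ i\in I\}$ of $\mathfrak g$, so $[x_\alpha,x_{-\alpha}]=h_\alpha$. The height of $\sum a_i\alpha_i$ is $\sum a_i$; a linear order on $\Delta^+$ is compatible with height if $\mathrm{ht}(\alpha)<\mathrm{ht}(\beta)$ implies $\alpha<\beta$ (so $\mathrm{ht}(\beta_{j_1})\le\dots\le\mathrm{ht}(\beta_{j_n})$). A faithful finite-dimensional highest weight module here is the nontrivial irreducible $\mathfrak g$-module $V=V^\lambda$ with highest weight $\lambda$ (a nonzero dominant integral weight). $\mathcal U_{\mathbb Z}$ is the Cartier–Kostant $\mathbb Z$-form of the universal enveloping algebra $\mathcal U$ of $\mathfrak g$: the $\mathbb Z$-subalgebra generated by $x_\alpha^{(m)}:=x_\alpha^m/m!$ ($\alpha\in\Delta$, $m\ge0$) and $\binom{h_i}{m}=h_i(h_i-1)\cdots(h_i-m+1)/m!$ ($i\in I$, $m\ge 0$). The lattice $V_{\mathbb Z}=\mathcal U_{\mathbb Z}\cdot v_\lambda$ is a $\mathbb Z$-form of $V$. For $\alpha\in\Delta$ and $t\in\mathbb Q$, $\chi_\alpha(t)=\exp(t x_\alpha)=\sum_{k\ge0}t^k x_\alpha^{(k)}$ acting on $V$ (a finite sum).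 $U(\mathbb Q)=\langle\chi_\alpha(t)\mid\alpha\in\Delta^+,\ t\in\mathbb Q\rangle$. It is known that every element of $U(\mathbb Q)$ can be written uniquely as an ordered product $\prod_{\alpha\in\Delta^+}\chi_\alpha(t_\alpha)$ with $t_\alpha\in\mathbb Q$, relative to any fixed order on $\Delta^+$. *)

theory Defs
  imports "HOL-Library.Poly_Mapping" "HOL-Algebra.Generated_Rings"
begin

section \<open>Simple complex Lie algebras\<close>

locale lie_algebra = vector_space s
  for s :: "complex \<Rightarrow> 'g::ab_group_add \<Rightarrow> 'g" +
  fixes br :: "'g \<Rightarrow> 'g \<Rightarrow> 'g"
  assumes br_add_left: "br (x + y) z = br x z + br y z"
    and br_add_right: "br x (y + z) = br x y + br x z"
    and br_scale_left: "br (s c x) y = s c (br x y)"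
    and br_scale_right: "br x (s c y) = s c (br x y)"
    and br_self: "br x x = 0"
    and jacobi: "br x (br y z) + br y (br z x) + br z (br x y) = 0"

definition lie_ideal ::
  "(complex \<Rightarrow> 'g::ab_group_add \<Rightarrow> 'g) \<Rightarrow> ('g \<Rightarrow> 'g \<Rightarrow> 'g) \<Rightarrow> 'g set \<Rightarrow> bool" where
  "lie_ideal s br I \<longleftrightarrow> module.subspace s I \<and> (\<forall>x. \<forall>y\<in>I. br x y \<in> I)"

definition fd_simple_lie_algebra ::
  "(complex \<Rightarrow> 'g::ab_group_add \<Rightarrow> 'g) \<Rightarrow> ('g \<Rightarrow> 'g \<Rightarrow> 'g) \<Rightarrow> bool" where
  "fd_simple_lie_algebra s br \<longleftrightarrow>
     lie_algebra s br \<and>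
     (\<exists>B. finite_dimensional_vector_space s B) \<and>
     (\<exists>x y. br x y \<noteq> 0) \<and>
     (\<forall>I. lie_ideal s br I \<longrightarrow> I = {0} \<or> I = UNIV)"

section \<open>Cartan subalgebras, roots and Chevalley bases\<close>

primrec lower_central ::
  "(complex \<Rightarrow> 'g::ab_group_add \<Rightarrow> 'g) \<Rightarrow> ('g \<Rightarrow> 'g \<Rightarrow> 'g) \<Rightarrow> 'g set \<Rightarrow> nat \<Rightarrow> 'g set" where
  "lower_central s br H 0 = H"
| "lower_central s br H (Suc n) =
     module.span s {br x y | x y. x \<in> H \<and> y \<in> lower_central s br H n}"

text \<open>A Cartan subalgebra is a nilpotent, self-normalizing subalgebra.\<close>

definition cartan_subalgebra ::
  "(complex \<Rightarrow> 'g::ab_group_add \<Rightarrow> 'g) \<Rightarrow> ('g \<Rightarrow> 'g \<Rightarrow> 'g) \<Rightarrow> 'g set \<Rightarrow> bool" where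
  "cartan_subalgebra s br H \<longleftrightarrow>
     module.subspace s H \<and> (\<forall>x\<in>H. \<forall>y\<in>H. br x y \<in> H) \<and>
     (\<exists>n. lower_central s br H n = {0}) \<and>
     {x. \<forall>y\<in>H. br x y \<in> H} = H"

text \<open>A linear functional on \<open>H\<close> is represented by the function on the whole of \<open>'g\<close> that extends
  it by \<open>0\<close> outside \<open>H\<close>, so that equality of functionals is equality of functions.\<close>

definition dual_space ::
  "(complex \<Rightarrow> 'g::ab_group_add \<Rightarrow> 'g) \<Rightarrow> 'g set \<Rightarrow> ('g \<Rightarrow> complex) set" where
  "dual_space s H =
     {f. (\<forall>x\<in>H. \<forall>y\<in>H. f (x + y) = f x + f y) \<and> (\<forall>c. \<forall>x\<in>H. f (s c x) = c * f x) \<and>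
         (\<forall>x. x \<notin> H \<longrightarrow> f x = 0)}"

definition root_space ::
  "(complex \<Rightarrow> 'g::ab_group_add \<Rightarrow> 'g) \<Rightarrow> ('g \<Rightarrow> 'g \<Rightarrow> 'g) \<Rightarrow> 'g set \<Rightarrow> ('g \<Rightarrow> complex) \<Rightarrow> 'g set" where
  "root_space s br H \<alpha> = {x. \<forall>y\<in>H. br y x = s (\<alpha> y) x}"

definition roots ::
  "(complex \<Rightarrow> 'g::ab_group_add \<Rightarrow> 'g) \<Rightarrow> ('g \<Rightarrow> 'g \<Rightarrow> 'g) \<Rightarrow> 'g set \<Rightarrow> ('g \<Rightarrow> complex) set" where
  "roots s br H = {\<alpha> \<in> dual_space s H. \<alpha> \<noteq> (\<lambda>_. 0) \<and> root_space s br H \<alpha> \<noteq> {0}}"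

text \<open>The set \<open>S\<close> of simple roots also serves as the index set \<open>I\<close>: the simple roots are indexed
  by themselves.\<close>

definition simple_roots ::
  "(complex \<Rightarrow> 'g::ab_group_add \<Rightarrow> 'g) \<Rightarrow> ('g \<Rightarrow> 'g \<Rightarrow> 'g) \<Rightarrow> 'g set \<Rightarrow> ('g \<Rightarrow> complex) set \<Rightarrow> bool" where
  "simple_roots s br H S \<longleftrightarrow>
     S \<subseteq> roots s br H \<and> finite S \<and>
     (\<forall>c :: ('g \<Rightarrow> complex) \<Rightarrow> complex.
        (\<lambda>y. \<Sum>\<alpha>\<in>S. c \<alpha> * \<alpha> y) = (\<lambda>_. 0) \<longrightarrow> (\<forall>\<alpha>\<in>S. c \<alpha> = 0)) \<and>
     (\<forall>\<beta>\<in>roots s br H. \<exists>a :: ('g \<Rightarrow> complex) \<Rightarrow> int.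
        \<beta> = (\<lambda>y. \<Sum>\<alpha>\<in>S. of_int (a \<alpha>) * \<alpha> y) \<and>
        ((\<forall>\<alpha>\<in>S. a \<alpha> \<ge> 0) \<or> (\<forall>\<alpha>\<in>S. a \<alpha> \<le> 0)))"

definition positive_roots ::
  "(complex \<Rightarrow> 'g::ab_group_add \<Rightarrow> 'g) \<Rightarrow> ('g \<Rightarrow> 'g \<Rightarrow> 'g) \<Rightarrow> 'g set \<Rightarrow> ('g \<Rightarrow> complex) set \<Rightarrow>
   ('g \<Rightarrow> complex) set" where
  "positive_roots s br H S =
     {\<beta> \<in> roots s br H. \<exists>a :: ('g \<Rightarrow> complex) \<Rightarrow> int.
        \<beta> = (\<lambda>y. \<Sum>\<alpha>\<in>S. of_int (a \<alpha>) * \<alpha> y) \<and> (\<forall>\<alpha>\<in>S. a \<alpha> \<ge> 0)}"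

definition height :: "('g \<Rightarrow> complex) set \<Rightarrow> ('g \<Rightarrow> complex) \<Rightarrow> int" where
  "height S \<beta> =
     (THE n. \<exists>a :: ('g \<Rightarrow> complex) \<Rightarrow> int.
        \<beta> = (\<lambda>y. \<Sum>\<alpha>\<in>S. of_int (a \<alpha>) * \<alpha> y) \<and> n = (\<Sum>\<alpha>\<in>S. a \<alpha>))"

text \<open>The coroot of \<open>\<alpha>\<close> is the unique element of \<open>[\<gg>\<^sub>\<alpha>, \<gg>\<^sub>-\<^sub>\<alpha>]\<close> on which \<open>\<alpha>\<close> takes the value \<open>2\<close>.\<close>

definition is_coroot ::
  "(complex \<Rightarrow> 'g::ab_group_add \<Rightarrow> 'g) \<Rightarrow> ('g \<Rightarrow> 'g \<Rightarrow> 'g) \<Rightarrow> 'g set \<Rightarrow> ('g \<Rightarrow> complex) \<Rightarrow> 'g \<Rightarrow> bool" where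
  "is_coroot s br H \<alpha> y \<longleftrightarrow>
     y \<in> module.span s {br u w | u w. u \<in> root_space s br H \<alpha> \<and>
                                      w \<in> root_space s br H (\<lambda>z. - \<alpha> z)} \<and>
     \<alpha> y = 2"

text \<open>\<open>x \<alpha>\<close> is the root vector \<open>x\<^sub>\<alpha>\<close> and \<open>h \<alpha>\<close> the coroot \<open>h\<^sub>\<alpha>\<close>; the basis consists of all \<open>x \<alpha>\<close>
  together with the \<open>h \<alpha>\<close> for simple \<open>\<alpha>\<close>.  The structure constants are Chevalley's
  \<open>\<plusminus>(r + 1)\<close>, with \<open>r\<close> the largest number such that \<open>\<beta> - r\<alpha>\<close> is a root.\<close>

definition chevalley_basis ::
  "(complex \<Rightarrow> 'g::ab_group_add \<Rightarrow> 'g) \<Rightarrow> ('g \<Rightarrow> 'g \<Rightarrow> 'g) \<Rightarrow> 'g set \<Rightarrow> ('g \<Rightarrow> complex) set \<Rightarrow>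
   (('g \<Rightarrow> complex) \<Rightarrow> 'g) \<Rightarrow> (('g \<Rightarrow> complex) \<Rightarrow> 'g) \<Rightarrow> bool" where
  "chevalley_basis s br H S x h \<longleftrightarrow>
     (\<forall>\<alpha>\<in>roots s br H. x \<alpha> \<in> root_space s br H \<alpha>) \<and>
     (\<forall>\<alpha>\<in>roots s br H. is_coroot s br H \<alpha> (h \<alpha>)) \<and>
     inj_on x (roots s br H) \<and> inj_on h S \<and> x ` roots s br H \<inter> h ` S = {} \<and>
     \<not> module.dependent s (x ` roots s br H \<union> h ` S) \<and>
     module.span s (x ` roots s br H \<union> h ` S) = UNIV \<and>
     (\<forall>\<alpha>\<in>roots s br H. br (x \<alpha>) (x (\<lambda>y. - \<alpha> y)) = h \<alpha>) \<and>
     (\<forall>\<alpha>\<in>roots s br H. \<forall>\<beta>\<in>roots s br H. (\<lambda>y. \<alpha> y + \<beta> y) \<in> roots s br H \<longrightarrow>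
        (let r = (GREATEST r :: nat. (\<lambda>y. \<beta> y - of_nat r * \<alpha> y) \<in> roots s br H)
         in br (x \<alpha>) (x \<beta>) = s (of_nat (r + 1)) (x (\<lambda>y. \<alpha> y + \<beta> y)) \<or>
            br (x \<alpha>) (x \<beta>) = s (- of_nat (r + 1)) (x (\<lambda>y. \<alpha> y + \<beta> y))))"

section \<open>The universal enveloping algebra and its integral form\<close>

text \<open>Words in the letters \<open>'a\<close> form the free monoid (written additively, as \<^typ>\<open>'a \<Rightarrow>\<^sub>0 'b\<close> requires),
  so \<open>'a word \<Rightarrow>\<^sub>0 complex\<close> is the free associative unital complex algebra on \<open>'a\<close>.\<close>

datatype 'a word = Word "'a list"

instantiation word :: (type) monoid_add
begin

definition zero_word :: "'a word" where
  "zero_word = Word []"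

fun plus_word :: "'a word \<Rightarrow> 'a word \<Rightarrow> 'a word" where
  "plus_word (Word xs) (Word ys) = Word (xs @ ys)"

instance
proof
  fix a b c :: "'a word"
  show "a + b + c = a + (b + c)"
    by (cases a; cases b; cases c) simp
  show "0 + a = a" "a + 0 = a"
    by (cases a; simp add: zero_word_def)+
qed

end

type_synonym 'a free_algebra = "'a word \<Rightarrow>\<^sub>0 complex"

definition free_gen :: "'a \<Rightarrow> 'a free_algebra" where
  "free_gen y = Poly_Mapping.single (Word [y]) 1"

definition free_const :: "complex \<Rightarrow> 'a free_algebra" where
  "free_const c = Poly_Mapping.single 0 c"

definition free_ring :: "'a free_algebra ring" where
  "free_ring = \<lparr>carrier = UNIV, mult = (*), one = 1, zero = 0, add = (+)\<rparr>"

text \<open>The first two families of relations make \<^const>\<open>free_gen\<close> linear, so that the quotient of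
  the free algebra on the underlying set is the usual quotient of the tensor algebra.\<close>

definition enveloping_ideal ::
  "(complex \<Rightarrow> 'g::ab_group_add \<Rightarrow> 'g) \<Rightarrow> ('g \<Rightarrow> 'g \<Rightarrow> 'g) \<Rightarrow> 'g free_algebra set" where
  "enveloping_ideal s br = genideal free_ring
     ({free_gen (x + y) - free_gen x - free_gen y | x y. True} \<union>
      {free_gen (s c x) - free_const c * free_gen x | c x. True} \<union>
      {free_gen x * free_gen y - free_gen y * free_gen x - free_gen (br x y) | x y. True})"

definition enveloping_algebra ::
  "(complex \<Rightarrow> 'g::ab_group_add \<Rightarrow> 'g) \<Rightarrow> ('g \<Rightarrow> 'g \<Rightarrow> 'g) \<Rightarrow> 'g free_algebra set ring" where
  "enveloping_algebra s br = FactRing free_ring (enveloping_ideal s br)"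

definition enveloping_class ::
  "(complex \<Rightarrow> 'g::ab_group_add \<Rightarrow> 'g) \<Rightarrow> ('g \<Rightarrow> 'g \<Rightarrow> 'g) \<Rightarrow> 'g free_algebra \<Rightarrow> 'g free_algebra set" where
  "enveloping_class s br t = a_r_coset free_ring (enveloping_ideal s br) t"

definition divided_power :: "'a \<Rightarrow> nat \<Rightarrow> 'a free_algebra" where
  "divided_power y m = free_const (1 / fact m) * free_gen y ^ m"

definition binomial_element :: "'a \<Rightarrow> nat \<Rightarrow> 'a free_algebra" where
  "binomial_element y m =
     free_const (1 / fact m) * prod_list (map (\<lambda>k. free_gen y - of_nat k) [0..<m])"

definition kostant_form ::
  "(complex \<Rightarrow> 'g::ab_group_add \<Rightarrow> 'g) \<Rightarrow> ('g \<Rightarrow> 'g \<Rightarrow> 'g) \<Rightarrow> 'g set \<Rightarrow> ('g \<Rightarrow> complex) set \<Rightarrow>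
   (('g \<Rightarrow> complex) \<Rightarrow> 'g) \<Rightarrow> (('g \<Rightarrow> complex) \<Rightarrow> 'g) \<Rightarrow> 'g free_algebra set set" where
  "kostant_form s br H S x h = generate_ring (enveloping_algebra s br)
     ({enveloping_class s br (divided_power (x \<alpha>) m) | \<alpha> m. \<alpha> \<in> roots s br H} \<union>
      {enveloping_class s br (binomial_element (h \<alpha>) m) | \<alpha> m. \<alpha> \<in> S})"

section \<open>Modules and the lattice generated by a highest weight vector\<close>

locale lie_module = lie_algebra s br + V: vector_space sv
  for s :: "complex \<Rightarrow> 'g::ab_group_add \<Rightarrow> 'g" and br :: "'g \<Rightarrow> 'g \<Rightarrow> 'g"
    and sv :: "complex \<Rightarrow> 'v::ab_group_add \<Rightarrow> 'v" +
  fixes \<rho> :: "'g \<Rightarrow> 'v \<Rightarrow> 'v"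
  assumes act_add_left: "\<rho> (x + y) v = \<rho> x v + \<rho> y v"
    and act_scale_left: "\<rho> (s c x) v = sv c (\<rho> x v)"
    and act_add_right: "\<rho> x (v + w) = \<rho> x v + \<rho> x w"
    and act_scale_right: "\<rho> x (sv c v) = sv c (\<rho> x v)"
    and act_br: "\<rho> (br x y) v = \<rho> x (\<rho> y v) - \<rho> y (\<rho> x v)"

definition irreducible_module ::
  "(complex \<Rightarrow> 'v::ab_group_add \<Rightarrow> 'v) \<Rightarrow> ('g \<Rightarrow> 'v \<Rightarrow> 'v) \<Rightarrow> bool" where
  "irreducible_module sv \<rho> \<longleftrightarrow>
     (\<exists>v::'v. v \<noteq> 0) \<and>
     (\<forall>W. module.subspace sv W \<and> (\<forall>y. \<forall>w\<in>W. \<rho> y w \<in> W) \<longrightarrow> W = {0} \<or> W = UNIV)"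

definition faithful_module :: "('g::zero \<Rightarrow> 'v::zero \<Rightarrow> 'v) \<Rightarrow> bool" where
  "faithful_module \<rho> \<longleftrightarrow> (\<forall>y. (\<forall>v. \<rho> y v = 0) \<longrightarrow> y = 0)"

definition dominant_integral ::
  "(complex \<Rightarrow> 'g::ab_group_add \<Rightarrow> 'g) \<Rightarrow> 'g set \<Rightarrow> ('g \<Rightarrow> complex) set \<Rightarrow>
   (('g \<Rightarrow> complex) \<Rightarrow> 'g) \<Rightarrow> ('g \<Rightarrow> complex) \<Rightarrow> bool" where
  "dominant_integral s H S h \<Lambda> \<longleftrightarrow> \<Lambda> \<in> dual_space s H \<and> (\<forall>\<alpha>\<in>S. \<Lambda> (h \<alpha>) \<in> \<nat>)"

definition highest_weight_vector ::
  "(complex \<Rightarrow> 'g::ab_group_add \<Rightarrow> 'g) \<Rightarrow> ('g \<Rightarrow> 'g \<Rightarrow> 'g) \<Rightarrow> 'g set \<Rightarrow> ('g \<Rightarrow> complex) set \<Rightarrow>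
   (complex \<Rightarrow> 'v::ab_group_add \<Rightarrow> 'v) \<Rightarrow> ('g \<Rightarrow> 'v \<Rightarrow> 'v) \<Rightarrow> ('g \<Rightarrow> complex) \<Rightarrow> 'v \<Rightarrow> bool" where
  "highest_weight_vector s br H S sv \<rho> \<Lambda> v \<longleftrightarrow>
     v \<noteq> 0 \<and> (\<forall>y\<in>H. \<rho> y v = sv (\<Lambda> y) v) \<and>
     (\<forall>\<alpha>\<in>positive_roots s br H S. \<forall>y\<in>root_space s br H \<alpha>. \<rho> y v = 0)"

definition fd_irreducible_highest_weight_module ::
  "(complex \<Rightarrow> 'g::ab_group_add \<Rightarrow> 'g) \<Rightarrow> ('g \<Rightarrow> 'g \<Rightarrow> 'g) \<Rightarrow> 'g set \<Rightarrow> ('g \<Rightarrow> complex) set \<Rightarrow>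
   (('g \<Rightarrow> complex) \<Rightarrow> 'g) \<Rightarrow>
   (complex \<Rightarrow> 'v::ab_group_add \<Rightarrow> 'v) \<Rightarrow> ('g \<Rightarrow> 'v \<Rightarrow> 'v) \<Rightarrow> ('g \<Rightarrow> complex) \<Rightarrow> 'v \<Rightarrow> bool" where
  "fd_irreducible_highest_weight_module s br H S h sv \<rho> \<Lambda> v \<longleftrightarrow>
     lie_module s br sv \<rho> \<and> (\<exists>B. finite_dimensional_vector_space sv B) \<and>
     irreducible_module sv \<rho> \<and> dominant_integral s H S h \<Lambda> \<and>
     highest_weight_vector s br H S sv \<rho> \<Lambda> v"

primrec word_action :: "('g \<Rightarrow> 'v \<Rightarrow> 'v) \<Rightarrow> 'g word \<Rightarrow> 'v \<Rightarrow> 'v" where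
  "word_action \<rho> (Word ys) v = foldr \<rho> ys v"

definition free_action ::
  "(complex \<Rightarrow> 'v::ab_group_add \<Rightarrow> 'v) \<Rightarrow> ('g \<Rightarrow> 'v \<Rightarrow> 'v) \<Rightarrow> 'g free_algebra \<Rightarrow> 'v \<Rightarrow> 'v" where
  "free_action sv \<rho> t v =
     (\<Sum>w\<in>Poly_Mapping.keys t. sv (Poly_Mapping.lookup t w) (word_action \<rho> w v))"

text \<open>The action of an element of the enveloping algebra, that is, of a coset \<open>C\<close>: all its
  representatives act in the same way.\<close>

definition enveloping_action ::
  "(complex \<Rightarrow> 'v::ab_group_add \<Rightarrow> 'v) \<Rightarrow> ('g \<Rightarrow> 'v \<Rightarrow> 'v) \<Rightarrow> 'g free_algebra set \<Rightarrow> 'v \<Rightarrow> 'v" where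
  "enveloping_action sv \<rho> C v = the_elem ((\<lambda>t. free_action sv \<rho> t v) ` C)"

definition kostant_lattice ::
  "(complex \<Rightarrow> 'g::ab_group_add \<Rightarrow> 'g) \<Rightarrow> ('g \<Rightarrow> 'g \<Rightarrow> 'g) \<Rightarrow> 'g set \<Rightarrow> ('g \<Rightarrow> complex) set \<Rightarrow>
   (('g \<Rightarrow> complex) \<Rightarrow> 'g) \<Rightarrow> (('g \<Rightarrow> complex) \<Rightarrow> 'g) \<Rightarrow>
   (complex \<Rightarrow> 'v::ab_group_add \<Rightarrow> 'v) \<Rightarrow> ('g \<Rightarrow> 'v \<Rightarrow> 'v) \<Rightarrow> 'v \<Rightarrow> 'v set" where
  "kostant_lattice s br H S x h sv \<rho> v =
     (\<lambda>C. enveloping_action sv \<rho> C v) ` kostant_form s br H S x h"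

section \<open>One-parameter subgroups\<close>

text \<open>\<open>chi sv \<rho> y t\<close> is \<open>exp (t y)\<close> acting on the module; \<^const>\<open>Sum_any\<close> is the sum over the finitely
  many nonzero terms, finiteness being guaranteed when \<open>y\<close> acts nilpotently.\<close>

definition chi ::
  "(complex \<Rightarrow> 'v::ab_group_add \<Rightarrow> 'v) \<Rightarrow> ('g \<Rightarrow> 'v \<Rightarrow> 'v) \<Rightarrow> 'g \<Rightarrow> rat \<Rightarrow> 'v \<Rightarrow> 'v" where
  "chi sv \<rho> y t v = Sum_any (\<lambda>k. sv (of_rat t ^ k / fact k) ((\<rho> y ^^ k) v))"

end

theory Submission
  imports Defs
begin

text \<open>Let \<open>M\<close> be the additive group spanned by the vectors \<open>f\<^sub>i\<^sup>(\<^sup>m\<^sup>) \<cdots> f\<^sub>j\<^sup>(\<^sup>n\<^sup>) v\<close>, where \<open>f\<^sub>i\<close> is the root vector of the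
  negative of a simple root.  For \<open>w\<close> of \<open>h\<close>-weight \<open>c\<close> in an \<open>sl\<^sub>2\<close>-module, \<open>e\<^sup>(\<^sup>n\<^sup>) f\<^sup>(\<^sup>m\<^sup>) w\<close> is the sum over \<open>t\<close> of
  \<open>binom(c - m + n, t) f\<^sup>(\<^sup>m\<^sup>-\<^sup>t\<^sup>) e\<^sup>(\<^sup>n\<^sup>-\<^sup>t\<^sup>) w\<close>; hence the divided powers of the \<open>e\<^sub>i\<close> preserve \<open>M\<close>, and so do the
  automorphisms \<open>exp e\<^sub>i exp (-f\<^sub>i) exp e\<^sub>i\<close>.  These carry \<open>x\<^sub>\<gamma>\<close> to an integer multiple of the root vector of
  the reflected root, and a positive root which is not simple can be lowered by a simple reflection.  So the
  divided powers of all root vectors preserve \<open>M\<close>, which means that \<open>M\<close> is the Kostant lattice.  Therefore that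
  lattice is graded by the weights, with component \<open>\<int> v\<close> at the highest weight, and none of its nonzero
  elements is divisible by arbitrarily large integers.

  After cancelling the leading factors with integral parameter, let \<open>\<chi>\<^sub>\<beta>(q)\<close> be the first remaining factor.
  Compatibility with the height implies that for \<open>w\<close> of weight \<open>\<mu>\<close> in the lattice, the component of \<open>u w\<close> of
  weight \<open>\<mu> + \<beta>\<close> is \<open>q x\<^sub>\<beta> w\<close>, so that \<open>q x\<^sub>\<beta>\<close> preserves the lattice.  If \<open>q\<close> is not an integer, then \<open>x\<^sub>\<beta> / b\<close>
  preserves it for some \<open>b \<ge> 2\<close>, hence so does \<open>x\<^sub>-\<^sub>\<beta> / b\<close>, hence \<open>2 x\<^sub>\<beta> / b\<^sup>3\<close>; iterating this contradicts the
  bound on divisibility.\<close>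

section \<open>Divided powers and exponentials in modules\<close>

context lie_algebra
begin

lemma br_zero_left [simp]: "br 0 y = 0"
  using br_add_left[of 0 0 y] by simp

lemma br_zero_right [simp]: "br y 0 = 0"
  using br_add_right[of y 0 0] by simp

lemma br_skew: "br y z = - br z y"
proof -
  have "br (y + z) (y + z) = br y z + br z y"
    unfolding br_add_left br_add_right by (simp add: br_self)
  then have "br y z + br z y = 0"
    by (metis br_self)
  then show ?thesis
    by (simp add: eq_neg_iff_add_eq_0)
qed

lemma br_minus_right [simp]: "br y (- z) = - br y z"
  using br_scale_right[of y "-1" z] by simp

text \<open>The Jacobi identity, rewritten by skew symmetry as the module axiom
  \<open>act_br\<close> for the adjoint action.\<close>

lemma br_br: "br (br y z) w = br y (br z w) - br z (br y w)"
proof -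
  have "br y (br z w) + br z (br w y) + br w (br y z) = 0"
    by (rule jacobi)
  then show ?thesis
    using br_skew[of w "br y z"] br_skew[of w y] by (simp add: algebra_simps)
qed

text \<open>Viewing the algebra as a module over itself makes all later facts on divided powers,
  exponentials and weight spaces available for the bracket, with prefix \<open>ad\<close>.\<close>

sublocale ad: lie_module s br s br
  by unfold_locales (auto simp: br_add_left br_add_right br_scale_left br_scale_right br_br)

end

context lie_module
begin

lemma act_zero_left [simp]: "\<rho> 0 w = 0"
  using act_add_left[of 0 0 w] by simp

lemma act_zero_right [simp]: "\<rho> y 0 = 0"
  using act_add_right[of y 0 0] by simp

lemma act_minus_right [simp]: "\<rho> y (- w) = - \<rho> y w"
  using act_scale_right[of y "-1" w] by simp

lemma act_minus_left [simp]: "\<rho> (- y) w = - \<rho> y w"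
  using act_scale_left[of "-1" y w] by simp

lemma act_diff_right: "\<rho> y (w - w') = \<rho> y w - \<rho> y w'"
  using act_add_right[of y w "- w'"] by simp

lemma act_sum_right: "\<rho> y (\<Sum>i\<in>F. f i) = (\<Sum>i\<in>F. \<rho> y (f i))"
  by (induction F rule: infinite_finite_induct) (auto simp: act_add_right)

lemma act_sum_left: "\<rho> (\<Sum>i\<in>F. f i) w = (\<Sum>i\<in>F. \<rho> (f i) w)"
  by (induction F rule: infinite_finite_induct) (auto simp: act_add_left)

lemma act_commute: "\<rho> y (\<rho> z w) = \<rho> z (\<rho> y w) + \<rho> (br y z) w"
  by (simp add: act_br)

text \<open>Divided powers as operators on the module. They are the coefficients of
  \<open>chi\<close>, and all integrality statements concern them rather than ordinary
  powers.\<close>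

definition dp :: "nat \<Rightarrow> 'g \<Rightarrow> 'v \<Rightarrow> 'v" where
  "dp n y w = sv (1 / fact n) ((\<rho> y ^^ n) w)"

lemma dp_0 [simp]: "dp 0 y w = w"
  by (simp add: dp_def)

lemma act_dp: "\<rho> y (dp n y w) = sv (of_nat (Suc n)) (dp (Suc n) y w)"
  by (simp add: dp_def act_scale_right field_simps del: of_nat_Suc)

lemma dp_Suc: "dp (Suc n) y w = sv (1 / of_nat (Suc n)) (\<rho> y (dp n y w))"
  by (simp add: act_dp del: of_nat_Suc)

lemma dp_1 [simp]: "dp (Suc 0) y w = \<rho> y w"
  by (simp add: dp_Suc)

lemma dp_add: "dp n y (w + w') = dp n y w + dp n y w'"
  by (induction n) (auto simp: dp_Suc act_add_right V.scale_right_distrib)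

lemma dp_scale: "dp n y (sv c w) = sv c (dp n y w)"
  by (induction n) (auto simp: dp_Suc act_scale_right mult.commute)

lemma dp_zero [simp]: "dp n y 0 = 0"
  using dp_scale[of n y 0 0] by simp

lemma dp_minus [simp]: "dp n y (- w) = - dp n y w"
  using dp_scale[of n y "-1" w] by simp

lemma dp_diff: "dp n y (w - w') = dp n y w - dp n y w'"
  using dp_add[of n y w "- w'"] by simp

lemma dp_sum: "dp n y (\<Sum>i\<in>F. f i) = (\<Sum>i\<in>F. dp n y (f i))"
  by (induction F rule: infinite_finite_induct) (auto simp: dp_add)

lemma dp_scale_left: "dp n (s c y) w = sv (c ^ n) (dp n y w)"
  by (induction n) (auto simp: dp_Suc act_scale_left act_scale_right mult.commute)

lemma dp_dp: "dp m y (dp n y w) = sv (of_nat ((m + n) choose m)) (dp (m + n) y w)"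
proof -
  have "dp m y (dp n y w) = sv (1 / fact m * (1 / fact n)) ((\<rho> y ^^ (m + n)) w)"
    by (subst (2) dp_def, subst dp_scale) (simp add: dp_def funpow_add mult.commute)
  also have "1 / fact m * (1 / fact n) = (of_nat ((m + n) choose m) * (1 / fact (m + n)) :: complex)"
    by (simp add: binomial_fact)
  finally show ?thesis
    by (simp add: dp_def)
qed

end

section \<open>Leibniz rule, local nilpotence and exponentials as finite sums\<close>

context lie_module
begin

lemma sum_shift_weighted:
  assumes "\<And>j. j \<le> n \<Longrightarrow> g j = sv (of_nat (Suc j)) (f (Suc j))"
  shows "(\<Sum>j\<le>n. g j) = (\<Sum>j\<le>Suc n. sv (of_nat j) (f j))"
  by (subst sum.atMost_Suc_shift) (simp add: assms del: of_nat_Suc)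

text \<open>Since \<open>y\<close> acts as a derivation, one more application of \<open>y\<close>
  produces the \<open>i\<close>-th term with the weights \<open>i\<close> and
  \<open>Suc n - i\<close>. They add up to \<open>Suc n\<close>, which is then cancelled.\<close>

lemma dp_leibniz: "dp n y (\<rho> z w) = (\<Sum>i\<le>n. \<rho> (ad.dp i y z) (dp (n - i) y w))"
proof (induction n)
  case (Suc n)
  let ?T = "\<lambda>i. \<rho> (ad.dp i y z) (dp (Suc n - i) y w)"
  have "sv (of_nat (Suc n)) (dp (Suc n) y (\<rho> z w)) = \<rho> y (dp n y (\<rho> z w))"
    by (simp only: act_dp)
  also have "\<dots> = (\<Sum>i\<le>n. \<rho> (br y (ad.dp i y z)) (dp (n - i) y w)) +
      (\<Sum>i\<le>n. \<rho> (ad.dp i y z) (\<rho> y (dp (n - i) y w)))"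
    unfolding Suc.IH act_sum_right sum.distrib[symmetric] by (rule sum.cong) (auto simp: act_br)
  also have "(\<Sum>i\<le>n. \<rho> (br y (ad.dp i y z)) (dp (n - i) y w)) = (\<Sum>i\<le>Suc n. sv (of_nat i) (?T i))"
    by (rule sum_shift_weighted) (simp add: ad.act_dp act_scale_left del: of_nat_Suc)
  also have "(\<Sum>i\<le>n. \<rho> (ad.dp i y z) (\<rho> y (dp (n - i) y w))) =
      (\<Sum>i\<le>Suc n. sv (of_nat (Suc n - i)) (?T i))"
    by (auto simp: act_dp act_scale_right Suc_diff_le simp del: of_nat_Suc of_nat_diff intro!: sum.cong)
  also have "(\<Sum>i\<le>Suc n. sv (of_nat i) (?T i)) + (\<Sum>i\<le>Suc n. sv (of_nat (Suc n - i)) (?T i)) =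
      (\<Sum>i\<le>Suc n. sv (of_nat (Suc n)) (?T i))"
    unfolding sum.distrib[symmetric]
    by (rule sum.cong) (auto simp: V.scale_left_distrib[symmetric] of_nat_add[symmetric] simp del: of_nat_add of_nat_Suc)
  also have "\<dots> = sv (of_nat (Suc n)) (\<Sum>i\<le>Suc n. ?T i)"
    by (simp only: V.scale_sum_right)
  finally show ?case
    by (simp del: of_nat_Suc sum.atMost_Suc)
qed simp

definition locally_nilpotent :: "'g \<Rightarrow> bool" where
  "locally_nilpotent y \<longleftrightarrow> (\<forall>w. \<exists>k. (\<rho> y ^^ k) w = 0)"

lemma funpow_act_zero: "(\<rho> y ^^ k) 0 = 0"
  by (induction k) auto

lemma dp_vanish:
  assumes "(\<rho> y ^^ k) w = 0" "k \<le> n"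
  shows "dp n y w = 0"
proof -
  have "(\<rho> y ^^ n) w = (\<rho> y ^^ (n - k)) ((\<rho> y ^^ k) w)"
    using assms(2) by (metis comp_apply funpow_add le_add_diff_inverse2)
  then show ?thesis
    by (simp add: dp_def assms(1) funpow_act_zero)
qed

lemma locally_nilpotentE:
  assumes "locally_nilpotent y"
  obtains K where "\<And>n. K \<le> n \<Longrightarrow> dp n y w = 0"
  using assms dp_vanish unfolding locally_nilpotent_def by blast

text \<open>The bound \<open>K\<close> need not be sharp, so several exponentials can be expanded
  over a common range.\<close>

lemma chi_eq:
  assumes "\<And>n. K \<le> n \<Longrightarrow> dp n y w = 0"
  shows "chi sv \<rho> y t w = (\<Sum>k<K. sv (of_rat t ^ k) (dp k y w))"
proof -
  have "chi sv \<rho> y t w = Sum_any (\<lambda>k. sv (of_rat t ^ k) (dp k y w))"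
    unfolding chi_def dp_def by (simp only: V.scale_scale times_divide_eq_right mult_1_right)
  also have "\<dots> = (\<Sum>k<K. sv (of_rat t ^ k) (dp k y w))"
  proof (rule Sum_any.expand_superset)
    show "{a. sv (of_rat t ^ a) (dp a y w) \<noteq> 0} \<subseteq> {..<K}"
      using assms by clarsimp (meson V.scale_eq_0_iff not_less)
  qed simp
  finally show ?thesis .
qed

lemma chi_add:
  assumes "locally_nilpotent y"
  shows "chi sv \<rho> y t (w + w') = chi sv \<rho> y t w + chi sv \<rho> y t w'"
proof -
  obtain K K' where K: "\<And>n. K \<le> n \<Longrightarrow> dp n y w = 0" "\<And>n. K' \<le> n \<Longrightarrow> dp n y w' = 0"
    using locally_nilpotentE[OF assms] by metis
  show ?thesis
    using K by (simp add: chi_eq[where K = "max K K'"] dp_add V.scale_right_distrib sum.distrib)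
qed

lemma chi_scale:
  assumes "locally_nilpotent y"
  shows "chi sv \<rho> y t (sv c w) = sv c (chi sv \<rho> y t w)"
proof -
  obtain K where K: "\<And>n. K \<le> n \<Longrightarrow> dp n y w = 0"
    using locally_nilpotentE[OF assms] by metis
  show ?thesis
    using K by (simp add: chi_eq[where K = K] dp_scale V.scale_sum_right mult.commute)
qed

lemma chi_zero [simp]: "chi sv \<rho> y t 0 = 0"
  using chi_eq[of 0 y 0 t] by simp

lemma chi_diff:
  assumes "locally_nilpotent y"
  shows "chi sv \<rho> y t (w - w') = chi sv \<rho> y t w - chi sv \<rho> y t w'"
  using chi_add[OF assms, of t "w - w'" w'] by simp

text \<open>Only the coefficient at \<open>k = 0\<close> survives, so the sum is finite for every
  \<open>y\<close>.\<close>

lemma chi_time_0 [simp]: "chi sv \<rho> y 0 w = w"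
proof -
  have "chi sv \<rho> y 0 w = Sum_any (\<lambda>k. sv (0 ^ k) (dp k y w))"
    unfolding chi_def dp_def by (simp only: V.scale_scale times_divide_eq_right mult_1_right of_rat_0)
  also have "\<dots> = (\<Sum>k\<in>{0}. sv (0 ^ k) (dp k y w))"
    by (rule Sum_any.expand_superset) (auto simp: power_0_left)
  finally show ?thesis by simp
qed

end

section \<open>Group law and conjugation formula for exponentials\<close>

context lie_module
begin

text \<open>A Cauchy product: the triangle contains the rectangle, and all terms outside the
  rectangle vanish.\<close>

lemma sum_triangle:
  fixes f :: "nat \<Rightarrow> nat \<Rightarrow> 'v"
  assumes "\<And>i j. K \<le> i \<or> L \<le> j \<Longrightarrow> f i j = 0"
  shows "(\<Sum>n<K + L. \<Sum>i\<le>n. f i (n - i)) = (\<Sum>i<K. \<Sum>j<L. f i j)"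
proof -
  have "(\<Sum>n<K + L. \<Sum>i\<le>n. f i (n - i)) = (\<Sum>(i,j)\<in>{(i,j). i + j < K + L}. f i j)"
    by (rule sum.triangle_reindex[symmetric])
  also have "\<dots> = (\<Sum>(i,j)\<in>{..<K} \<times> {..<L}. f i j)"
  proof (rule sum.mono_neutral_right)
    show "finite {(i, j). i + j < K + L}"
      by (rule finite_subset[of _ "{..<K+L} \<times> {..<K+L}"]) auto
    show "\<forall>p\<in>{(i, j). i + j < K + L} - {..<K} \<times> {..<L}. (case p of (i, j) \<Rightarrow> f i j) = 0"
      by clarsimp (meson assms not_less)
  qed auto
  finally show ?thesis
    by (simp add: sum.cartesian_product)
qed

text \<open>The product of two divided powers contributes a binomial coefficient, and the binomial
  theorem collects the terms of equal degree.\<close>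

lemma chi_chi:
  assumes "locally_nilpotent y"
  shows "chi sv \<rho> y t (chi sv \<rho> y t' w) = chi sv \<rho> y (t + t') w"
proof -
  obtain K where K: "\<And>n. K \<le> n \<Longrightarrow> dp n y w = 0"
    using locally_nilpotentE[OF assms] by metis
  let ?a = "of_rat t :: complex" and ?b = "of_rat t' :: complex"
  let ?f = "\<lambda>i j. sv (?a ^ i * ?b ^ j * of_nat ((i + j) choose i)) (dp (i + j) y w)"
  have 1: "chi sv \<rho> y t' w = (\<Sum>j<K. sv (?b ^ j) (dp j y w))"
    by (rule chi_eq) (rule K)
  have 2: "dp n y (chi sv \<rho> y t' w) = (\<Sum>j<K. sv (?b ^ j * of_nat ((n + j) choose n)) (dp (n + j) y w))" for n
    by (simp add: 1 dp_sum dp_scale dp_dp)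
  have "chi sv \<rho> y t (chi sv \<rho> y t' w) = (\<Sum>i<K. sv (?a ^ i) (dp i y (chi sv \<rho> y t' w)))"
    by (rule chi_eq) (simp add: 2 K)
  also have "\<dots> = (\<Sum>i<K. \<Sum>j<K. ?f i j)"
    by (simp add: 2 V.scale_sum_right mult.assoc)
  also have "\<dots> = (\<Sum>n<K + K. \<Sum>i\<le>n. ?f i (n - i))"
    by (rule sum_triangle[symmetric]) (auto simp: K)
  also have "\<dots> = (\<Sum>n<K + K. sv (of_rat (t + t') ^ n) (dp n y w))"
  proof (rule sum.cong[OF refl])
    fix n
    have "(\<Sum>i\<le>n. ?f i (n - i)) = sv (\<Sum>i\<le>n. of_nat (n choose i) * ?a ^ i * ?b ^ (n - i)) (dp n y w)"
      by (simp add: V.scale_sum_left mult_ac)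
    then show "(\<Sum>i\<le>n. ?f i (n - i)) = sv (of_rat (t + t') ^ n) (dp n y w)"
      by (simp add: binomial_ring of_rat_add)
  qed
  also have "\<dots> = chi sv \<rho> y (t + t') w"
    by (rule chi_eq[symmetric]) (simp add: K)
  finally show ?thesis .
qed

lemma chi_inverse:
  assumes "locally_nilpotent y"
  shows "chi sv \<rho> y (- t) (chi sv \<rho> y t w) = w" "chi sv \<rho> y t (chi sv \<rho> y (- t) w) = w"
  by (simp_all add: chi_chi[OF assms])

text \<open>The Leibniz rule summed over all degrees. It says that conjugation by
  \<open>exp (t y)\<close> on the module is \<open>exp (t ad y)\<close> on the algebra.\<close>

lemma chi_act:
  assumes "locally_nilpotent y" "ad.locally_nilpotent y"
  shows "chi sv \<rho> y t (\<rho> z w) = \<rho> (chi s br y t z) (chi sv \<rho> y t w)"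
proof -
  obtain K where K: "\<And>n. K \<le> n \<Longrightarrow> ad.dp n y z = 0"
    using ad.locally_nilpotentE[OF assms(2)] by metis
  obtain L where L: "\<And>n. L \<le> n \<Longrightarrow> dp n y w = 0"
    using locally_nilpotentE[OF assms(1)] by metis
  let ?a = "of_rat t :: complex"
  let ?f = "\<lambda>i j. sv (?a ^ (i + j)) (\<rho> (ad.dp i y z) (dp j y w))"
  have "chi sv \<rho> y t (\<rho> z w) = (\<Sum>n<K + L. sv (?a ^ n) (dp n y (\<rho> z w)))"
  proof (rule chi_eq)
    fix n assume "K + L \<le> n"
    then have "K \<le> i \<or> L \<le> n - i" for i
      by linarith
    then have "\<rho> (ad.dp i y z) (dp (n - i) y w) = 0" for i
      using K L act_zero_left act_zero_right by metis
    then show "dp n y (\<rho> z w) = 0"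
      by (simp add: dp_leibniz)
  qed
  also have "\<dots> = (\<Sum>n<K + L. \<Sum>i\<le>n. ?f i (n - i))"
    by (rule sum.cong[OF refl]) (simp add: dp_leibniz V.scale_sum_right)
  also have "\<dots> = (\<Sum>i<K. \<Sum>j<L. ?f i j)"
    by (rule sum_triangle) (metis K L act_zero_left act_zero_right V.scale_zero_right)
  also have "\<dots> = \<rho> (\<Sum>i<K. s (?a ^ i) (ad.dp i y z)) (\<Sum>j<L. sv (?a ^ j) (dp j y w))"
    by (subst sum.swap)
      (simp add: act_sum_left act_sum_right act_scale_left act_scale_right power_add V.scale_sum_right mult.commute)
  also have "\<dots> = \<rho> (chi s br y t z) (chi sv \<rho> y t w)"
    using chi_eq[of L y w t] ad.chi_eq[of K y z t] K L by simp
  finally show ?thesis .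
qed

end

section \<open>Weight spaces\<close>

lemma dual_space_0: "(\<lambda>_. 0) \<in> dual_space s H"
  by (simp add: dual_space_def)

lemma dual_space_add:
  "\<mu> \<in> dual_space s H \<Longrightarrow> \<nu> \<in> dual_space s H \<Longrightarrow> (\<lambda>y. \<mu> y + \<nu> y) \<in> dual_space s H"
  by (auto simp: dual_space_def algebra_simps)

lemma dual_space_scale: "\<mu> \<in> dual_space s H \<Longrightarrow> (\<lambda>y. c * \<mu> y) \<in> dual_space s H"
  by (auto simp: dual_space_def algebra_simps)

lemma dual_space_sum:
  "(\<And>i. i \<in> F \<Longrightarrow> f i \<in> dual_space s H) \<Longrightarrow> (\<lambda>y. \<Sum>i\<in>F. f i y) \<in> dual_space s H"
  by (auto simp: dual_space_def sum.distrib sum_distrib_left)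

text \<open>Functionals are extended by 0 outside \<open>H\<close>, so a point where two of them
  differ must lie in \<open>H\<close>.\<close>

lemma dual_space_neq:
  assumes "\<mu> \<in> dual_space s H" "\<nu> \<in> dual_space s H" "\<mu> \<noteq> \<nu>"
  obtains y where "y \<in> H" "\<mu> y \<noteq> \<nu> y"
proof -
  obtain y where y: "\<mu> y \<noteq> \<nu> y"
    using assms(3) by blast
  then have "y \<in> H"
    using assms(1,2) unfolding dual_space_def by (metis (mono_tags, lifting) mem_Collect_eq)
  then show ?thesis
    using that y by blast
qed

context lie_module
begin

definition weight_space :: "'g set \<Rightarrow> ('g \<Rightarrow> complex) \<Rightarrow> 'v set" where
  "weight_space H \<mu> = {w. \<forall>y\<in>H. \<rho> y w = sv (\<mu> y) w}"

text \<open>Membership expresses that the component of weight \<nu> is zero. Statements about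
  components are made modulo this subspace, which avoids projection maps.\<close>

definition off_weight :: "'g set \<Rightarrow> ('g \<Rightarrow> complex) \<Rightarrow> 'v set" where
  "off_weight H \<nu> = V.span (\<Union>\<mu>\<in>dual_space s H - {\<nu>}. weight_space H \<mu>)"

lemma weight_spaceD: "w \<in> weight_space H \<mu> \<Longrightarrow> y \<in> H \<Longrightarrow> \<rho> y w = sv (\<mu> y) w"
  by (simp add: weight_space_def)

lemma subspace_weight_space: "V.subspace (weight_space H \<mu>)"
  by (auto simp: V.subspace_def weight_space_def act_add_right act_scale_right V.scale_right_distrib mult.commute)

lemma subspace_off_weight: "V.subspace (off_weight H \<nu>)"
  by (simp add: off_weight_def)

lemma weight_space_off:
  "w \<in> weight_space H \<mu> \<Longrightarrow> \<mu> \<in> dual_space s H \<Longrightarrow> \<mu> \<noteq> \<nu> \<Longrightarrow> w \<in> off_weight H \<nu>"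
  unfolding off_weight_def by (rule V.span_base) auto

text \<open>Choose \<open>y\<close> with \<open>\<kappa> y \<noteq> \<nu> y\<close>, apply
  \<open>y\<close> to the relation and subtract \<open>\<nu> y\<close> times the relation. The term
  of \<nu> disappears and the induction hypothesis applies to the rest.\<close>

lemma weight_spaces_independent:
  assumes "finite F" "F \<subseteq> dual_space s H" "\<And>\<mu>. \<mu> \<in> F \<Longrightarrow> f \<mu> \<in> weight_space H \<mu>"
    and "(\<Sum>\<mu>\<in>F. f \<mu>) = 0" "\<mu> \<in> F"
  shows "f \<mu> = 0"
  using assms
proof (induction F arbitrary: f \<mu> rule: finite_induct)
  case (insert \<nu> F)
  have zero: "f \<kappa> = 0" if \<kappa>: "\<kappa> \<in> F" for \<kappa>
  proof -
    obtain y where y: "y \<in> H" "\<kappa> y \<noteq> \<nu> y"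
      using dual_space_neq[of \<kappa> s H \<nu>] insert.hyps(2) insert.prems(1) \<kappa> by auto
    have act: "\<rho> y (f \<iota>) = sv (\<iota> y) (f \<iota>)" if "\<iota> \<in> insert \<nu> F" for \<iota>
      using insert.prems(2)[OF that] y(1) by (simp add: weight_space_def)
    have "\<rho> y (\<Sum>\<iota>\<in>insert \<nu> F. f \<iota>) = 0" "(\<Sum>\<iota>\<in>insert \<nu> F. sv (\<nu> y) (f \<iota>)) = 0"
      using insert.prems(3) by (simp_all flip: V.scale_sum_right)
    then have "(\<Sum>\<iota>\<in>insert \<nu> F. sv (\<iota> y - \<nu> y) (f \<iota>)) = 0"
      by (simp add: act_sum_right act V.scale_left_diff_distrib sum_subtractf del: sum.insert)
    then have "(\<Sum>\<iota>\<in>F. sv (\<iota> y - \<nu> y) (f \<iota>)) = 0"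
      using insert.hyps by simp
    then have "sv (\<kappa> y - \<nu> y) (f \<kappa>) = 0"
      using insert.prems(1,2) \<kappa> insert.IH[of "\<lambda>\<iota>. sv (\<iota> y - \<nu> y) (f \<iota>)" \<kappa>]
        V.subspace_scale[OF subspace_weight_space] by blast
    then show "f \<kappa> = 0"
      using y(2) by simp
  qed
  then have "f \<nu> = 0"
    using insert.prems(3) insert.hyps by simp
  with zero show ?case
    using insert.prems(4) by auto
qed simp

lemma span_weight_spaces:
  assumes "w \<in> V.span (\<Union>\<mu>\<in>D. weight_space H \<mu>)"
  obtains F f where "finite F" "F \<subseteq> D" "\<And>\<mu>. \<mu> \<in> F \<Longrightarrow> f \<mu> \<in> weight_space H \<mu>" "w = (\<Sum>\<mu>\<in>F. f \<mu>)"
proof -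
  have "\<exists>F f. finite F \<and> F \<subseteq> D \<and> (\<forall>\<mu>\<in>F. f \<mu> \<in> weight_space H \<mu>) \<and> w = (\<Sum>\<mu>\<in>F. f \<mu>)"
    using assms
  proof (induction w rule: V.span_induct_alt)
    case base
    show ?case by (rule exI[of _ "{}"]) auto
  next
    case (step c a b)
    then obtain F f \<nu> where F: "finite F" "F \<subseteq> D" "\<forall>\<mu>\<in>F. f \<mu> \<in> weight_space H \<mu>" "b = (\<Sum>\<mu>\<in>F. f \<mu>)"
      and \<nu>: "\<nu> \<in> D" "a \<in> weight_space H \<nu>" by blast
    define g where "g = f(\<nu> := sv c a + (if \<nu> \<in> F then f \<nu> else 0))"
    have "(\<Sum>\<mu>\<in>insert \<nu> F. g \<mu>) = g \<nu> + (\<Sum>\<mu>\<in>F - {\<nu>}. g \<mu>)"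
      using F(1) by (simp add: sum.insert_remove)
    also have "(\<Sum>\<mu>\<in>F - {\<nu>}. g \<mu>) = (\<Sum>\<mu>\<in>F - {\<nu>}. f \<mu>)"
      by (rule sum.cong) (auto simp: g_def)
    also have "g \<nu> + \<dots> = sv c a + b"
      using F(1) by (auto simp: g_def F(4) sum.remove)
    finally have "sv c a + b = (\<Sum>\<mu>\<in>insert \<nu> F. g \<mu>)" ..
    moreover have "\<forall>\<mu>\<in>insert \<nu> F. g \<mu> \<in> weight_space H \<mu>"
      using F(3) \<nu>(2) subspace_weight_space[of H \<nu>]
      by (auto simp: g_def intro!: V.subspace_add V.subspace_scale V.subspace_0)
    ultimately show ?case
      using F(1,2) \<nu>(1) by (intro exI[of _ "insert \<nu> F"] exI[of _ g]) auto
  qed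
  then show ?thesis
    using that by blast
qed

lemma weight_space_Int_off:
  assumes "\<nu> \<in> dual_space s H" "w \<in> weight_space H \<nu>" "w \<in> off_weight H \<nu>"
  shows "w = 0"
proof -
  obtain F f where F: "finite F" "F \<subseteq> dual_space s H - {\<nu>}" "\<And>\<mu>. \<mu> \<in> F \<Longrightarrow> f \<mu> \<in> weight_space H \<mu>"
    "w = (\<Sum>\<mu>\<in>F. f \<mu>)"
    using span_weight_spaces assms(3) unfolding off_weight_def by metis
  \<comment> \<open>Moving \<open>w\<close> to the other side yields a vanishing sum of vectors of
    distinct weights.\<close>
  define g where "g = f(\<nu> := - w)"
  have "(\<Sum>\<mu>\<in>F. g \<mu>) = (\<Sum>\<mu>\<in>F. f \<mu>)"
    by (rule sum.cong) (use F(2) in \<open>auto simp: g_def\<close>)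
  then have "(\<Sum>\<mu>\<in>insert \<nu> F. g \<mu>) = 0"
    using F(1,2,4) by (subst sum.insert) (auto simp: g_def)
  moreover have "g \<mu> \<in> weight_space H \<mu>" if "\<mu> \<in> insert \<nu> F" for \<mu>
    using that F(3) assms(2) V.subspace_neg[OF subspace_weight_space] by (auto simp: g_def)
  ultimately have "g \<nu> = 0"
    using weight_spaces_independent[of "insert \<nu> F" H g \<nu>] F(1,2) assms(1) by auto
  then show ?thesis
    by (simp add: g_def)
qed

lemma weight_space_shift:
  assumes "y \<in> root_space s br H \<alpha>" "w \<in> weight_space H \<mu>"
  shows "\<rho> y w \<in> weight_space H (\<lambda>z. \<mu> z + \<alpha> z)"
  using assms by (auto simp: weight_space_def root_space_def act_commute[of _ y] act_scale_right
      act_scale_left V.scale_left_distrib)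

lemma weight_space_dp:
  assumes "y \<in> root_space s br H \<alpha>" "w \<in> weight_space H \<mu>"
  shows "dp n y w \<in> weight_space H (\<lambda>z. \<mu> z + of_nat n * \<alpha> z)"
proof (induction n)
  case (Suc n)
  then show ?case
    using V.subspace_scale[OF subspace_weight_space weight_space_shift[OF assms(1) Suc]]
    by (simp add: dp_Suc algebra_simps)
qed (use assms in simp)

text \<open>The weights \<open>\<mu> + k \<alpha>\<close> are pairwise distinct. In finite dimension
  a string of such vectors therefore cannot stay nonzero forever.\<close>

lemma weight_vectors_independent:
  assumes "\<alpha> \<in> dual_space s H" "\<alpha> \<noteq> (\<lambda>_. 0)" "\<mu> \<in> dual_space s H"
    and "\<And>k. u k \<in> weight_space H (\<lambda>y. \<mu> y + of_nat k * \<alpha> y)" "\<And>k. u k \<noteq> 0"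
  shows "V.independent (u ` {..<n}) \<and> card (u ` {..<n}) = n"
proof (induction n)
  case (Suc n)
  let ?\<nu> = "\<lambda>k y. \<mu> y + of_nat k * \<alpha> y"
  have dual: "?\<nu> k \<in> dual_space s H" for k
    by (intro dual_space_add dual_space_scale assms)
  have "?\<nu> k \<noteq> ?\<nu> n" if "k < n" for k
    using assms(2) that by (auto simp: fun_eq_iff)
  then have "u ` {..<n} \<subseteq> off_weight H (?\<nu> n)"
    using weight_space_off[OF assms(4) dual] by blast
  then have "V.span (u ` {..<n}) \<subseteq> off_weight H (?\<nu> n)"
    by (rule V.span_minimal) (rule subspace_off_weight)
  then have "u n = 0" if "u n \<in> V.span (u ` {..<n})"
    using weight_space_Int_off[OF dual assms(4)] that by (simp add: subset_iff)
  then have notin: "u n \<notin> V.span (u ` {..<n})"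
    using assms(5) by metis
  then have "u n \<notin> u ` {..<n}"
    by (metis V.span_base)
  then show ?case
    using notin Suc by (simp add: lessThan_Suc V.independent_insert)
qed (simp add: V.independent_empty)

text \<open>The vectors killed by some power of \<open>y\<close> form a subspace. It contains every
  weight vector, as otherwise the divided powers would give independent sets of every size.\<close>

lemma root_vector_locally_nilpotent:
  assumes "V.span (\<Union>\<mu>\<in>dual_space s H. weight_space H \<mu>) = UNIV"
    and "\<exists>B. finite_dimensional_vector_space sv B"
    and "y \<in> root_space s br H \<alpha>" "\<alpha> \<in> dual_space s H" "\<alpha> \<noteq> (\<lambda>_. 0)"
  shows "locally_nilpotent y"
proof -
  obtain B where "finite_dimensional_vector_space sv B"
    using assms(2) by blast
  then interpret fd: finite_dimensional_vector_space sv B .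
  let ?N = "{w. \<exists>k. (\<rho> y ^^ k) w = 0}"
  have pow_add: "(\<rho> y ^^ k) (w + w') = (\<rho> y ^^ k) w + (\<rho> y ^^ k) w'" for k w w'
    by (induction k) (auto simp: act_add_right)
  have pow_scale: "(\<rho> y ^^ k) (sv c w) = sv c ((\<rho> y ^^ k) w)" for k c w
    by (induction k) (auto simp: act_scale_right)
  have pow_mono: "(\<rho> y ^^ l) w = 0" if "(\<rho> y ^^ k) w = 0" "k \<le> l" for k l w
  proof -
    have "(\<rho> y ^^ l) w = (\<rho> y ^^ (l - k)) ((\<rho> y ^^ k) w)"
      using that(2) by (metis comp_apply funpow_add le_add_diff_inverse2)
    then show ?thesis
      by (simp add: that(1) funpow_act_zero)
  qed
  have "V.subspace ?N"
    unfolding V.subspace_def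
  proof (intro conjI ballI allI)
    show "0 \<in> ?N" by (simp add: funpow_act_zero)
    fix w w' assume "w \<in> ?N" "w' \<in> ?N"
    then obtain k k' where "(\<rho> y ^^ k) w = 0" "(\<rho> y ^^ k') w' = 0" by blast
    then show "w + w' \<in> ?N"
      using pow_mono[of k w "max k k'"] pow_mono[of k' w' "max k k'"]
      by (auto intro!: exI[of _ "max k k'"] simp: pow_add)
  qed (auto simp: pow_scale)
  moreover have "(\<Union>\<mu>\<in>dual_space s H. weight_space H \<mu>) \<subseteq> ?N"
  proof (rule UN_least, rule subsetI)
    fix \<mu> w assume \<mu>: "\<mu> \<in> dual_space s H" and w: "w \<in> weight_space H \<mu>"
    have "\<exists>k. (\<rho> y ^^ k) w = 0"
    proof (rule ccontr)
      assume "\<not> ?thesis"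
      moreover have "(\<rho> y ^^ k) w = sv (fact k) (dp k y w)" for k
        by (simp add: dp_def)
      ultimately have "dp k y w \<noteq> 0" for k
        by auto
      then have "V.independent ((\<lambda>k. dp k y w) ` {..<n}) \<and> card ((\<lambda>k. dp k y w) ` {..<n}) = n" for n
        by (intro weight_vectors_independent[OF assms(4,5) \<mu>]) (use weight_space_dp[OF assms(3) w] in auto)
      then have "n \<le> V.dim (UNIV :: 'v set)" for n
        using fd.independent_card_le_dim[of "(\<lambda>k. dp k y w) ` {..<n}" UNIV] by simp
      then show False
        using not_less_eq_eq by blast
    qed
    then show "w \<in> ?N" by simp
  qed
  ultimately have "?N = UNIV"
    using V.span_minimal assms(1) by blast
  then show ?thesis
    unfolding locally_nilpotent_def by blast
qed

end

section \<open>Roots and coroots\<close>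

lemma (in lie_algebra) ad_weight_space: "ad.weight_space H \<mu> = root_space s br H \<mu>"
  by (simp add: ad.weight_space_def root_space_def)

locale chevalley = lie_algebra s br
  for s :: "complex \<Rightarrow> 'g::ab_group_add \<Rightarrow> 'g" and br :: "'g \<Rightarrow> 'g \<Rightarrow> 'g" +
  fixes H :: "'g set" and S :: "('g \<Rightarrow> complex) set" and x h :: "('g \<Rightarrow> complex) \<Rightarrow> 'g"
  assumes finite_dim: "\<exists>B. finite_dimensional_vector_space s B"
    and cartan: "cartan_subalgebra s br H"
    and simple: "simple_roots s br H S"
    and basis: "chevalley_basis s br H S x h"
begin

abbreviation "\<Delta> \<equiv> roots s br H"

lemma subspace_H: "subspace H"
  using cartan by (simp add: cartan_subalgebra_def)

lemma normalizer_subset: "(\<And>y. y \<in> H \<Longrightarrow> br z y \<in> H) \<Longrightarrow> z \<in> H"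
  using cartan unfolding cartan_subalgebra_def by blast

lemma root_dual: "\<alpha> \<in> \<Delta> \<Longrightarrow> \<alpha> \<in> dual_space s H"
  by (simp add: roots_def)

lemma root_nonzero: "\<alpha> \<in> \<Delta> \<Longrightarrow> \<alpha> \<noteq> (\<lambda>_. 0)"
  by (simp add: roots_def)

lemma root_space_zero:
  "\<mu> \<in> dual_space s H \<Longrightarrow> \<mu> \<noteq> (\<lambda>_. 0) \<Longrightarrow> \<mu> \<notin> \<Delta> \<Longrightarrow> u \<in> root_space s br H \<mu> \<Longrightarrow> u = 0"
  by (auto simp: roots_def)

lemma dual_add: "\<mu> \<in> dual_space s H \<Longrightarrow> y \<in> H \<Longrightarrow> z \<in> H \<Longrightarrow> \<mu> (y + z) = \<mu> y + \<mu> z"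
  by (simp add: dual_space_def)

lemma dual_scale: "\<mu> \<in> dual_space s H \<Longrightarrow> y \<in> H \<Longrightarrow> \<mu> (s c y) = c * \<mu> y"
  by (simp add: dual_space_def)

lemma dual_diff_scale:
  assumes "\<mu> \<in> dual_space s H" "y \<in> H" "z \<in> H"
  shows "\<mu> (y - s c z) = \<mu> y - c * \<mu> z"
proof -
  have "y - s c z = y + s (- c) z" by simp
  then show ?thesis
    using assms subspace_H by (simp only: dual_add dual_scale subspace_scale) simp
qed

lemma root_vector: "\<alpha> \<in> \<Delta> \<Longrightarrow> x \<alpha> \<in> root_space s br H \<alpha>"
  using basis by (simp add: chevalley_basis_def)

lemma br_root_vector: "\<alpha> \<in> \<Delta> \<Longrightarrow> y \<in> H \<Longrightarrow> br y (x \<alpha>) = s (\<alpha> y) (x \<alpha>)"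
  using root_vector by (simp add: root_space_def)

lemma independent_basis: "independent (x ` \<Delta> \<union> h ` S)"
  and span_basis: "span (x ` \<Delta> \<union> h ` S) = UNIV"
  and inj_on_x: "inj_on x \<Delta>"
  using basis by (auto simp: chevalley_basis_def)

lemma root_vector_nonzero: "\<alpha> \<in> \<Delta> \<Longrightarrow> x \<alpha> \<noteq> 0"
  using independent_basis dependent_zero by (metis UnI1 image_eqI)

lemma root_coroot: "\<alpha> \<in> \<Delta> \<Longrightarrow> \<alpha> (h \<alpha>) = 2"
  using basis by (auto simp: chevalley_basis_def is_coroot_def)

lemma br_opposite: "\<alpha> \<in> \<Delta> \<Longrightarrow> br (x \<alpha>) (x (\<lambda>y. - \<alpha> y)) = h \<alpha>"
  using basis by (simp add: chevalley_basis_def)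

lemma coroot_span: "\<alpha> \<in> \<Delta> \<Longrightarrow> h \<alpha> \<in> span {br u w | u w. u \<in> root_space s br H \<alpha> \<and>
    w \<in> root_space s br H (\<lambda>z. - \<alpha> z)}"
  using basis by (auto simp: chevalley_basis_def is_coroot_def)

lemma S_roots: "\<alpha> \<in> S \<Longrightarrow> \<alpha> \<in> \<Delta>"
  using simple by (auto simp: simple_roots_def)

lemma finite_S: "finite S"
  using simple by (auto simp: simple_roots_def)

text \<open>Brackets of opposite root vectors have weight 0, so the coroot commutes with
  \<open>H\<close>; it then lies in \<open>H\<close> because \<open>H\<close> is its own
  normalizer.\<close>

lemma coroot_in_H: "\<alpha> \<in> \<Delta> \<Longrightarrow> h \<alpha> \<in> H"
  and H_coroot: "\<alpha> \<in> \<Delta> \<Longrightarrow> y \<in> H \<Longrightarrow> br y (h \<alpha>) = 0"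
proof -
  assume \<alpha>: "\<alpha> \<in> \<Delta>"
  have "{br u w | u w. u \<in> root_space s br H \<alpha> \<and> w \<in> root_space s br H (\<lambda>z. - \<alpha> z)} \<subseteq>
      ad.weight_space H (\<lambda>_. 0)"
    using ad.weight_space_shift[of _ H \<alpha> _ "\<lambda>z. - \<alpha> z"] by (auto simp: ad_weight_space)
  then have "h \<alpha> \<in> ad.weight_space H (\<lambda>_. 0)"
    using coroot_span[OF \<alpha>] span_minimal[OF _ ad.subspace_weight_space] by blast
  then have *: "br y (h \<alpha>) = 0" if "y \<in> H" for y
    using that by (simp add: ad.weight_space_def)
  then show "br y (h \<alpha>) = 0" if "y \<in> H"
    using that .
  show "h \<alpha> \<in> H"
  proof (rule normalizer_subset)
    fix y assume "y \<in> H"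
    then show "br (h \<alpha>) y \<in> H"
      using * br_skew[of "h \<alpha>" y] subspace_0[OF subspace_H] by simp
  qed
qed

text \<open>Otherwise the opposite root space would be zero, the coroot would vanish, and \<alpha>
  could not take the value 2 on it.\<close>

lemma neg_root: "\<alpha> \<in> \<Delta> \<Longrightarrow> (\<lambda>y. - \<alpha> y) \<in> \<Delta>"
proof (rule ccontr)
  assume \<alpha>: "\<alpha> \<in> \<Delta>" and neg: "(\<lambda>y. - \<alpha> y) \<notin> \<Delta>"
  have "(\<lambda>y. - \<alpha> y) \<in> dual_space s H"
    using dual_space_scale[OF root_dual[OF \<alpha>], of "-1"] by simp
  moreover have "(\<lambda>y. - \<alpha> y) \<noteq> (\<lambda>_. 0)"
    using root_nonzero[OF \<alpha>] by (auto simp: fun_eq_iff)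
  ultimately have "u = 0" if "u \<in> root_space s br H (\<lambda>y. - \<alpha> y)" for u
    using root_space_zero neg that by blast
  then have "{br u w | u w. u \<in> root_space s br H \<alpha> \<and> w \<in> root_space s br H (\<lambda>z. - \<alpha> z)} \<subseteq> {0}"
    by clarsimp (metis br_zero_right)
  then have "h \<alpha> = 0"
    using coroot_span[OF \<alpha>] span_minimal[OF _ subspace_single_0] by blast
  moreover have "\<alpha> 0 = 0"
    using dual_scale[OF root_dual[OF \<alpha>] subspace_0[OF subspace_H], of 0] by simp
  ultimately show False
    using root_coroot[OF \<alpha>] by simp
qed

lemma coroot_weight_space: "\<alpha> \<in> \<Delta> \<Longrightarrow> h \<alpha> \<in> ad.weight_space H (\<lambda>_. 0)"
  using H_coroot by (auto simp: ad.weight_space_def)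

lemma adjoint_weight_spaces_span: "span (\<Union>\<mu>\<in>dual_space s H. ad.weight_space H \<mu>) = UNIV"
proof -
  have "x \<alpha> \<in> (\<Union>\<mu>\<in>dual_space s H. ad.weight_space H \<mu>)" if "\<alpha> \<in> \<Delta>" for \<alpha>
    using root_vector[OF that] root_dual[OF that] ad_weight_space by blast
  moreover have "h \<alpha> \<in> (\<Union>\<mu>\<in>dual_space s H. ad.weight_space H \<mu>)" if "\<alpha> \<in> S" for \<alpha>
    using coroot_weight_space[OF S_roots[OF that]] dual_space_0 by blast
  ultimately have "x ` \<Delta> \<union> h ` S \<subseteq> (\<Union>\<mu>\<in>dual_space s H. ad.weight_space H \<mu>)"
    by blast
  then show ?thesis
    using span_mono span_basis by blast
qed

lemma finite_roots: "finite \<Delta>"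
proof -
  obtain B where "finite_dimensional_vector_space s B"
    using finite_dim by blast
  then interpret fd: finite_dimensional_vector_space s B .
  have "finite (x ` \<Delta>)"
    using fd.finiteI_independent[OF independent_basis] by simp
  then show ?thesis
    using inj_on_x finite_imageD by blast
qed

text \<open>After removal of its \<open>x \<alpha>\<close> coordinate, \<open>u\<close> still has
  weight \<alpha> but lies in the span of basis vectors of other weights, so it is zero.\<close>

lemma root_space_one_dim:
  assumes "\<alpha> \<in> \<Delta>" "u \<in> root_space s br H \<alpha>"
  obtains c where "u = s c (x \<alpha>)"
proof -
  have "x ` \<Delta> \<union> h ` S = insert (x \<alpha>) (x ` (\<Delta> - {\<alpha>}) \<union> h ` S)"
    using assms(1) by auto
  then have "u \<in> span (insert (x \<alpha>) (x ` (\<Delta> - {\<alpha>}) \<union> h ` S))"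
    using span_basis by simp
  then obtain k where k: "u - s k (x \<alpha>) \<in> span (x ` (\<Delta> - {\<alpha>}) \<union> h ` S)"
    by (auto simp: span_insert)
  have "x ` (\<Delta> - {\<alpha>}) \<union> h ` S \<subseteq> ad.off_weight H \<alpha>"
  proof -
    have "x \<gamma> \<in> ad.off_weight H \<alpha>" if "\<gamma> \<in> \<Delta>" "\<gamma> \<noteq> \<alpha>" for \<gamma>
      using ad.weight_space_off[of "x \<gamma>" H \<gamma>] that root_vector root_dual by (simp add: ad_weight_space)
    moreover have "h \<gamma> \<in> ad.off_weight H \<alpha>" if "\<gamma> \<in> S" for \<gamma>
      using ad.weight_space_off[OF coroot_weight_space dual_space_0] S_roots[OF that] root_nonzero[OF assms(1)]
      by metis
    ultimately show ?thesis by auto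
  qed
  then have "u - s k (x \<alpha>) \<in> ad.off_weight H \<alpha>"
    using span_minimal[OF _ ad.subspace_off_weight] k by blast
  moreover have "u - s k (x \<alpha>) \<in> ad.weight_space H \<alpha>"
    using assms root_vector subspace_diff[OF ad.subspace_weight_space] subspace_scale[OF ad.subspace_weight_space]
    by (metis ad_weight_space)
  ultimately have "u - s k (x \<alpha>) = 0"
    using ad.weight_space_Int_off[OF root_dual[OF assms(1)]] by blast
  then show ?thesis
    using that[of k] by simp
qed

end

section \<open>Positive roots, heights, reflections and adjoint exponentials\<close>

context chevalley
begin

text \<open>Elements of the root lattice are handled through coefficient functions. Only the values
  of \<open>a\<close> on \<open>S\<close> matter, so \<open>comb a\<close> determines
  \<open>a\<close> on \<open>S\<close> alone.\<close>

definition comb :: "(('g \<Rightarrow> complex) \<Rightarrow> int) \<Rightarrow> 'g \<Rightarrow> complex" where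
  "comb a = (\<lambda>y. \<Sum>\<alpha>\<in>S. of_int (a \<alpha>) * \<alpha> y)"

abbreviation "\<Phi> \<equiv> positive_roots s br H S"

lemma simple_independent:
  fixes c d :: "('g \<Rightarrow> complex) \<Rightarrow> complex"
  assumes "\<And>y. (\<Sum>\<alpha>\<in>S. c \<alpha> * \<alpha> y) = (\<Sum>\<alpha>\<in>S. d \<alpha> * \<alpha> y)" "\<alpha> \<in> S"
  shows "c \<alpha> = d \<alpha>"
proof -
  have "(\<lambda>y. \<Sum>\<alpha>\<in>S. (c \<alpha> - d \<alpha>) * \<alpha> y) = (\<lambda>_. 0)"
    using assms(1) by (simp add: left_diff_distrib sum_subtractf)
  moreover have "(\<lambda>y. \<Sum>\<alpha>\<in>S. (c \<alpha> - d \<alpha>) * \<alpha> y) = (\<lambda>_. 0) \<longrightarrow> (\<forall>\<alpha>\<in>S. c \<alpha> - d \<alpha> = 0)"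
    using simple unfolding simple_roots_def
    by (elim conjE) (drule spec[where x = "\<lambda>\<alpha>. c \<alpha> - d \<alpha>"], assumption)
  ultimately have "\<forall>\<alpha>\<in>S. c \<alpha> - d \<alpha> = 0"
    by (rule mp[rotated])
  then show ?thesis
    using assms(2) by simp
qed

lemma comb_inject:
  assumes "comb a = comb b" "\<alpha> \<in> S"
  shows "a \<alpha> = b \<alpha>"
  using simple_independent[of "\<lambda>\<alpha>. of_int (a \<alpha>)" "\<lambda>\<alpha>. of_int (b \<alpha>)" \<alpha>] assms
  by (simp add: comb_def fun_eq_iff)

lemma comb_add: "comb (\<lambda>\<alpha>. a \<alpha> + b \<alpha>) y = comb a y + comb b y"
  by (simp add: comb_def distrib_right sum.distrib)

lemma comb_scale: "comb (\<lambda>\<alpha>. k * a \<alpha>) y = of_int k * comb a y"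
  by (simp add: comb_def sum_distrib_left mult.assoc)

lemma comb_zero: "comb (\<lambda>_. 0) = (\<lambda>_. 0)"
  by (simp add: comb_def)

lemma comb_dual: "comb a \<in> dual_space s H"
  unfolding comb_def by (rule dual_space_sum) (rule dual_space_scale, rule root_dual, rule S_roots)

lemma simple_comb: "\<alpha> \<in> S \<Longrightarrow> \<alpha> = comb (\<lambda>\<gamma>. if \<gamma> = \<alpha> then 1 else 0)"
  by (simp add: comb_def if_distrib[of of_int] if_distrib[of "\<lambda>c. c * _"] finite_S cong: if_cong)

lemma root_comb:
  assumes "\<beta> \<in> \<Delta>"
  obtains a where "\<beta> = comb a" "(\<forall>\<alpha>\<in>S. 0 \<le> a \<alpha>) \<or> (\<forall>\<alpha>\<in>S. a \<alpha> \<le> 0)"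
  using simple assms unfolding simple_roots_def comb_def by blast

lemma positive_iff: "\<beta> \<in> \<Phi> \<longleftrightarrow> \<beta> \<in> \<Delta> \<and> (\<exists>a. \<beta> = comb a \<and> (\<forall>\<alpha>\<in>S. 0 \<le> a \<alpha>))"
  by (auto simp: positive_roots_def comb_def)

lemma positive_root: "\<beta> \<in> \<Phi> \<Longrightarrow> \<beta> \<in> \<Delta>"
  by (simp add: positive_iff)

lemma simple_positive: "\<alpha> \<in> S \<Longrightarrow> \<alpha> \<in> \<Phi>"
  unfolding positive_iff using simple_comb[of \<alpha>] S_roots
  by (auto intro!: exI[of _ "\<lambda>\<gamma>. if \<gamma> = \<alpha> then 1 else 0"])

lemma positive_or_negative:
  assumes "\<beta> \<in> \<Delta>" shows "\<beta> \<in> \<Phi> \<or> (\<lambda>y. - \<beta> y) \<in> \<Phi>"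
proof -
  obtain a where a: "\<beta> = comb a" "(\<forall>\<alpha>\<in>S. 0 \<le> a \<alpha>) \<or> (\<forall>\<alpha>\<in>S. a \<alpha> \<le> 0)"
    using root_comb assms by metis
  have "(\<lambda>y. - \<beta> y) = comb (\<lambda>\<alpha>. - a \<alpha>)"
    by (simp add: a(1) comb_def sum_negf)
  then show ?thesis
    using a assms neg_root[OF assms] unfolding positive_iff
    by (metis (no_types, lifting) neg_0_le_iff_le)
qed

text \<open>Independence of the simple roots makes the coefficients unique on \<open>S\<close>, so
  the description by \<open>THE\<close> has exactly one solution.\<close>

lemma height_comb: "height S (comb a) = (\<Sum>\<alpha>\<in>S. a \<alpha>)"
  unfolding height_def comb_def[symmetric]
proof (rule the_equality)
  fix n assume "\<exists>b. comb a = comb b \<and> n = (\<Sum>\<alpha>\<in>S. b \<alpha>)"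
  then show "n = (\<Sum>\<alpha>\<in>S. a \<alpha>)"
    using comb_inject by (metis (no_types, lifting) sum.cong)
qed auto

lemma root_coefficient_nonzero:
  assumes "comb a \<in> \<Delta>" obtains \<alpha> where "\<alpha> \<in> S" "a \<alpha> \<noteq> 0"
proof -
  have "\<not> (\<forall>\<alpha>\<in>S. a \<alpha> = 0)"
    using root_nonzero[OF assms] by (auto simp: comb_def)
  then show ?thesis using that by blast
qed

lemma height_positive: "\<beta> \<in> \<Phi> \<Longrightarrow> 0 < height S \<beta>"
proof -
  assume "\<beta> \<in> \<Phi>"
  then obtain a where a: "\<beta> \<in> \<Delta>" "\<beta> = comb a" "\<forall>\<alpha>\<in>S. 0 \<le> a \<alpha>"
    by (auto simp: positive_iff)
  then obtain \<alpha> where "\<alpha> \<in> S" "a \<alpha> \<noteq> 0"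
    using root_coefficient_nonzero by blast
  then have "0 < a \<alpha>"
    using a(3) by (simp add: order_less_le)
  then show ?thesis
    using a finite_S \<open>\<alpha> \<in> S\<close> by (auto simp: height_comb intro: sum_pos2)
qed

definition reflection :: "('g \<Rightarrow> complex) \<Rightarrow> ('g \<Rightarrow> complex) \<Rightarrow> 'g \<Rightarrow> complex" where
  "reflection \<alpha> \<mu> = (\<lambda>y. \<mu> y - \<mu> (h \<alpha>) * \<alpha> y)"

lemma reflection_dual: "\<alpha> \<in> \<Delta> \<Longrightarrow> \<mu> \<in> dual_space s H \<Longrightarrow> reflection \<alpha> \<mu> \<in> dual_space s H"
  using dual_space_add[OF _ dual_space_scale[OF root_dual], of \<mu> \<alpha> "- \<mu> (h \<alpha>)"]
  by (simp add: reflection_def)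

lemma reflection_reflection: "\<alpha> \<in> \<Delta> \<Longrightarrow> reflection \<alpha> (reflection \<alpha> \<mu>) = \<mu>"
  by (simp add: reflection_def root_coroot algebra_simps)

lemma br_x_H: "\<alpha> \<in> \<Delta> \<Longrightarrow> y \<in> H \<Longrightarrow> br (x \<alpha>) y = s (- \<alpha> y) (x \<alpha>)"
  using br_skew[of "x \<alpha>" y] by (simp add: br_root_vector)

lemma br_opposite': "\<alpha> \<in> \<Delta> \<Longrightarrow> br (x (\<lambda>y. - \<alpha> y)) (x \<alpha>) = - h \<alpha>"
  using br_skew[of "x (\<lambda>y. - \<alpha> y)" "x \<alpha>"] by (simp add: br_opposite)

lemma ad_exp_H:
  assumes "\<alpha> \<in> \<Delta>" "y \<in> H"
  shows "chi s br (x \<alpha>) t y = y - s (of_rat t * \<alpha> y) (x \<alpha>)"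
proof -
  have "(br (x \<alpha>) ^^ 2) y = 0"
    using assms by (simp add: numeral_2_eq_2 br_x_H br_self ad.act_scale_right)
  then have "chi s br (x \<alpha>) t y = (\<Sum>k<2. s (of_rat t ^ k) (ad.dp k (x \<alpha>) y))"
    by (intro ad.chi_eq) (rule ad.dp_vanish)
  then show ?thesis
    using assms by (simp add: numeral_2_eq_2 br_x_H)
qed

lemma ad_exp_self: "chi s br y t y = y"
proof -
  have "chi s br y t y = (\<Sum>k<1. s (of_rat t ^ k) (ad.dp k y y))"
    by (intro ad.chi_eq) (rule ad.dp_vanish[of 1], simp_all add: br_self)
  then show ?thesis by simp
qed

text \<open>A computation in the three-dimensional algebra of \<alpha>: the series stops after the
  quadratic term, whose factor 1/2 cancels the 2 in \<open>[f, h] = 2 f\<close>.\<close>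

lemma ad_exp_opposite:
  assumes "\<alpha> \<in> \<Delta>"
  shows "chi s br (x (\<lambda>y. - \<alpha> y)) (- 1) (x \<alpha>) = x \<alpha> + h \<alpha> - x (\<lambda>y. - \<alpha> y)"
proof -
  let ?f = "x (\<lambda>y. - \<alpha> y)"
  have h: "br ?f (h \<alpha>) = s 2 ?f"
    using br_x_H[OF neg_root[OF assms] coroot_in_H[OF assms]] by (simp add: root_coroot assms)
  have "(br ?f ^^ 3) (x \<alpha>) = 0"
    using assms by (simp add: numeral_3_eq_3 br_opposite' h br_self ad.act_scale_right)
  then have "chi s br ?f (- 1) (x \<alpha>) = (\<Sum>k<3. s (of_rat (- 1) ^ k) (ad.dp k ?f (x \<alpha>)))"
    by (intro ad.chi_eq) (rule ad.dp_vanish)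
  then show ?thesis
    using assms by (simp add: numeral_3_eq_3 br_opposite' h ad.dp_Suc[of "Suc 0"] of_rat_minus)
qed

end

section \<open>Rank one computations\<close>

text \<open>The span of the weight spaces is an assumption here, so that the adjoint module and the
  highest weight module become instances of one theory.\<close>

locale chevalley_module = chevalley s br H S x h + lie_module s br sv \<rho>
  for s :: "complex \<Rightarrow> 'g::ab_group_add \<Rightarrow> 'g" and br H S x h
    and sv :: "complex \<Rightarrow> 'v::ab_group_add \<Rightarrow> 'v" and \<rho> +
  assumes finite_dim_module: "\<exists>B. finite_dimensional_vector_space sv B"
    and weight_spaces_span: "V.span (\<Union>\<mu>\<in>dual_space s H. weight_space H \<mu>) = UNIV"
begin

lemma root_vector_nilpotent: "\<alpha> \<in> \<Delta> \<Longrightarrow> locally_nilpotent (x \<alpha>)"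
  using root_vector_locally_nilpotent[OF weight_spaces_span finite_dim_module]
    root_vector root_dual root_nonzero by blast

text \<open>The standard lift of the reflection in \<alpha> to an operator on the module;
  \<open>weyl_inv\<close> reverses the three factors.\<close>

definition weyl :: "('g \<Rightarrow> complex) \<Rightarrow> 'v \<Rightarrow> 'v" where
  "weyl \<alpha> w = chi sv \<rho> (x \<alpha>) 1 (chi sv \<rho> (x (\<lambda>y. - \<alpha> y)) (- 1) (chi sv \<rho> (x \<alpha>) 1 w))"

definition weyl_inv :: "('g \<Rightarrow> complex) \<Rightarrow> 'v \<Rightarrow> 'v" where
  "weyl_inv \<alpha> w = chi sv \<rho> (x \<alpha>) (- 1) (chi sv \<rho> (x (\<lambda>y. - \<alpha> y)) 1 (chi sv \<rho> (x \<alpha>) (- 1) w))"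

lemma weyl_inv_weyl: "\<alpha> \<in> \<Delta> \<Longrightarrow> weyl_inv \<alpha> (weyl \<alpha> w) = w"
  using chi_inverse(1)[of "x \<alpha>" 1] chi_inverse(1)[of "x (\<lambda>y. - \<alpha> y)" "- 1"]
  by (simp add: weyl_def weyl_inv_def root_vector_nilpotent neg_root)

lemma weyl_nonzero: "\<alpha> \<in> \<Delta> \<Longrightarrow> w \<noteq> 0 \<Longrightarrow> weyl \<alpha> w \<noteq> 0"
  using weyl_inv_weyl[of \<alpha> w] by (auto simp: weyl_inv_def)

lemma weyl_scale: "\<alpha> \<in> \<Delta> \<Longrightarrow> weyl \<alpha> (sv c w) = sv c (weyl \<alpha> w)"
  by (simp add: weyl_def chi_scale root_vector_nilpotent neg_root)

end

text \<open>With this instance, \<open>adm.weyl\<close> is the lift of the same reflection to the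
  algebra itself.\<close>

sublocale chevalley \<subseteq> adm: chevalley_module s br H S x h s br
  by unfold_locales (rule finite_dim adjoint_weight_spaces_span)+

context chevalley
begin

text \<open>The three exponentials are evaluated one after the other; all multiples of the two root
  vectors cancel and the reflection on \<open>H\<close> remains.\<close>

lemma adjoint_weyl_H:
  assumes "\<alpha> \<in> \<Delta>" "y \<in> H"
  shows "adm.weyl \<alpha> y = y - s (\<alpha> y) (h \<alpha>)"
proof -
  let ?e = "x \<alpha>" and ?f = "x (\<lambda>y. - \<alpha> y)" and ?a = "\<alpha> y"
  note nil = adm.root_vector_nilpotent[OF assms(1)] adm.root_vector_nilpotent[OF neg_root[OF assms(1)]]
  have e_y: "chi s br ?e 1 y = y - s ?a ?e" and e_h: "chi s br ?e 1 (h \<alpha>) = h \<alpha> - s 2 ?e"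
    using ad_exp_H[OF assms(1) assms(2), of 1] ad_exp_H[OF assms(1) coroot_in_H[OF assms(1)], of 1]
    by (simp_all add: root_coroot assms(1))
  have f_y: "chi s br ?f (- 1) y = y - s ?a ?f"
    using ad_exp_H[OF neg_root[OF assms(1)] assms(2), of "- 1"] by (simp add: of_rat_minus)
  have "adm.weyl \<alpha> y = chi s br ?e 1 (chi s br ?f (- 1) (y - s ?a ?e))"
    by (simp only: adm.weyl_def e_y)
  also have "chi s br ?f (- 1) (y - s ?a ?e) = (y - s ?a ?f) - s ?a (?e + h \<alpha> - ?f)"
    by (simp only: ad.chi_diff[OF nil(2)] ad.chi_scale[OF nil(2)] f_y ad_exp_opposite[OF assms(1)])
  also have "\<dots> = y - s ?a ?e - s ?a (h \<alpha>)"
    by (simp add: scale_right_distrib scale_right_diff_distrib)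
  also have "chi s br ?e 1 \<dots> = (y - s ?a ?e - s ?a ?e) - s ?a (h \<alpha> - s 2 ?e)"
    by (simp only: ad.chi_diff[OF nil(1)] ad.chi_scale[OF nil(1)] e_y e_h ad_exp_self)
  also have "s ?a (h \<alpha> - s 2 ?e) = s ?a (h \<alpha>) - (s ?a ?e + s ?a ?e)"
    by (simp add: scale_right_diff_distrib flip: scale_left_distrib)
  finally show ?thesis by simp
qed

end

context chevalley_module
begin

lemma weyl_act:
  assumes "\<alpha> \<in> \<Delta>"
  shows "weyl \<alpha> (\<rho> z w) = \<rho> (adm.weyl \<alpha> z) (weyl \<alpha> w)"
  using assms by (simp add: weyl_def adm.weyl_def chi_act root_vector_nilpotent adm.root_vector_nilpotent neg_root)

lemma weyl_weight_space:
  assumes "\<alpha> \<in> \<Delta>" "\<mu> \<in> dual_space s H" "w \<in> weight_space H \<mu>"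
  shows "weyl \<alpha> w \<in> weight_space H (reflection \<alpha> \<mu>)"
  unfolding weight_space_def
proof (intro CollectI ballI)
  fix y assume y: "y \<in> H"
  \<comment> \<open>The reflection of \<open>y\<close> inside \<open>H\<close>. Being an involution
    on \<open>H\<close>, \<open>adm.weyl \<alpha>\<close> carries it back to
    \<open>y\<close>.\<close>
  let ?y = "y - s (\<alpha> y) (h \<alpha>)"
  have y': "?y \<in> H"
    using y coroot_in_H[OF assms(1)] subspace_H by (simp add: subspace_diff subspace_scale)
  have "\<alpha> ?y = - \<alpha> y"
    using dual_diff_scale[OF root_dual[OF assms(1)] y coroot_in_H[OF assms(1)]] by (simp add: root_coroot assms(1))
  then have "adm.weyl \<alpha> ?y = y"
    using adjoint_weyl_H[OF assms(1) y'] by simp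
  then have "\<rho> y (weyl \<alpha> w) = weyl \<alpha> (\<rho> ?y w)"
    by (simp add: weyl_act[OF assms(1)])
  also have "\<dots> = sv (\<mu> ?y) (weyl \<alpha> w)"
    using assms(3) y' by (simp add: weight_spaceD weyl_scale assms(1))
  also have "\<mu> ?y = reflection \<alpha> \<mu> y"
    using dual_diff_scale[OF assms(2) y coroot_in_H[OF assms(1)]] by (simp add: reflection_def mult.commute)
  finally show "\<rho> y (weyl \<alpha> w) = sv (reflection \<alpha> \<mu> y) (weyl \<alpha> w)" .
qed

text \<open>The case \<open>n = 1\<close> of \<open>dp_dp_opposite\<close>. Passing \<open>e\<close>
  through one more \<open>f\<close> adds the weight of \<open>h\<close> on the vector reached so
  far.\<close>

lemma act_dp_opposite:
  assumes "\<alpha> \<in> \<Delta>" "w \<in> weight_space H \<mu>"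
  shows "\<rho> (x \<alpha>) (dp (Suc m) (x (\<lambda>y. - \<alpha> y)) w) =
    dp (Suc m) (x (\<lambda>y. - \<alpha> y)) (\<rho> (x \<alpha>) w) + sv (\<mu> (h \<alpha>) - of_nat m) (dp m (x (\<lambda>y. - \<alpha> y)) w)"
proof (induction m)
  case 0
  show ?case
    using weight_spaceD[OF assms(2) coroot_in_H[OF assms(1)]]
    by (simp add: act_commute[of "x \<alpha>" "x (\<lambda>y. - \<alpha> y)"] br_opposite assms(1))
next
  case (Suc m)
  let ?e = "x \<alpha>" and ?f = "x (\<lambda>y. - \<alpha> y)" and ?c = "\<mu> (h \<alpha>)"
  let ?w = "dp (Suc m) ?f w"
  have "?w \<in> weight_space H (\<lambda>z. \<mu> z + of_nat (Suc m) * - \<alpha> z)"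
    using weight_space_dp[OF root_vector[OF neg_root[OF assms(1)]] assms(2)] .
  from weight_spaceD[OF this coroot_in_H[OF assms(1)]]
  have h: "\<rho> (h \<alpha>) ?w = sv (?c - 2 * of_nat (Suc m)) ?w"
    by (simp add: root_coroot assms(1) mult.commute)
  have "sv (of_nat (Suc (Suc m))) (\<rho> ?e (dp (Suc (Suc m)) ?f w)) = \<rho> ?e (\<rho> ?f ?w)"
    by (simp only: act_dp act_scale_right)
  also have "\<dots> = \<rho> ?f (\<rho> ?e ?w) + \<rho> (h \<alpha>) ?w"
    by (simp add: act_commute[of ?e ?f] br_opposite assms(1))
  also have "\<dots> = sv (of_nat (Suc (Suc m))) (dp (Suc (Suc m)) ?f (\<rho> ?e w)) +
      sv ((?c - of_nat m) * of_nat (Suc m) + (?c - 2 * of_nat (Suc m))) ?w"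
    unfolding Suc.IH h by (simp only: act_add_right act_scale_right act_dp V.scale_scale V.scale_left_distrib add.assoc)
  also have "(?c - of_nat m) * of_nat (Suc m) + (?c - 2 * of_nat (Suc m)) =
      of_nat (Suc (Suc m)) * (?c - of_nat (Suc m))"
    by (simp add: algebra_simps)
  also have "sv (of_nat (Suc (Suc m))) (dp (Suc (Suc m)) ?f (\<rho> ?e w)) + sv \<dots> ?w =
      sv (of_nat (Suc (Suc m))) (dp (Suc (Suc m)) ?f (\<rho> ?e w) + sv (?c - of_nat (Suc m)) ?w)"
    by (simp only: V.scale_right_distrib V.scale_scale)
  finally show ?case
    by (simp only: V.scale_cancel_left of_nat_eq_0_iff) simp
qed

lemma gbinomial_absorb: "of_nat (Suc t) * (a gchoose Suc t) = (a - of_nat t) * (a gchoose t)" for a :: complex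
  using gbinomial_absorption'[of "Suc t" a] gbinomial_mult_1 [of a t]
  by (simp add: algebra_simps)

text \<open>Induction on \<open>n\<close>, with both sides multiplied by \<open>Suc n\<close>.
  Pascal's rule and the absorption identity raise the upper argument \<open>a\<close> of the
  binomial coefficient to \<open>a + 1\<close>.\<close>

lemma dp_dp_opposite:
  assumes "\<alpha> \<in> \<Delta>" "w \<in> weight_space H \<mu>"
  shows "dp n (x \<alpha>) (dp m (x (\<lambda>y. - \<alpha> y)) w) =
    (\<Sum>t\<le>n. if t \<le> m then sv ((\<mu> (h \<alpha>) - of_nat m + of_nat n) gchoose t)
      (dp (m - t) (x (\<lambda>y. - \<alpha> y)) (dp (n - t) (x \<alpha>) w)) else 0)"
proof (induction n)
  case (Suc n)
  let ?e = "x \<alpha>" and ?f = "x (\<lambda>y. - \<alpha> y)" and ?c = "\<mu> (h \<alpha>)"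
  define a where "a = ?c - of_nat m + of_nat n"
  define G where "G t = (if t \<le> m then dp (m - t) ?f (dp (Suc n - t) ?e w) else 0)" for t
  \<comment> \<open>\<open>r t\<close> is the part of the coefficient of \<open>G t\<close> that
    comes from term \<open>t - 1\<close>, when \<open>e\<close> lowers the exponent of
    \<open>f\<close>; nothing arrives at \<open>t = 0\<close>.\<close>
  define r where "r t = (case t of 0 \<Rightarrow> 0 | Suc t \<Rightarrow> (a + of_nat n - of_nat t + 1) * (a gchoose t))" for t
  have e: "\<rho> ?e (if t \<le> m then sv (a gchoose t) (dp (m - t) ?f (dp (n - t) ?e w)) else 0) =
      sv (of_nat (Suc n - t) * (a gchoose t)) (G t) + sv (r (Suc t)) (G (Suc t))" if "t \<le> n" for t
  proof (cases "t < m")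
    case True
    then obtain k where k: "m - t = Suc k"
      by (metis Suc_diff_Suc)
    have m: "m = t + Suc k"
      using k by simp
    \<comment> \<open>The vector \<open>dp (n - t) ?e w\<close> has \<open>h\<close>-weight
      \<open>?c + 2 (n - t)\<close>, and the exponent \<open>Suc k\<close> of \<open>f\<close>
      subtracts \<open>k\<close>.\<close>
    have c: "?c + of_nat (n - t) * 2 - of_nat k = a + of_nat n - of_nat t + 1"
      using that m by (simp add: a_def of_nat_diff)
    have mk: "m - Suc t = k" using k by simp
    have "\<rho> ?e (dp (Suc k) ?f (dp (n - t) ?e w)) = dp (Suc k) ?f (\<rho> ?e (dp (n - t) ?e w)) +
        sv (a + of_nat n - of_nat t + 1) (dp k ?f (dp (n - t) ?e w))"
      using act_dp_opposite[OF assms(1) weight_space_dp[OF root_vector[OF assms(1)] assms(2)], of k "n - t"] c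
      by (simp add: root_coroot assms(1))
    then show ?thesis
      using True k mk that
      by (simp add: G_def r_def act_scale_right act_dp dp_scale Suc_diff_le V.scale_right_distrib mult.commute
          del: of_nat_Suc of_nat_diff)
  next
    case False
    then show ?thesis
      using that by (auto simp: G_def r_def act_scale_right act_dp Suc_diff_le mult.commute simp del: of_nat_Suc of_nat_diff)
  qed
  have "sv (of_nat (Suc n)) (dp (Suc n) ?e (dp m ?f w)) =
      (\<Sum>t\<le>n. sv (of_nat (Suc n - t) * (a gchoose t)) (G t)) + (\<Sum>t\<le>n. sv (r (Suc t)) (G (Suc t)))"
    unfolding act_dp[symmetric] Suc.IH act_sum_right a_def[symmetric] sum.distrib[symmetric]
    by (rule sum.cong) (use e in auto)
  also have "(\<Sum>t\<le>n. sv (of_nat (Suc n - t) * (a gchoose t)) (G t)) =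
      (\<Sum>t\<le>Suc n. sv (of_nat (Suc n - t) * (a gchoose t)) (G t))"
    by simp
  also have "(\<Sum>t\<le>n. sv (r (Suc t)) (G (Suc t))) = (\<Sum>t\<le>Suc n. sv (r t) (G t))"
    by (subst sum.atMost_Suc_shift) (simp add: r_def)
  also have "(\<Sum>t\<le>Suc n. sv (of_nat (Suc n - t) * (a gchoose t)) (G t)) + \<dots> =
      (\<Sum>t\<le>Suc n. sv (of_nat (Suc n) * ((a + 1) gchoose t)) (G t))"
    unfolding sum.distrib[symmetric] V.scale_left_distrib[symmetric]
  proof (rule sum.cong[OF refl])
    fix t assume "t \<in> {..Suc n}"
    then have "of_nat (Suc n - t) * (a gchoose t) + r t = of_nat (Suc n) * ((a + 1) gchoose t)"
    proof (cases t)
      case (Suc t')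
      then have "t' \<le> n" using \<open>t \<in> {..Suc n}\<close> by simp
      then show ?thesis
        using gbinomial_absorb[of t' a] unfolding Suc r_def gbinomial_Suc_Suc[of a t']
        by (simp add: of_nat_diff algebra_simps)
    qed (simp add: r_def)
    then show "sv (of_nat (Suc n - t) * (a gchoose t) + r t) (G t) = sv (of_nat (Suc n) * ((a + 1) gchoose t)) (G t)"
      by simp
  qed
  also have "\<dots> = sv (of_nat (Suc n)) (\<Sum>t\<le>Suc n. sv ((a + 1) gchoose t) (G t))"
    by (simp only: V.scale_sum_right V.scale_scale)
  finally have "dp (Suc n) ?e (dp m ?f w) = (\<Sum>t\<le>Suc n. sv ((a + 1) gchoose t) (G t))"
    by (simp only: V.scale_cancel_left of_nat_eq_0_iff) simp
  also have "a + 1 = ?c - of_nat m + of_nat (Suc n)"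
    by (simp add: a_def)
  finally show ?case
    by (simp only: G_def if_distrib[of "sv _"] V.scale_zero_right)
qed simp

end

section \<open>Reflections and root strings\<close>

text \<open>The subgroup generated by \<open>A\<close>; closure under differences already gives
  negatives and sums.\<close>

inductive_set additive_span :: "'a::ab_group_add set \<Rightarrow> 'a set" for A where
  base: "a \<in> A \<Longrightarrow> a \<in> additive_span A"
| zero: "0 \<in> additive_span A"
| diff: "a \<in> additive_span A \<Longrightarrow> b \<in> additive_span A \<Longrightarrow> a - b \<in> additive_span A"

lemma additive_span_minus: "a \<in> additive_span A \<Longrightarrow> - a \<in> additive_span A"
  using additive_span.diff[OF additive_span.zero] by fastforce

lemma additive_span_add: "a \<in> additive_span A \<Longrightarrow> b \<in> additive_span A \<Longrightarrow> a + b \<in> additive_span A"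
  using additive_span.diff[OF _ additive_span_minus] by fastforce

lemma additive_span_sum:
  "(\<And>i. i \<in> F \<Longrightarrow> f i \<in> additive_span A) \<Longrightarrow> (\<Sum>i\<in>F. f i) \<in> additive_span A"
  by (induction F rule: infinite_finite_induct) (auto intro: additive_span.zero additive_span_add)

context vector_space
begin

lemma additive_span_of_nat: "a \<in> additive_span A \<Longrightarrow> scale (of_nat n) a \<in> additive_span A"
  by (induction n) (auto simp: scale_left_distrib intro: additive_span.zero additive_span_add)

lemma additive_span_scale: "a \<in> additive_span A \<Longrightarrow> scale (of_int k) a \<in> additive_span A"
  by (cases k rule: int_cases2) (auto simp: additive_span_of_nat intro: additive_span_minus)

end

context lie_module
begin

lemma additive_span_dp:
  assumes "\<And>a. a \<in> A \<Longrightarrow> dp n y a \<in> additive_span A" "w \<in> additive_span A"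
  shows "dp n y w \<in> additive_span A"
  using assms(2) by induction (auto simp: dp_diff assms(1) intro: additive_span.zero additive_span.diff)

text \<open>At an integral time all powers of \<open>t\<close> are integers, so only the divided
  powers have to be controlled.\<close>

lemma additive_span_chi:
  assumes "locally_nilpotent y" "\<And>n a. a \<in> A \<Longrightarrow> dp n y a \<in> additive_span A" "w \<in> additive_span A"
    and "t \<in> \<int>"
  shows "chi sv \<rho> y t w \<in> additive_span A"
proof -
  obtain k where k: "t = of_int k"
    using assms(4) by (elim Ints_cases)
  obtain K where "\<And>n. K \<le> n \<Longrightarrow> dp n y w = 0"
    using locally_nilpotentE[OF assms(1)] by metis
  from chi_eq[OF this] have "chi sv \<rho> y t w = (\<Sum>n<K. sv (of_int (k ^ n)) (dp n y w))"
    by (simp add: k)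
  also have "\<dots> \<in> additive_span A"
    by (rule additive_span_sum, rule V.additive_span_scale, rule additive_span_dp[OF assms(2,3)])
  finally show ?thesis .
qed

end

context chevalley
begin

text \<open>The image is a nonzero vector of the reflected weight, which is therefore a root, and
  root spaces are one-dimensional.\<close>

lemma weyl_root_vector_scalar:
  assumes "\<alpha> \<in> \<Delta>" "\<gamma> \<in> \<Delta>"
  shows "reflection \<alpha> \<gamma> \<in> \<Delta> \<and> (\<exists>c. adm.weyl \<alpha> (x \<gamma>) = s c (x (reflection \<alpha> \<gamma>)))"
proof -
  let ?u = "adm.weyl \<alpha> (x \<gamma>)"
  have u: "?u \<in> root_space s br H (reflection \<alpha> \<gamma>)"
    using adm.weyl_weight_space[OF assms(1) root_dual[OF assms(2)]] root_vector[OF assms(2)]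
    by (simp add: ad_weight_space)
  have "reflection \<alpha> \<gamma> \<noteq> (\<lambda>_. 0)"
  proof
    assume "reflection \<alpha> \<gamma> = (\<lambda>_. 0)"
    then have "\<gamma> = reflection \<alpha> (\<lambda>_. 0)"
      using reflection_reflection[OF assms(1)] by metis
    then show False
      using root_nonzero[OF assms(2)] by (simp add: reflection_def)
  qed
  moreover have "?u \<noteq> 0"
    by (intro adm.weyl_nonzero assms root_vector_nonzero)
  ultimately have "reflection \<alpha> \<gamma> \<in> \<Delta>"
    using root_space_zero[OF reflection_dual[OF assms(1) root_dual[OF assms(2)]]] u by blast
  then show ?thesis
    using root_space_one_dim[OF _ u] by metis
qed

lemma reflection_root: "\<alpha> \<in> \<Delta> \<Longrightarrow> \<gamma> \<in> \<Delta> \<Longrightarrow> reflection \<alpha> \<gamma> \<in> \<Delta>"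
  using weyl_root_vector_scalar by blast

text \<open>Reflected roots again have integral coefficients. Comparing them gives an equation for
  the value of a root on a coroot.\<close>

lemma reflection_coefficient:
  assumes "reflection (comb b) (comb a) = comb d" "\<iota> \<in> S"
  shows "of_int (a \<iota>) - comb a (h (comb b)) * of_int (b \<iota>) = of_int (d \<iota>)"
proof (rule simple_independent[OF _ assms(2)])
  fix y
  have "comb a y - comb a (h (comb b)) * comb b y = comb d y"
    using assms(1) unfolding reflection_def by (rule fun_cong)
  then show "(\<Sum>\<alpha>\<in>S. (of_int (a \<alpha>) - comb a (h (comb b)) * of_int (b \<alpha>)) * \<alpha> y) =
      (\<Sum>\<alpha>\<in>S. of_int (d \<alpha>) * \<alpha> y)"
    unfolding comb_def[of _] by (simp add: left_diff_distrib sum_subtractf sum_distrib_left mult.assoc)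
qed

lemmas comb_unit = simple_comb[symmetric]

text \<open>Comparison at a simple root that occurs in \<alpha> writes the value as a quotient of
  integers.\<close>

lemma root_coroot_real:
  assumes "\<alpha> \<in> \<Delta>" "\<gamma> \<in> \<Delta>"
  shows "\<gamma> (h \<alpha>) \<in> \<real>"
proof -
  obtain a b d where eq: "\<gamma> = comb a" "\<alpha> = comb b" "reflection \<alpha> \<gamma> = comb d"
    using root_comb assms reflection_root by metis
  obtain \<iota> where \<iota>: "\<iota> \<in> S" "b \<iota> \<noteq> 0"
    using root_coefficient_nonzero assms(1) eq(2) by blast
  have "of_int (a \<iota>) - \<gamma> (h \<alpha>) * of_int (b \<iota>) = of_int (d \<iota>)"
    using reflection_coefficient[of b a d \<iota>] eq \<iota>(1) by simp
  then have "\<gamma> (h \<alpha>) = (of_int (a \<iota>) - of_int (d \<iota>)) / of_int (b \<iota>)"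
    using \<iota>(2) by (simp add: field_simps)
  then show ?thesis by simp
qed

text \<open>For simple \<alpha> the comparison can be made at \<alpha> itself, where the denominator
  is 1.\<close>

lemma root_simple_coroot_int:
  assumes "\<alpha> \<in> S" "\<gamma> \<in> \<Delta>"
  shows "\<gamma> (h \<alpha>) \<in> \<int>"
proof -
  define b where "b = (\<lambda>\<gamma>. if \<gamma> = \<alpha> then 1 else 0 :: int)"
  obtain a d where eq: "\<gamma> = comb a" "reflection \<alpha> \<gamma> = comb d"
    using root_comb assms reflection_root S_roots by metis
  have "of_int (a \<alpha>) - \<gamma> (h \<alpha>) * of_int (b \<alpha>) = of_int (d \<alpha>)"
    using reflection_coefficient[of b a d \<alpha>] eq assms(1) comb_unit[OF assms(1)] by (simp add: b_def)
  then have "\<gamma> (h \<alpha>) = of_int (a \<alpha>) - of_int (d \<alpha>)"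
    by (simp add: b_def algebra_simps)
  then show ?thesis by simp
qed

text \<open>The Killing form on \<open>H\<close>; only its invariance under the reflections is needed, to compare the signs of
  \<open>\<alpha>(h\<^sub>\<gamma>)\<close> and \<open>\<gamma>(h\<^sub>\<alpha>)\<close>.\<close>

definition root_form :: "'g \<Rightarrow> 'g \<Rightarrow> complex" where
  "root_form y z = (\<Sum>\<delta>\<in>\<Delta>. \<delta> y * \<delta> z)"

text \<open>The reflection permutes the roots and changes the sign of their values on
  \<open>h \<alpha>\<close>; reindexing the sum by it gives the identity.\<close>

lemma root_form_coroot:
  assumes "\<alpha> \<in> \<Delta>"
  shows "2 * root_form (h \<alpha>) y = \<alpha> y * root_form (h \<alpha>) (h \<alpha>)"
proof -
  have "root_form (h \<alpha>) y = (\<Sum>\<delta>\<in>\<Delta>. reflection \<alpha> \<delta> (h \<alpha>) * reflection \<alpha> \<delta> y)"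
    unfolding root_form_def
    by (rule sum.reindex_bij_witness[of _ "reflection \<alpha>" "reflection \<alpha>"])
      (auto simp: reflection_reflection reflection_root assms)
  also have "\<dots> = (\<Sum>\<delta>\<in>\<Delta>. \<alpha> y * (\<delta> (h \<alpha>) * \<delta> (h \<alpha>)) - \<delta> (h \<alpha>) * \<delta> y)"
    by (rule sum.cong) (auto simp: reflection_def root_coroot assms algebra_simps)
  finally show ?thesis
    by (simp add: root_form_def sum_subtractf sum_distrib_left)
qed

text \<open>A sum of squares of real numbers in which \<alpha> itself contributes 4.\<close>

lemma root_form_positive:
  assumes "\<alpha> \<in> \<Delta>"
  obtains r where "0 < r" "root_form (h \<alpha>) (h \<alpha>) = of_real r"
proof
  have "\<delta> (h \<alpha>) = of_real (Re (\<delta> (h \<alpha>)))" if "\<delta> \<in> \<Delta>" for \<delta>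
    using root_coroot_real[OF assms that] by (simp add: of_real_Re)
  then show "root_form (h \<alpha>) (h \<alpha>) = of_real (\<Sum>\<delta>\<in>\<Delta>. Re (\<delta> (h \<alpha>)) * Re (\<delta> (h \<alpha>)))"
    by (auto simp: root_form_def intro!: sum.cong)
  show "0 < (\<Sum>\<delta>\<in>\<Delta>. Re (\<delta> (h \<alpha>)) * Re (\<delta> (h \<alpha>)))"
    by (rule sum_pos2[OF finite_roots assms]) (auto simp: root_coroot assms)
qed

text \<open>By symmetry of the form, \<open>\<alpha> (h \<gamma>)\<close> and
  \<open>\<gamma> (h \<alpha>)\<close> become equal after multiplication by suitable positive
  numbers.\<close>

lemma root_coroot_sign:
  assumes "\<alpha> \<in> \<Delta>" "\<gamma> \<in> \<Delta>" "0 < Re (\<alpha> (h \<gamma>))"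
  shows "0 < Re (\<gamma> (h \<alpha>))"
proof -
  obtain r where r: "0 < r" "root_form (h \<alpha>) (h \<alpha>) = of_real r"
    using root_form_positive[OF assms(1)] .
  obtain t where t: "0 < t" "root_form (h \<gamma>) (h \<gamma>) = of_real t"
    using root_form_positive[OF assms(2)] .
  have "root_form (h \<alpha>) (h \<gamma>) = root_form (h \<gamma>) (h \<alpha>)"
    by (simp add: root_form_def mult.commute)
  then have "\<alpha> (h \<gamma>) * of_real r = \<gamma> (h \<alpha>) * of_real t"
    using root_form_coroot[OF assms(1), of "h \<gamma>"] root_form_coroot[OF assms(2), of "h \<alpha>"] r t by simp
  from arg_cong[OF this, of Re] have "Re (\<alpha> (h \<gamma>)) * r = Re (\<gamma> (h \<alpha>)) * t"
    by simp
  then show ?thesis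
    using assms(3) r(1) t(1) by (metis mult_pos_pos zero_less_mult_pos2)
qed

text \<open>Let \<open>K\<close> be the largest multiple that is a root. Its root vector is killed
  by \<open>x \<alpha>\<close> and has \<open>h\<close>-weight \<open>2 K\<close>, so lowering it up
  to \<open>2 K\<close> times gives nonzero vectors. If \<open>K \<ge> 2\<close>, lowering
  \<open>K - 1\<close> times gives a multiple of \<open>x \<alpha>\<close>, which
  \<open>x \<alpha>\<close> kills, whereas raising it must give a nonzero multiple of the preceding
  vector.\<close>

lemma multiple_not_root:
  assumes "\<alpha> \<in> \<Delta>" "(\<lambda>y. of_nat k * \<alpha> y) \<in> \<Delta>"
  shows "k \<le> 1"
proof (rule ccontr)
  assume "\<not> k \<le> 1"
  let ?m = "\<lambda>k y. of_nat k * \<alpha> y"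
  have inj: "inj ?m"
  proof (rule injI)
    fix i j assume "?m i = ?m j"
    from fun_cong[OF this, of "h \<alpha>"] show "i = j"
      by (simp add: root_coroot assms(1))
  qed
  let ?R = "{k. ?m k \<in> \<Delta>}"
  have "finite ?R"
    using finite_vimageI[OF finite_roots inj] by (simp add: vimage_def)
  define K where "K = Max ?R"
  have K: "?m K \<in> \<Delta>" "?m (Suc K) \<notin> \<Delta>" "k \<le> K"
    using Max_in[OF \<open>finite ?R\<close>] Max_ge[OF \<open>finite ?R\<close>] assms(2) by (fastforce simp: K_def)+
  let ?f = "x (\<lambda>y. - \<alpha> y)" and ?w = "x (?m K)"
  have w: "?w \<in> ad.weight_space H (?m K)"
    using root_vector[OF K(1)] by (simp add: ad_weight_space)
  have "br (x \<alpha>) ?w \<in> root_space s br H (?m (Suc K))"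
    using ad.weight_space_shift[OF root_vector[OF assms(1)] w] by (simp add: ad_weight_space algebra_simps)
  moreover have "?m (Suc K) \<noteq> (\<lambda>_. 0)"
    using inj unfolding inj_def by (metis (no_types, lifting) mult_zero_left nat.distinct(1) of_nat_0)
  ultimately have "br (x \<alpha>) ?w = 0"
    using root_space_zero[OF dual_space_scale[OF root_dual[OF assms(1)]]] K(2) by blast
  then have e: "br (x \<alpha>) (ad.dp (Suc j) ?f ?w) = s (2 * of_nat K - of_nat j) (ad.dp j ?f ?w)" for j
    using adm.act_dp_opposite[OF assms(1) w, of j] by (simp add: root_coroot assms(1) mult.commute)
  have nz: "j \<le> 2 * K \<Longrightarrow> ad.dp j ?f ?w \<noteq> 0" for j
  proof (induction j)
    case (Suc j)
    have "(2 * of_nat K - of_nat j :: complex) \<noteq> 0"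
      using Suc.prems by (metis Suc_le_eq less_irrefl of_nat_eq_iff of_nat_mult of_nat_numeral right_minus_eq)
    then show ?case
      using e[of j] Suc by auto
  qed (use root_vector_nonzero[OF K(1)] in simp)
  obtain K' where K': "K = Suc (Suc K')"
    using \<open>\<not> k \<le> 1\<close> K(3) by (metis One_nat_def Suc_le_D le_trans not_less_eq_eq)
  have "ad.dp (Suc K') ?f ?w \<in> ad.weight_space H (\<lambda>z. of_nat K * \<alpha> z + of_nat (Suc K') * - \<alpha> z)"
    by (rule ad.weight_space_dp[OF root_vector[OF neg_root[OF assms(1)]] w])
  then have "ad.dp (Suc K') ?f ?w \<in> root_space s br H \<alpha>"
    by (simp add: K' ad_weight_space algebra_simps)
  then obtain c where "ad.dp (Suc K') ?f ?w = s c (x \<alpha>)"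
    using root_space_one_dim[OF assms(1)] by metis
  then have "s (2 * of_nat K - of_nat K') (ad.dp K' ?f ?w) = 0"
    using e[of K'] by (simp add: ad.act_scale_right br_self)
  moreover have "2 * of_nat K - of_nat K' = (of_nat (K' + 4) :: complex)"
    by (simp add: K')
  ultimately show False
    using nz[of K'] K' by (simp del: of_nat_add)
qed

text \<open>Expanding \<open>\<gamma> (h \<gamma>) = 2\<close> in simple roots yields a simple
  \<alpha> with \<open>\<alpha> (h \<gamma>) > 0\<close>, hence with
  \<open>\<gamma> (h \<alpha>)\<close> a positive integer. The reflection lowers only the
  coefficient of \<alpha>, and another positive coefficient keeps the root positive.\<close>

lemma simple_descent:
  assumes "\<gamma> \<in> \<Phi>" "\<gamma> \<notin> S"
  obtains \<alpha> where "\<alpha> \<in> S" "reflection \<alpha> \<gamma> \<in> \<Phi>" "height S (reflection \<alpha> \<gamma>) < height S \<gamma>"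
    "\<And>k::int. \<gamma> \<noteq> (\<lambda>y. of_int k * \<alpha> y)"
proof -
  have \<gamma>: "\<gamma> \<in> \<Delta>" using assms(1) by (rule positive_root)
  obtain a where a: "\<gamma> = comb a" "\<forall>\<alpha>\<in>S. 0 \<le> a \<alpha>"
    using assms(1) by (auto simp: positive_iff)
  have "2 = (\<Sum>\<alpha>\<in>S. of_int (a \<alpha>) * \<alpha> (h \<gamma>))"
    using root_coroot[OF \<gamma>] a(1) by (simp add: comb_def)
  from arg_cong[OF this, of Re] have "(\<Sum>\<alpha>\<in>S. of_int (a \<alpha>) * Re (\<alpha> (h \<gamma>))) = 2"
    by simp
  then have "\<not> (\<forall>\<alpha>\<in>S. of_int (a \<alpha>) * Re (\<alpha> (h \<gamma>)) \<le> 0)"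
    using sum_nonpos[of S "\<lambda>\<alpha>. of_int (a \<alpha>) * Re (\<alpha> (h \<gamma>))"] by auto
  then obtain \<alpha> where \<alpha>: "\<alpha> \<in> S" "0 < of_int (a \<alpha>) * Re (\<alpha> (h \<gamma>))"
    by (auto simp: not_le)
  have "0 \<le> a \<alpha>" using a(2) \<alpha>(1) by blast
  then have "0 < Re (\<alpha> (h \<gamma>))"
    using \<alpha>(2) by (simp add: zero_less_mult_iff)
  then have pos: "0 < Re (\<gamma> (h \<alpha>))"
    using root_coroot_sign S_roots \<alpha>(1) \<gamma> by blast
  obtain k where k: "\<gamma> (h \<alpha>) = of_int k"
    using root_simple_coroot_int[OF \<alpha>(1) \<gamma>] by (elim Ints_cases)
  have "0 < k" using pos k by simp
  define d where "d = (\<lambda>\<iota>. a \<iota> + (- k) * (if \<iota> = \<alpha> then 1 else 0))"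
  have refl_eq: "reflection \<alpha> \<gamma> = comb d"
  proof
    fix y
    have "\<alpha> y = comb (\<lambda>\<gamma>. if \<gamma> = \<alpha> then 1 else 0) y"
      using simple_comb[OF \<alpha>(1)] by (rule fun_cong)
    then show "reflection \<alpha> \<gamma> y = comb d y"
      unfolding d_def reflection_def k comb_add comb_scale by (simp add: a(1))
  qed
  \<comment> \<open>A root supported on \<alpha> alone would be \<alpha> itself by
    \<open>multiple_not_root\<close>, but \<gamma> is not simple.\<close>
  have "\<exists>\<iota>\<in>S. \<iota> \<noteq> \<alpha> \<and> a \<iota> \<noteq> 0"
  proof (rule ccontr)
    assume "\<not> ?thesis"
    then have coeff: "a \<iota> = a \<alpha> * (if \<iota> = \<alpha> then 1 else 0)" if "\<iota> \<in> S" for \<iota>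
      using that by (cases "\<iota> = \<alpha>") auto
    have \<gamma>_comb: "\<gamma> = comb (\<lambda>\<iota>. a \<alpha> * (if \<iota> = \<alpha> then 1 else 0))"
      unfolding a(1) comb_def
    proof (intro ext sum.cong refl)
      fix y \<iota> assume "\<iota> \<in> S"
      from coeff[OF this] show "of_int (a \<iota>) * \<iota> y = of_int (a \<alpha> * (if \<iota> = \<alpha> then 1 else 0)) * \<iota> y"
        by (rule arg_cong)
    qed
    have eq: "\<gamma> = (\<lambda>y. of_int (a \<alpha>) * \<alpha> y)"
      by (rule ext, subst \<gamma>_comb) (simp only: comb_scale comb_unit[OF \<alpha>(1)])
    then have "\<gamma> = (\<lambda>y. of_nat (nat (a \<alpha>)) * \<alpha> y)"
      using \<open>0 \<le> a \<alpha>\<close> by simp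
    then have "nat (a \<alpha>) \<le> 1"
      using multiple_not_root[OF S_roots[OF \<alpha>(1)]] \<gamma> by blast
    moreover have "a \<alpha> \<noteq> 0"
      using \<alpha>(2) by auto
    ultimately have "a \<alpha> = 1"
      using \<open>0 \<le> a \<alpha>\<close> by linarith
    then have "\<gamma> = \<alpha>"
      using eq by simp
    then show False
      using assms(2) \<alpha>(1) by simp
  qed
  then obtain \<iota> where \<iota>: "\<iota> \<in> S" "\<iota> \<noteq> \<alpha>" "a \<iota> \<noteq> 0" by blast
  have root: "reflection \<alpha> \<gamma> \<in> \<Delta>"
    by (rule reflection_root[OF S_roots[OF \<alpha>(1)] \<gamma>])
  then obtain d' where d': "comb d = comb d'" "(\<forall>\<alpha>\<in>S. 0 \<le> d' \<alpha>) \<or> (\<forall>\<alpha>\<in>S. d' \<alpha> \<le> 0)"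
    unfolding refl_eq using root_comb by metis
  then have "(\<forall>\<alpha>\<in>S. 0 \<le> d \<alpha>) \<or> (\<forall>\<alpha>\<in>S. d \<alpha> \<le> 0)"
    using comb_inject[OF d'(1)] by simp
  moreover have "0 < d \<iota>"
    using \<iota> a(2) by (simp add: d_def order_less_le)
  ultimately have "reflection \<alpha> \<gamma> \<in> \<Phi>"
    using root refl_eq \<iota>(1) unfolding positive_iff by (metis not_le)
  moreover have "height S (comb d) < height S (comb a)"
    using \<open>0 < k\<close> \<alpha>(1) finite_S by (simp add: height_comb d_def sum_subtractf flip: sum_distrib_left)
  then have "height S (reflection \<alpha> \<gamma>) < height S \<gamma>"
    by (simp only: refl_eq a(1)[symmetric])
  moreover have "\<gamma> \<noteq> (\<lambda>y. of_int k * \<alpha> y)" for k :: int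
  proof
    assume \<gamma>_eq: "\<gamma> = (\<lambda>y. of_int k * \<alpha> y)"
    have "comb a y = comb (\<lambda>\<iota>. k * (if \<iota> = \<alpha> then 1 else 0)) y" for y
      by (simp only: comb_scale comb_unit[OF \<alpha>(1)] a(1)[symmetric] \<gamma>_eq)
    then have "comb a = comb (\<lambda>\<iota>. k * (if \<iota> = \<alpha> then 1 else 0))"
      by (rule ext)
    from comb_inject[OF this \<iota>(1)] show False
      using \<iota> by simp
  qed
  ultimately show ?thesis
    using that \<alpha>(1) by blast
qed

section \<open>Integrality of the lifted reflections on root strings\<close>

abbreviation string_length :: "('g \<Rightarrow> complex) \<Rightarrow> ('g \<Rightarrow> complex) \<Rightarrow> nat" where
  "string_length \<alpha> \<gamma> \<equiv> GREATEST r :: nat. (\<lambda>y. \<gamma> y - of_nat r * \<alpha> y) \<in> \<Delta>"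

text \<open>Finiteness of the root system makes the maximum exist; the substitution
  \<open>r = r' + n\<close> then matches the two strings.\<close>

lemma string_length_shift:
  assumes "\<alpha> \<in> \<Delta>" "\<gamma> \<in> \<Delta>"
  shows "string_length \<alpha> (\<lambda>y. \<gamma> y + of_nat n * \<alpha> y) = string_length \<alpha> \<gamma> + n"
proof -
  let ?P = "\<lambda>r :: nat. (\<lambda>y. \<gamma> y - of_nat r * \<alpha> y) \<in> \<Delta>"
  have inj: "inj (\<lambda>r y. \<gamma> y - of_nat r * \<alpha> y)"
  proof (rule injI)
    fix i j :: nat assume "(\<lambda>y. \<gamma> y - of_nat i * \<alpha> y) = (\<lambda>y. \<gamma> y - of_nat j * \<alpha> y)"
    from fun_cong[OF this, of "h \<alpha>"] show "i = j"
      by (simp add: root_coroot assms(1))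
  qed
  have fin: "finite {r. ?P r}"
    using finite_vimageI[OF finite_roots inj] by (simp add: vimage_def)
  then have bound: "\<forall>r. ?P r \<longrightarrow> r \<le> Max {r. ?P r}"
    by auto
  have "?P 0" using assms(2) by simp
  then have P: "?P (string_length \<alpha> \<gamma>)"
    using GreatestI_nat[of ?P 0] bound by blast
  have le: "r \<le> string_length \<alpha> \<gamma>" if "?P r" for r
    using Greatest_le_nat[of ?P, OF that] bound by blast
  show ?thesis
  proof (rule Greatest_equality)
    have "(\<lambda>y. \<gamma> y + of_nat n * \<alpha> y - of_nat (string_length \<alpha> \<gamma> + n) * \<alpha> y) =
        (\<lambda>y. \<gamma> y - of_nat (string_length \<alpha> \<gamma>) * \<alpha> y)"
      by (simp add: algebra_simps)
    then show "(\<lambda>y. \<gamma> y + of_nat n * \<alpha> y - of_nat (string_length \<alpha> \<gamma> + n) * \<alpha> y) \<in> \<Delta>"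
      using P by simp
    fix r assume r: "(\<lambda>y. \<gamma> y + of_nat n * \<alpha> y - of_nat r * \<alpha> y) \<in> \<Delta>"
    show "r \<le> string_length \<alpha> \<gamma> + n"
    proof (cases "n \<le> r")
      case True
      then have "(\<lambda>y. \<gamma> y + of_nat n * \<alpha> y - of_nat r * \<alpha> y) = (\<lambda>y. \<gamma> y - of_nat (r - n) * \<alpha> y)"
        by (simp add: of_nat_diff algebra_simps)
      then show ?thesis
        using le[of "r - n"] r by simp
    qed simp
  qed
qed

text \<open>The sign is recorded merely as an integer \<epsilon>; what matters is divisibility by
  the string length plus 1.\<close>

lemma structure_constant:
  assumes "\<alpha> \<in> \<Delta>" "\<beta> \<in> \<Delta>" "(\<lambda>y. \<alpha> y + \<beta> y) \<in> \<Delta>"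
  obtains \<epsilon> :: int where "br (x \<alpha>) (x \<beta>) = s (of_int \<epsilon> * of_nat (string_length \<alpha> \<beta> + 1)) (x (\<lambda>y. \<alpha> y + \<beta> y))"
proof -
  let ?r = "string_length \<alpha> \<beta>"
  have "br (x \<alpha>) (x \<beta>) = s (of_nat (?r + 1)) (x (\<lambda>y. \<alpha> y + \<beta> y)) \<or>
      br (x \<alpha>) (x \<beta>) = s (- of_nat (?r + 1)) (x (\<lambda>y. \<alpha> y + \<beta> y))"
    using basis assms unfolding chevalley_basis_def Let_def by blast
  then show ?thesis
    using that[of 1] that[of "- 1"] by auto
qed

text \<open>Step \<open>n\<close> multiplies by \<open>r + n + 1\<close> up to an integer, and
  division by \<open>n + 1\<close> turns the running product into a binomial coefficient. Excluding
  multiples of \<alpha> keeps the weight 0 out of the string, so outside the roots the bracket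
  vanishes.\<close>

lemma string_divided_power:
  assumes "\<alpha> \<in> \<Delta>" "\<gamma> \<in> \<Delta>" "\<And>k::int. \<gamma> \<noteq> (\<lambda>y. of_int k * \<alpha> y)"
  shows "ad.dp n (x \<alpha>) (x \<gamma>) = 0 \<or> (\<lambda>y. \<gamma> y + of_nat n * \<alpha> y) \<in> \<Delta> \<and>
    (\<exists>\<epsilon>::int. ad.dp n (x \<alpha>) (x \<gamma>) =
      s (of_int \<epsilon> * of_nat ((string_length \<alpha> \<gamma> + n) choose n)) (x (\<lambda>y. \<gamma> y + of_nat n * \<alpha> y)))"
proof (induction n)
  case 0
  show ?case
    using assms(2) by (auto intro!: exI[of _ 1])
next
  case (Suc n)
  let ?\<gamma> = "\<lambda>n y. \<gamma> y + of_nat n * \<alpha> y" and ?r = "string_length \<alpha> \<gamma>"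
  show ?case
  proof (cases "ad.dp n (x \<alpha>) (x \<gamma>) = 0")
    case True
    then show ?thesis by (simp add: ad.dp_Suc)
  next
    case False
    then obtain \<epsilon> :: int where n: "?\<gamma> n \<in> \<Delta>"
      "ad.dp n (x \<alpha>) (x \<gamma>) = s (of_int \<epsilon> * of_nat ((?r + n) choose n)) (x (?\<gamma> n))"
      using Suc.IH by blast
    have eq: "(\<lambda>y. \<alpha> y + ?\<gamma> n y) = ?\<gamma> (Suc n)"
      by (simp add: algebra_simps)
    show ?thesis
    proof (cases "?\<gamma> (Suc n) \<in> \<Delta>")
      case True
      obtain \<epsilon>' :: int where \<epsilon>': "br (x \<alpha>) (x (?\<gamma> n)) =
          s (of_int \<epsilon>' * of_nat (string_length \<alpha> (?\<gamma> n) + 1)) (x (\<lambda>y. \<alpha> y + ?\<gamma> n y))"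
        by (rule structure_constant[OF assms(1) n(1)]) (simp only: eq True, rule that)
      have "Suc (?r + n) * ((?r + n) choose n) = (Suc (?r + n) choose Suc n) * Suc n"
        by (rule Suc_times_binomial_eq)
      from arg_cong[OF this, of "of_nat :: nat \<Rightarrow> complex"]
      have "of_nat (?r + n + 1) * of_nat ((?r + n) choose n) =
          (of_nat ((?r + Suc n) choose Suc n) * of_nat (Suc n) :: complex)"
        by (simp only: of_nat_mult add_Suc_right Suc_eq_plus1 add.assoc)
      then have binom: "of_nat ((?r + n) choose n) * of_nat (?r + n + 1) / of_nat (Suc n) =
          (of_nat ((?r + Suc n) choose Suc n) :: complex)"
        by (subst nonzero_divide_eq_eq) (simp_all only: of_nat_neq_0 mult.commute simp_thms)
      have "ad.dp (Suc n) (x \<alpha>) (x \<gamma>) =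
          s (of_int (\<epsilon> * \<epsilon>') * (of_nat ((?r + n) choose n) * of_nat (?r + n + 1) / of_nat (Suc n))) (x (?\<gamma> (Suc n)))"
        unfolding ad.dp_Suc n(2) ad.act_scale_right \<epsilon>' string_length_shift[OF assms(1,2)] eq scale_scale
        by (simp add: mult_ac)
      then show ?thesis
        unfolding binom using True by blast
    next
      case False
      have "br (x \<alpha>) (x (?\<gamma> n)) \<in> root_space s br H (?\<gamma> (Suc n))"
        using ad.weight_space_shift[OF root_vector[OF assms(1)], of "x (?\<gamma> n)" "?\<gamma> n"] root_vector[OF n(1)]
        by (simp add: ad_weight_space algebra_simps)
      moreover have "?\<gamma> (Suc n) \<in> dual_space s H"
        by (intro dual_space_add dual_space_scale root_dual assms)
      moreover have "?\<gamma> (Suc n) \<noteq> (\<lambda>_. 0)"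
      proof
        assume zero: "?\<gamma> (Suc n) = (\<lambda>_. 0)"
        have "\<gamma> y = of_int (- int (Suc n)) * \<alpha> y" for y
          using fun_cong[OF zero, of y] by (simp add: eq_neg_iff_add_eq_0[symmetric] del: of_nat_Suc)
        then have "\<gamma> = (\<lambda>y. of_int (- int (Suc n)) * \<alpha> y)"
          by (rule ext)
        then show False
          using assms(3) by blast
      qed
      ultimately have "br (x \<alpha>) (x (?\<gamma> n)) = 0"
        using root_space_zero False by blast
      then show ?thesis
        by (simp add: ad.dp_Suc n(2) ad.act_scale_right)
    qed
  qed
qed

text \<open>The index \<open>k\<close> runs over integers of both signs, so that \<alpha> and its
  negative give the same string.\<close>

definition root_string :: "('g \<Rightarrow> complex) \<Rightarrow> ('g \<Rightarrow> complex) \<Rightarrow> 'g set" where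
  "root_string \<alpha> \<gamma> = {x \<delta> | \<delta>. \<delta> \<in> \<Delta> \<and> (\<exists>k::int. \<delta> = (\<lambda>y. \<gamma> y + of_int k * \<alpha> y))}"

lemma root_string_dp:
  assumes "\<alpha> \<in> \<Delta>" "\<And>k::int. \<gamma> \<noteq> (\<lambda>y. of_int k * \<alpha> y)" "a \<in> root_string \<alpha> \<gamma>"
  shows "ad.dp n (x \<alpha>) a \<in> additive_span (root_string \<alpha> \<gamma>)"
proof -
  obtain \<delta> and k :: int where \<delta>: "a = x \<delta>" "\<delta> \<in> \<Delta>" "\<delta> = (\<lambda>y. \<gamma> y + of_int k * \<alpha> y)"
    using assms(3) by (auto simp: root_string_def)
  have "\<delta> \<noteq> (\<lambda>y. of_int l * \<alpha> y)" for l :: int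
  proof
    assume "\<delta> = (\<lambda>y. of_int l * \<alpha> y)"
    then have "\<gamma> = (\<lambda>y. of_int (l - k) * \<alpha> y)"
      using \<delta>(3) by (auto simp: fun_eq_iff algebra_simps)
    then show False using assms(2) by blast
  qed
  from string_divided_power[OF assms(1) \<delta>(2) this, of n] show ?thesis
  proof (elim disjE conjE exE)
    assume "ad.dp n (x \<alpha>) (x \<delta>) = 0"
    then show ?thesis by (simp add: \<delta>(1) additive_span.zero)
  next
    fix \<epsilon> :: int
    let ?\<delta> = "\<lambda>y. \<delta> y + of_nat n * \<alpha> y"
    assume mem: "?\<delta> \<in> \<Delta>" and
      eq: "ad.dp n (x \<alpha>) (x \<delta>) = s (of_int \<epsilon> * of_nat ((string_length \<alpha> \<delta> + n) choose n)) (x ?\<delta>)"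
    have "?\<delta> = (\<lambda>y. \<gamma> y + of_int (k + int n) * \<alpha> y)"
      by (simp add: \<delta>(3) algebra_simps)
    then have "x ?\<delta> \<in> root_string \<alpha> \<gamma>"
      unfolding root_string_def using mem by blast
    then have "s (of_int (\<epsilon> * int ((string_length \<alpha> \<delta> + n) choose n))) (x ?\<delta>) \<in> additive_span (root_string \<alpha> \<gamma>)"
      by (intro additive_span_scale additive_span.base)
    then show ?thesis by (simp add: \<delta>(1) eq)
  qed
qed

lemma root_string_neg: "root_string (\<lambda>y. - \<alpha> y) \<gamma> = root_string \<alpha> \<gamma>"
proof -
  have "(\<exists>k::int. \<delta> = (\<lambda>y. \<gamma> y + of_int k * - \<alpha> y)) \<longleftrightarrow> (\<exists>k::int. \<delta> = (\<lambda>y. \<gamma> y + of_int k * \<alpha> y))" for \<delta>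
    by (safe, (rule exI[of _ "- _"], simp)+)
  then show ?thesis by (simp add: root_string_def)
qed

text \<open>The exponentials at times 1 and -1 preserve the integral span of the string. Every
  element of that span has an integral coefficient at the reflected root, and the image has no other
  component.\<close>

lemma weyl_root_vector:
  assumes "\<alpha> \<in> \<Delta>" "\<gamma> \<in> \<Delta>" "\<And>k::int. \<gamma> \<noteq> (\<lambda>y. of_int k * \<alpha> y)"
  obtains m :: int where "adm.weyl \<alpha> (x \<gamma>) = s (of_int m) (x (reflection \<alpha> \<gamma>))"
proof -
  let ?A = "root_string \<alpha> \<gamma>" and ?\<delta> = "reflection \<alpha> \<gamma>"
  have neg: "\<gamma> \<noteq> (\<lambda>y. of_int k * - \<alpha> y)" for k :: int
    using assms(3)[of "- k"] by simp
  note dp = root_string_dp[OF assms(1,3)] root_string_dp[OF neg_root[OF assms(1)] neg, unfolded root_string_neg]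
  note nil = adm.root_vector_nilpotent[OF assms(1)] adm.root_vector_nilpotent[OF neg_root[OF assms(1)]]
  have "x \<gamma> \<in> ?A"
    using assms(2) by (auto simp: root_string_def intro!: exI[of _ \<gamma>] exI[of _ "0::int"])
  then have "adm.weyl \<alpha> (x \<gamma>) \<in> additive_span ?A"
    unfolding adm.weyl_def
    by (intro ad.additive_span_chi[OF nil(1)] ad.additive_span_chi[OF nil(2)] dp additive_span.base) auto
  moreover have "\<exists>m::int. u - s (of_int m) (x ?\<delta>) \<in> ad.off_weight H ?\<delta>" if "u \<in> additive_span ?A" for u
    using that
  proof induction
    case (base a)
    then obtain \<delta> where \<delta>: "a = x \<delta>" "\<delta> \<in> \<Delta>"
      by (auto simp: root_string_def)
    show ?case
    proof (cases "\<delta> = ?\<delta>")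
      case True
      then show ?thesis
        using \<delta> subspace_0[OF ad.subspace_off_weight] by (intro exI[of _ 1]) simp
    next
      case False
      then show ?thesis
        using ad.weight_space_off[of a H \<delta>] \<delta> root_vector root_dual
        by (intro exI[of _ 0]) (simp add: ad_weight_space)
    qed
  next
    case zero
    then show ?case
      using subspace_0[OF ad.subspace_off_weight] by (intro exI[of _ 0]) simp
  next
    case (diff a b)
    then obtain k l :: int where "a - s (of_int k) (x ?\<delta>) \<in> ad.off_weight H ?\<delta>"
      "b - s (of_int l) (x ?\<delta>) \<in> ad.off_weight H ?\<delta>" by blast
    from subspace_diff[OF ad.subspace_off_weight this] show ?case
      by (intro exI[of _ "k - l"]) (simp add: scale_left_diff_distrib algebra_simps)
  qed
  ultimately obtain m :: int where m: "adm.weyl \<alpha> (x \<gamma>) - s (of_int m) (x ?\<delta>) \<in> ad.off_weight H ?\<delta>"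
    by blast
  have "?\<delta> \<in> \<Delta>" by (rule reflection_root[OF assms(1,2)])
  then have "x ?\<delta> \<in> ad.weight_space H ?\<delta>"
    by (simp add: ad_weight_space root_vector)
  moreover obtain c where "adm.weyl \<alpha> (x \<gamma>) = s c (x ?\<delta>)"
    using weyl_root_vector_scalar[OF assms(1,2)] by blast
  ultimately have "adm.weyl \<alpha> (x \<gamma>) - s (of_int m) (x ?\<delta>) \<in> ad.weight_space H ?\<delta>"
    using subspace_diff[OF ad.subspace_weight_space] subspace_scale[OF ad.subspace_weight_space] by simp
  from ad.weight_space_Int_off[OF root_dual[OF \<open>?\<delta> \<in> \<Delta>\<close>] this m]
  show ?thesis
    by (intro that[of m]) simp
qed

end

section \<open>The lattice of lowering monomials\<close>

text \<open>Negating the upper argument reduces the negative case to ordinary binomial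
  coefficients.\<close>

lemma gbinomial_Ints:
  assumes "(c :: 'a::field_char_0) \<in> \<int>"
  shows "c gchoose k \<in> \<int>"
proof -
  have nat: "(of_nat n :: 'a) gchoose k \<in> \<int>" for n
    by (simp flip: binomial_gbinomial)
  obtain i where i: "c = of_int i"
    using assms by (elim Ints_cases)
  show ?thesis
  proof (cases i)
    case (nonneg n)
    then show ?thesis using nat[of n] by (simp add: i)
  next
    case (neg n)
    then have eq: "of_nat k - c - 1 = (of_nat (k + n) :: 'a)"
      by (simp add: i)
    show ?thesis
      unfolding gbinomial_negated_upper[of c k] eq by (intro Ints_mult Ints_power nat) simp
  qed
qed

lemma (in vector_space) additive_span_Ints:
  "c \<in> \<int> \<Longrightarrow> a \<in> additive_span A \<Longrightarrow> scale c a \<in> additive_span A"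
  by (elim Ints_cases) (simp add: additive_span_scale)

lemma (in lie_module) act_dp_commute: "br y z = 0 \<Longrightarrow> \<rho> y (dp m z w) = dp m z (\<rho> y w)"
  by (induction m) (simp_all add: dp_Suc act_scale_right act_commute[of y z])

lemma (in lie_module) dp_commute: "br y z = 0 \<Longrightarrow> dp n y (dp m z w) = dp m z (dp n y w)"
  by (induction n) (simp_all add: dp_Suc act_dp_commute dp_scale)

locale highest_weight_module = chevalley s br H S x h + lie_module s br sv \<rho>
  for s :: "complex \<Rightarrow> 'g::ab_group_add \<Rightarrow> 'g" and br H S x h
    and sv :: "complex \<Rightarrow> 'v::ab_group_add \<Rightarrow> 'v" and \<rho> +
  fixes \<Lambda> v
  assumes finite_dim_V: "\<exists>B. finite_dimensional_vector_space sv B"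
    and irreducible: "irreducible_module sv \<rho>"
    and dominant: "dominant_integral s H S h \<Lambda>"
    and highest: "highest_weight_vector s br H S sv \<rho> \<Lambda> v"
begin

lemma highest_dual: "\<Lambda> \<in> dual_space s H"
  using dominant by (simp add: dominant_integral_def)

lemma highest_nonzero: "v \<noteq> 0"
  using highest by (simp add: highest_weight_vector_def)

lemma highest_weight: "v \<in> weight_space H \<Lambda>"
  using highest by (simp add: highest_weight_vector_def weight_space_def)

text \<open>The algebra elements that preserve \<open>W\<close> form a subspace, so testing on the
  Chevalley basis suffices.\<close>

lemma submodule_basis:
  assumes W: "V.subspace W"
    and "\<And>\<alpha> w. \<alpha> \<in> \<Delta> \<Longrightarrow> w \<in> W \<Longrightarrow> \<rho> (x \<alpha>) w \<in> W"
    and "\<And>\<alpha> w. \<alpha> \<in> S \<Longrightarrow> w \<in> W \<Longrightarrow> \<rho> (h \<alpha>) w \<in> W"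
  shows "W = {0} \<or> W = UNIV"
proof -
  have "subspace {y. \<forall>w\<in>W. \<rho> y w \<in> W}"
    using V.subspace_0[OF W] V.subspace_add[OF W] V.subspace_scale[OF W]
    by (auto simp: subspace_def act_add_left act_scale_left)
  moreover have "x ` \<Delta> \<union> h ` S \<subseteq> {y. \<forall>w\<in>W. \<rho> y w \<in> W}"
    using assms(2,3) by auto
  ultimately have "{y. \<forall>w\<in>W. \<rho> y w \<in> W} = UNIV"
    using span_minimal span_basis by blast
  then show ?thesis
    using irreducible W unfolding irreducible_module_def by blast
qed

text \<open>The span of the weight vectors is a submodule containing \<open>v\<close>, so
  irreducibility makes it everything.\<close>

lemma module_weight_spaces_span: "V.span (\<Union>\<mu>\<in>dual_space s H. weight_space H \<mu>) = UNIV"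
proof -
  let ?W = "V.span (\<Union>\<mu>\<in>dual_space s H. weight_space H \<mu>)"
  have closed: "\<rho> y w \<in> ?W"
    if "\<And>\<mu> w. \<mu> \<in> dual_space s H \<Longrightarrow> w \<in> weight_space H \<mu> \<Longrightarrow> \<rho> y w \<in> ?W" "w \<in> ?W" for y w
    using that(2)
    by (induction rule: V.span_induct_alt)
      (auto simp: act_add_right act_scale_right intro: V.span_zero V.span_add V.span_scale that(1))
  have "?W = {0} \<or> ?W = UNIV"
  proof (rule submodule_basis)
    fix \<alpha> w assume \<alpha>: "\<alpha> \<in> \<Delta>" and "w \<in> ?W"
    from \<open>w \<in> ?W\<close> show "\<rho> (x \<alpha>) w \<in> ?W"
      by (rule closed[rotated])
        (use weight_space_shift[OF root_vector[OF \<alpha>]] dual_space_add[OF _ root_dual[OF \<alpha>]] in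
          \<open>blast intro: V.span_base\<close>)
  next
    fix \<alpha> w assume \<alpha>: "\<alpha> \<in> S" and "w \<in> ?W"
    from \<open>w \<in> ?W\<close> show "\<rho> (h \<alpha>) w \<in> ?W"
    proof (rule closed[rotated])
      fix \<mu> w assume \<mu>: "\<mu> \<in> dual_space s H" and w: "w \<in> weight_space H \<mu>"
      have "\<rho> (h \<alpha>) w = sv (\<mu> (h \<alpha>)) w"
        using w coroot_in_H S_roots \<alpha> by (blast intro: weight_spaceD)
      then show "\<rho> (h \<alpha>) w \<in> ?W"
        by (simp only:) (rule V.span_scale, rule V.span_base, use \<mu> w in blast)
    qed
  qed simp
  moreover have "v \<in> ?W"
    using highest_weight highest_dual by (auto intro: V.span_base)
  ultimately show ?thesis
    using highest_nonzero by auto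
qed

end

sublocale highest_weight_module \<subseteq> chevalley_module
  by unfold_locales (rule finite_dim_V module_weight_spaces_span)+

context highest_weight_module
begin

text \<open>The second argument records the weight: \<open>lowering w a\<close> makes \<open>w\<close> a vector of weight
  \<open>\<Lambda> - \<Sum>\<iota>. a \<iota> \<cdot> \<iota>\<close>.\<close>

inductive lowering :: "'v \<Rightarrow> (('g \<Rightarrow> complex) \<Rightarrow> int) \<Rightarrow> bool" where
  highest: "lowering v (\<lambda>_. 0)"
| lower: "lowering w a \<Longrightarrow> \<alpha> \<in> S \<Longrightarrow>
    lowering (dp m (x (\<lambda>y. - \<alpha> y)) w) (\<lambda>\<iota>. a \<iota> + int m * (if \<iota> = \<alpha> then 1 else 0))"

definition wt :: "(('g \<Rightarrow> complex) \<Rightarrow> int) \<Rightarrow> 'g \<Rightarrow> complex" where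
  "wt a = (\<lambda>y. \<Lambda> y - comb a y)"

text \<open>The group \<open>M\<close> of the idea; \<open>kostant_lattice_eq\<close> identifies it
  with the Kostant lattice. Generators that are explicit weight vectors make the grading
  visible.\<close>

definition lattice :: "'v set" where
  "lattice = additive_span {w. \<exists>a. lowering w a}"

lemma wt_dual: "wt a \<in> dual_space s H"
  using dual_space_add[OF highest_dual dual_space_scale[OF comb_dual, of "- 1" a]]
  by (simp add: wt_def)

lemma comb_coroot_int: "\<alpha> \<in> S \<Longrightarrow> comb a (h \<alpha>) \<in> \<int>"
  unfolding comb_def by (intro Ints_sum Ints_mult Ints_of_int root_simple_coroot_int S_roots)

lemma wt_coroot_int: "\<alpha> \<in> S \<Longrightarrow> wt a (h \<alpha>) \<in> \<int>"
  using dominant Nats_subset_Ints unfolding wt_def dominant_integral_def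
  by (intro Ints_diff comb_coroot_int) auto

lemma lowering_weight: "lowering w a \<Longrightarrow> w \<in> weight_space H (wt a)"
proof (induction rule: lowering.induct)
  case highest
  then show ?case
    using highest_weight by (simp add: wt_def comb_zero)
next
  case (lower w a \<alpha> m)
  have "(\<lambda>z. wt a z + of_nat m * - \<alpha> z) = wt (\<lambda>\<iota>. a \<iota> + int m * (if \<iota> = \<alpha> then 1 else 0))"
    by (rule ext) (simp only: wt_def comb_add comb_scale comb_unit[OF lower.hyps(2)], simp)
  then show ?case
    using weight_space_dp[OF root_vector[OF neg_root[OF S_roots[OF lower.hyps(2)]]] lower.IH, of m] by simp
qed

lemma lowering_nonneg: "lowering w a \<Longrightarrow> 0 \<le> a \<iota>"
  by (induction rule: lowering.induct) auto

text \<open>Coefficients never cancel, being nonnegative, so every exponent \<open>m\<close> in the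
  monomial is 0.\<close>

lemma lowering_zero: "lowering w a \<Longrightarrow> (\<And>\<iota>. \<iota> \<in> S \<Longrightarrow> a \<iota> = 0) \<Longrightarrow> w = v"
proof (induction rule: lowering.induct)
  case (lower w a \<alpha> m)
  have "a \<iota> = 0 \<and> int m * (if \<iota> = \<alpha> then 1 else 0) = 0" if "\<iota> \<in> S" for \<iota>
    using lower.prems[OF that] lowering_nonneg[OF lower.hyps(1), of \<iota>] by (auto split: if_splits)
  then show ?case
    using lower.IH lower.hyps(2) by fastforce
qed simp

lemma lattice_lowering: "lowering w a \<Longrightarrow> w \<in> lattice"
  unfolding lattice_def by (blast intro: additive_span.base)

lemma highest_in_lattice: "v \<in> lattice"
  using lowering.highest by (rule lattice_lowering)

lemma lattice_induct [consumes 1, case_names lowering zero diff]: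
  assumes "w \<in> lattice" "\<And>w a. lowering w a \<Longrightarrow> P w" "P 0"
    "\<And>a b. a \<in> lattice \<Longrightarrow> b \<in> lattice \<Longrightarrow> P a \<Longrightarrow> P b \<Longrightarrow> P (a - b)"
  shows "P w"
  using assms(1) unfolding lattice_def
  by induction (use assms(2-4) in \<open>auto simp: lattice_def\<close>)

lemma lattice_zero: "0 \<in> lattice"
  and lattice_add: "a \<in> lattice \<Longrightarrow> b \<in> lattice \<Longrightarrow> a + b \<in> lattice"
  and lattice_diff: "a \<in> lattice \<Longrightarrow> b \<in> lattice \<Longrightarrow> a - b \<in> lattice"
  and lattice_scale: "c \<in> \<int> \<Longrightarrow> a \<in> lattice \<Longrightarrow> sv c a \<in> lattice"
  and lattice_sum: "(\<And>i. i \<in> F \<Longrightarrow> f i \<in> lattice) \<Longrightarrow> sum f F \<in> lattice"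
  unfolding lattice_def
  by (auto intro: additive_span.zero additive_span_add additive_span.diff V.additive_span_Ints additive_span_sum)

lemma lattice_dp_extend:
  assumes "\<And>w a. lowering w a \<Longrightarrow> dp n y w \<in> lattice" "w \<in> lattice"
  shows "dp n y w \<in> lattice"
  using assms unfolding lattice_def by (auto intro: additive_span_dp)

lemma lattice_chi:
  assumes "locally_nilpotent y" "\<And>n w. w \<in> lattice \<Longrightarrow> dp n y w \<in> lattice" "w \<in> lattice" "t \<in> \<int>"
  shows "chi sv \<rho> y t w \<in> lattice"
  using assms(2-4) lattice_lowering unfolding lattice_def
  by (intro additive_span_chi[OF assms(1)]) (auto simp: lattice_def)

lemma lattice_dp_lower: "\<alpha> \<in> S \<Longrightarrow> w \<in> lattice \<Longrightarrow> dp m (x (\<lambda>y. - \<alpha> y)) w \<in> lattice"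
  by (rule lattice_dp_extend) (auto intro: lattice_lowering lowering.lower)

text \<open>The difference of two simple roots has coefficients of both signs, so it is neither a
  root nor zero, and its root space is trivial.\<close>

lemma simple_difference_bracket:
  assumes "\<alpha> \<in> S" "\<beta> \<in> S" "\<alpha> \<noteq> \<beta>"
  shows "br (x \<alpha>) (x (\<lambda>y. - \<beta> y)) = 0"
proof -
  let ?\<mu> = "\<lambda>y. - \<beta> y + \<alpha> y"
  define a where "a = (\<lambda>\<iota>. (-1) * (if \<iota> = \<beta> then 1 else 0) + (if \<iota> = \<alpha> then 1 else 0) :: int)"
  have comb: "?\<mu> = comb a"
    by (rule ext) (simp only: a_def comb_add comb_scale comb_unit[OF assms(1)] comb_unit[OF assms(2)], simp)
  have a: "a \<alpha> = 1" "a \<beta> = -1"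
    using assms(3) by (auto simp: a_def)
  have "?\<mu> \<notin> \<Delta>"
  proof
    assume "?\<mu> \<in> \<Delta>"
    then obtain b where "comb a = comb b" "(\<forall>\<alpha>\<in>S. 0 \<le> b \<alpha>) \<or> (\<forall>\<alpha>\<in>S. b \<alpha> \<le> 0)"
      unfolding comb using root_comb by metis
    then show False
      using comb_inject assms a by (metis neg_0_le_iff_le not_one_le_zero)
  qed
  moreover have "?\<mu> \<noteq> (\<lambda>_. 0)"
  proof
    assume "?\<mu> = (\<lambda>_. 0)"
    then have "comb a = comb (\<lambda>_. 0)"
      by (simp only: comb comb_zero)
    from comb_inject[OF this assms(1)] a show False by simp
  qed
  moreover have "br (x \<alpha>) (x (\<lambda>y. - \<beta> y)) \<in> root_space s br H ?\<mu>"
    using ad.weight_space_shift[OF root_vector[OF S_roots[OF assms(1)]]]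
      root_vector[OF neg_root[OF S_roots[OF assms(2)]]] by (simp only: ad_weight_space)
  ultimately show ?thesis
    using root_space_zero[OF comb_dual[of a]] comb by metis
qed

text \<open>For the leftmost factor there are two cases. With the same simple root,
  \<open>dp_dp_opposite\<close> has integral coefficients and involves lower powers of
  \<open>x \<alpha>\<close>, which is why \<open>n\<close> is arbitrary in the induction. With
  another simple root, the operators commute.\<close>

lemma lowering_dp_raise: "lowering w a \<Longrightarrow> \<alpha> \<in> S \<Longrightarrow> dp n (x \<alpha>) w \<in> lattice"
proof (induction arbitrary: n rule: lowering.induct)
  case highest
  then have "\<rho> (x \<alpha>) v = 0"
    using highest_weight_module.highest[OF highest_weight_module_axioms] simple_positive
      root_vector[OF S_roots] unfolding highest_weight_vector_def by blast
  then show ?case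
    by (cases n) (auto simp: dp_vanish[of 1] highest_in_lattice lattice_zero)
next
  case (lower w a \<beta> m)
  show ?case
  proof (cases "\<beta> = \<alpha>")
    case True
    have "dp n (x \<alpha>) (dp m (x (\<lambda>y. - \<alpha> y)) w) = (\<Sum>t\<le>n. if t \<le> m
        then sv ((wt a (h \<alpha>) - of_nat m + of_nat n) gchoose t) (dp (m - t) (x (\<lambda>y. - \<alpha> y)) (dp (n - t) (x \<alpha>) w)) else 0)"
      by (rule dp_dp_opposite[OF S_roots[OF lower.prems] lowering_weight[OF lower.hyps(1)]])
    also have "\<dots> \<in> lattice"
      using lower.IH[OF lower.prems] lower.prems
      by (intro lattice_sum) (auto intro!: lattice_zero lattice_scale lattice_dp_lower gbinomial_Ints
          Ints_add Ints_diff wt_coroot_int)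
    finally show ?thesis
      by (simp add: True)
  next
    case False
    have "dp n (x \<alpha>) (dp m (x (\<lambda>y. - \<beta> y)) w) = dp m (x (\<lambda>y. - \<beta> y)) (dp n (x \<alpha>) w)"
      by (rule dp_commute) (rule simple_difference_bracket, use False lower in auto)
    then show ?thesis
      using lower by (simp add: lattice_dp_lower)
  qed
qed

lemma lattice_dp_simple: "\<alpha> \<in> S \<Longrightarrow> w \<in> lattice \<Longrightarrow> dp n (x \<alpha>) w \<in> lattice"
  by (rule lattice_dp_extend) (auto intro: lowering_dp_raise)

lemma lattice_weyl:
  assumes "\<alpha> \<in> S" "w \<in> lattice"
  shows "weyl \<alpha> w \<in> lattice" "weyl_inv \<alpha> w \<in> lattice"
proof -
  note nil = root_vector_nilpotent[OF S_roots[OF assms(1)]] root_vector_nilpotent[OF neg_root[OF S_roots[OF assms(1)]]]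
  have "chi sv \<rho> (x \<alpha>) t w \<in> lattice" "chi sv \<rho> (x (\<lambda>y. - \<alpha> y)) t w \<in> lattice"
    if "t \<in> \<int>" "w \<in> lattice" for t w
    using that assms(1) by (auto intro: lattice_chi nil lattice_dp_simple lattice_dp_lower)
  then show "weyl \<alpha> w \<in> lattice" "weyl_inv \<alpha> w \<in> lattice"
    unfolding weyl_def weyl_inv_def using assms(2) by simp_all
qed

lemma weyl_dp: "\<alpha> \<in> \<Delta> \<Longrightarrow> weyl \<alpha> (dp n y w) = dp n (adm.weyl \<alpha> y) (weyl \<alpha> w)"
  by (induction n) (simp_all add: dp_Suc weyl_scale weyl_act)

text \<open>Conjugation by the lifted reflection, which preserves the lattice in both directions,
  turns \<open>x \<gamma>\<close> into an integral multiple of the reflected root vector.\<close>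

lemma lattice_dp_reflection:
  assumes "\<alpha> \<in> S" "\<gamma> \<in> \<Delta>" "\<And>k::int. \<gamma> \<noteq> (\<lambda>y. of_int k * \<alpha> y)"
    and "\<And>n w. w \<in> lattice \<Longrightarrow> dp n (x (reflection \<alpha> \<gamma>)) w \<in> lattice" "w \<in> lattice"
  shows "dp n (x \<gamma>) w \<in> lattice"
proof -
  note \<alpha> = S_roots[OF assms(1)]
  obtain m :: int where m: "adm.weyl \<alpha> (x \<gamma>) = s (of_int m) (x (reflection \<alpha> \<gamma>))"
    by (rule weyl_root_vector[OF \<alpha> assms(2,3)])
  have "weyl \<alpha> (dp n (x \<gamma>) w) = sv (of_int (m ^ n)) (dp n (x (reflection \<alpha> \<gamma>)) (weyl \<alpha> w))"
    by (simp add: weyl_dp[OF \<alpha>] m dp_scale_left)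
  also have "\<dots> \<in> lattice"
    by (intro lattice_scale assms(4) lattice_weyl assms(1,5) Ints_of_int)
  finally have "weyl_inv \<alpha> (weyl \<alpha> (dp n (x \<gamma>) w)) \<in> lattice"
    by (rule lattice_weyl(2)[OF assms(1)])
  then show ?thesis
    by (simp add: weyl_inv_weyl[OF \<alpha>])
qed

text \<open>Induction on the height by \<open>simple_descent\<close>. A reflection commutes with
  negation, so both signs are treated together.\<close>

lemma lattice_dp_positive:
  assumes "\<gamma> \<in> \<Phi>" "w \<in> lattice"
  shows "dp n (x \<gamma>) w \<in> lattice \<and> dp n (x (\<lambda>y. - \<gamma> y)) w \<in> lattice"
  using assms
proof (induction "nat (height S \<gamma>)" arbitrary: \<gamma> n w rule: less_induct)
  case less
  show ?case
  proof (cases "\<gamma> \<in> S")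
    case True
    then show ?thesis
      using less.prems lattice_dp_simple lattice_dp_lower by blast
  next
    case False
    note \<gamma> = positive_root[OF less.prems(1)]
    from simple_descent[OF less.prems(1) False] obtain \<alpha> where \<alpha>: "\<alpha> \<in> S" "reflection \<alpha> \<gamma> \<in> \<Phi>"
      "height S (reflection \<alpha> \<gamma>) < height S \<gamma>" "\<And>k::int. \<gamma> \<noteq> (\<lambda>y. of_int k * \<alpha> y)" by blast
    have "nat (height S (reflection \<alpha> \<gamma>)) < nat (height S \<gamma>)"
      using \<alpha>(3) height_positive[OF \<alpha>(2)] by linarith
    note IH = less.hyps[OF this \<alpha>(2)]
    have neg: "reflection \<alpha> (\<lambda>y. - \<gamma> y) = (\<lambda>y. - reflection \<alpha> \<gamma> y)"
      by (simp add: reflection_def)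
    have "(\<lambda>y. - \<gamma> y) \<noteq> (\<lambda>y. of_int k * \<alpha> y)" for k :: int
    proof
      assume "(\<lambda>y. - \<gamma> y) = (\<lambda>y. of_int k * \<alpha> y)"
      then have "\<gamma> y = of_int (- k) * \<alpha> y" for y
        by (metis add.inverse_inverse mult_minus_left of_int_minus)
      then show False
        using \<alpha>(4)[of "- k"] by blast
    qed
    then show ?thesis
      using lattice_dp_reflection[OF \<alpha>(1) \<gamma> \<alpha>(4)] lattice_dp_reflection[OF \<alpha>(1) neg_root[OF \<gamma>]]
        IH less.prems(2) unfolding neg by blast
  qed
qed

lemma lattice_dp: 
  assumes "\<gamma> \<in> \<Delta>" "w \<in> lattice"
  shows "dp n (x \<gamma>) w \<in> lattice"
  using positive_or_negative[OF assms(1)] lattice_dp_positive[OF _ assms(2)] by force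

lemma lattice_root_vector: "\<gamma> \<in> \<Delta> \<Longrightarrow> w \<in> lattice \<Longrightarrow> \<rho> (x \<gamma>) w \<in> lattice"
  using lattice_dp[of \<gamma> w "Suc 0"] by simp

lemma lowering_coroot:
  "lowering w a \<Longrightarrow> \<alpha> \<in> S \<Longrightarrow> \<rho> (h \<alpha>) w = sv (wt a (h \<alpha>)) w"
  using weight_spaceD[OF lowering_weight coroot_in_H[OF S_roots]] .

lemma lattice_coroot:
  assumes "\<alpha> \<in> S" "w \<in> lattice"
  shows "\<rho> (h \<alpha>) w \<in> lattice"
  using assms(2)
proof (induction rule: lattice_induct)
  case (lowering w a)
  then show ?case
    using assms(1) by (simp add: lowering_coroot lattice_scale wt_coroot_int lattice_lowering)
qed (auto simp: act_diff_right intro: lattice_zero lattice_diff)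

end

section \<open>Divisibility in the lattice\<close>

context highest_weight_module
begin

text \<open>The generators are weight vectors, so each one lies entirely in one of the two
  parts.\<close>

lemma lattice_decomposition:
  assumes "w \<in> lattice" "\<nu> \<in> dual_space s H"
  obtains w1 w2 where "w1 \<in> lattice" "w1 \<in> weight_space H \<nu>" "w2 \<in> lattice" "w2 \<in> off_weight H \<nu>"
    "w = w1 + w2"
proof -
  have "\<exists>w1 w2. w1 \<in> lattice \<and> w1 \<in> weight_space H \<nu> \<and> w2 \<in> lattice \<and> w2 \<in> off_weight H \<nu> \<and> w = w1 + w2"
    using assms(1)
  proof (induction rule: lattice_induct)
    case (lowering w a)
    note w = lattice_lowering[OF lowering] lowering_weight[OF lowering]
    show ?case
    proof (cases "wt a = \<nu>")
      case True
      then show ?thesis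
        using w V.subspace_0[OF subspace_off_weight] lattice_zero
        by (intro exI[of _ w] exI[of _ 0]) simp
    next
      case False
      then show ?thesis
        using w V.subspace_0[OF subspace_weight_space] lattice_zero weight_space_off[OF w(2) wt_dual]
        by (intro exI[of _ 0] exI[of _ w]) simp
    qed
  next
    case zero
    then show ?case
      using V.subspace_0[OF subspace_off_weight] V.subspace_0[OF subspace_weight_space] lattice_zero
      by (intro exI[of _ 0]) simp
  next
    case (diff a b)
    then obtain a1 a2 b1 b2 where "a1 \<in> lattice" "a1 \<in> weight_space H \<nu>" "a2 \<in> lattice" "a2 \<in> off_weight H \<nu>"
      "a = a1 + a2" "b1 \<in> lattice" "b1 \<in> weight_space H \<nu>" "b2 \<in> lattice" "b2 \<in> off_weight H \<nu>"
      "b = b1 + b2" by blast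
    then show ?case
      by (intro exI[of _ "a1 - b1"] exI[of _ "a2 - b2"])
        (simp add: lattice_diff V.subspace_diff[OF subspace_off_weight] V.subspace_diff[OF subspace_weight_space])
  qed
  then show ?thesis
    using that by blast
qed

text \<open>The splitting into a part of weight \<nu> and a part off \<nu> is unique, so it agrees
  with the splitting inside the lattice.\<close>

lemma lattice_component:
  assumes "p + z \<in> lattice" "p \<in> weight_space H \<nu>" "z \<in> off_weight H \<nu>" "\<nu> \<in> dual_space s H"
  shows "p \<in> lattice"
proof -
  obtain w1 w2 where w: "w1 \<in> lattice" "w1 \<in> weight_space H \<nu>" "w2 \<in> off_weight H \<nu>" "p + z = w1 + w2"
    using lattice_decomposition[OF assms(1,4)] by metis
  have "p - w1 = w2 - z"
    using w(4) by (simp add: algebra_simps)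
  then have "p - w1 = 0"
    using weight_space_Int_off[OF assms(4), of "p - w1"] V.subspace_diff[OF subspace_weight_space assms(2) w(2)]
      V.subspace_diff[OF subspace_off_weight w(3) assms(3)] by simp
  then show ?thesis
    using w(1) by simp
qed

text \<open>By \<open>lowering_zero\<close>, the only monomial of weight \<Lambda> is
  \<open>v\<close> itself.\<close>

lemma lattice_highest_component:
  assumes "w \<in> lattice"
  obtains k :: int where "w - sv (of_int k) v \<in> off_weight H \<Lambda>"
proof -
  have "\<exists>k::int. w - sv (of_int k) v \<in> off_weight H \<Lambda>"
    using assms
  proof (induction rule: lattice_induct)
    case (lowering w a)
    show ?case
    proof (cases "\<forall>\<iota>\<in>S. a \<iota> = 0")
      case True
      then have "w = v"
        using lowering_zero[OF lowering] by blast
      then show ?thesis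
        using V.subspace_0[OF subspace_off_weight] by (intro exI[of _ 1]) simp
    next
      case False
      have "wt a \<noteq> \<Lambda>"
      proof
        assume eq: "wt a = \<Lambda>"
        have "comb a y = comb (\<lambda>_. 0) y" for y
          using fun_cong[OF eq, of y] by (simp add: wt_def comb_zero)
        then have "comb a = comb (\<lambda>_. 0)" by (rule ext)
        then show False
          using comb_inject False by metis
      qed
      then show ?thesis
        using weight_space_off[OF lowering_weight[OF lowering] wt_dual] by (intro exI[of _ 0]) simp
    qed
  next
    case zero
    then show ?case
      using V.subspace_0[OF subspace_off_weight] by (intro exI[of _ 0]) simp
  next
    case (diff a b)
    then obtain k l :: int where "a - sv (of_int k) v \<in> off_weight H \<Lambda>" "b - sv (of_int l) v \<in> off_weight H \<Lambda>"
      by blast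
    from V.subspace_diff[OF subspace_off_weight this] show ?case
      by (intro exI[of _ "k - l"]) (simp add: V.scale_left_diff_distrib algebra_simps)
  qed
  then show ?thesis
    using that by blast
qed

lemma highest_not_off: "sv c v \<in> off_weight H \<Lambda> \<Longrightarrow> c = 0"
  using weight_space_Int_off[OF highest_dual V.subspace_scale[OF subspace_weight_space highest_weight]]
    highest_nonzero by fastforce

text \<open>The vectors for which no word in the basis produces a component of weight \<Lambda> form
  a submodule. The empty word shows that \<open>v\<close> is not among them, so irreducibility
  leaves only 0.\<close>

lemma highest_component_detected:
  assumes "y \<noteq> 0"
  obtains L where "set L \<subseteq> x ` \<Delta> \<union> h ` S" "foldr \<rho> L y \<notin> off_weight H \<Lambda>"
proof -
  let ?K = "{y. \<forall>L. set L \<subseteq> x ` \<Delta> \<union> h ` S \<longrightarrow> foldr \<rho> L y \<in> off_weight H \<Lambda>}"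
  have fold_add: "foldr \<rho> L (a + b) = foldr \<rho> L a + foldr \<rho> L b" for L a b
    by (induction L) (auto simp: act_add_right)
  have fold_scale: "foldr \<rho> L (sv c a) = sv c (foldr \<rho> L a)" for L c a
    by (induction L) (auto simp: act_scale_right)
  have fold_zero: "foldr \<rho> L 0 = 0" for L
    by (induction L) auto
  have "V.subspace ?K"
    using V.subspace_0[OF subspace_off_weight] V.subspace_add[OF subspace_off_weight]
      V.subspace_scale[OF subspace_off_weight]
    by (auto simp: V.subspace_def fold_add fold_scale fold_zero)
  moreover have closed: "\<rho> z w \<in> ?K" if "z \<in> x ` \<Delta> \<union> h ` S" "w \<in> ?K" for z w
  proof -
    have "foldr \<rho> L (\<rho> z w) \<in> off_weight H \<Lambda>" if "set L \<subseteq> x ` \<Delta> \<union> h ` S" for L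
    proof -
      have "set (L @ [z]) \<subseteq> x ` \<Delta> \<union> h ` S"
        using that \<open>z \<in> _\<close> by simp
      then have "foldr \<rho> (L @ [z]) w \<in> off_weight H \<Lambda>"
        using \<open>w \<in> ?K\<close> by blast
      then show ?thesis by simp
    qed
    then show ?thesis by simp
  qed
  ultimately have "?K = {0} \<or> ?K = UNIV"
    by (intro submodule_basis closed) auto
  moreover have "v \<notin> ?K"
    using highest_not_off[of 1] by (auto intro!: exI[of _ "[]"])
  ultimately have "?K = {0}"
    by blast
  then have "y \<notin> ?K"
    using assms by (simp only: singleton_iff simp_thms)
  then show ?thesis
    using that by blast
qed

text \<open>Some word sends \<open>y\<close> to a lattice vector whose component at \<Lambda> is
  \<open>k v\<close> with a nonzero integer \<open>k\<close>. If \<open>y / N\<close> is in the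
  lattice, the same word applied to it shows that \<open>N\<close> divides \<open>k\<close>.\<close>

lemma lattice_divisibility_bounded:
  assumes "y \<in> lattice" "y \<noteq> 0"
  obtains B :: nat where "\<And>N. 0 < N \<Longrightarrow> sv (1 / of_nat N) y \<in> lattice \<Longrightarrow> N \<le> B"
proof -
  obtain L where L: "set L \<subseteq> x ` \<Delta> \<union> h ` S" "foldr \<rho> L y \<notin> off_weight H \<Lambda>"
    using highest_component_detected[OF assms(2)] .
  have fold_lattice: "foldr \<rho> L w \<in> lattice" if "w \<in> lattice" for w
    using L(1) that by (induction L) (auto intro: lattice_root_vector lattice_coroot)
  have fold_scale: "foldr \<rho> L (sv c a) = sv c (foldr \<rho> L a)" for c a
    by (induction L) (auto simp: act_scale_right)
  obtain k :: int where k: "foldr \<rho> L y - sv (of_int k) v \<in> off_weight H \<Lambda>"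
    using lattice_highest_component[OF fold_lattice[OF assms(1)]] .
  have "k \<noteq> 0"
    using k L(2) by auto
  have "N \<le> nat \<bar>k\<bar>" if N: "0 < N" "sv (1 / of_nat N) y \<in> lattice" for N
  proof -
    obtain l :: int where l: "sv (1 / of_nat N) (foldr \<rho> L y) - sv (of_int l) v \<in> off_weight H \<Lambda>"
      using lattice_highest_component[OF fold_lattice[OF N(2)]] unfolding fold_scale .
    have "sv (of_nat N) (sv (1 / of_nat N) (foldr \<rho> L y) - sv (of_int l) v) - (foldr \<rho> L y - sv (of_int k) v)
        \<in> off_weight H \<Lambda>"
      by (intro V.subspace_diff[OF subspace_off_weight] V.subspace_scale[OF subspace_off_weight] l k)
    also have "sv (of_nat N) (sv (1 / of_nat N) (foldr \<rho> L y) - sv (of_int l) v) - (foldr \<rho> L y - sv (of_int k) v) =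
        sv (of_int (k - int N * l)) v"
      using N(1) by (simp add: V.scale_right_diff_distrib V.scale_left_diff_distrib)
    finally have "k - int N * l = 0"
      using highest_not_off of_int_eq_0_iff by blast
    then have "int N dvd k" by simp
    then have "\<bar>int N\<bar> \<le> \<bar>k\<bar>"
      using \<open>k \<noteq> 0\<close> by (rule dvd_imp_le_int[rotated])
    then show ?thesis by simp
  qed
  then show ?thesis
    using that by blast
qed

text \<open>The span is a nonzero submodule. Together with faithfulness this prevents a root vector
  from killing the whole lattice.\<close>

lemma span_lattice: "V.span lattice = UNIV"
proof -
  have closed: "\<rho> y w \<in> V.span lattice" if "\<And>w. w \<in> lattice \<Longrightarrow> \<rho> y w \<in> lattice" "w \<in> V.span lattice" for y w
    using that(2) by (induction rule: V.span_induct_alt)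
      (auto simp: act_add_right act_scale_right intro: V.span_zero V.span_add V.span_scale V.span_base that(1))
  have "V.span lattice = {0} \<or> V.span lattice = UNIV"
    by (rule submodule_basis) (auto intro: closed lattice_root_vector lattice_coroot)
  moreover have "v \<in> V.span lattice"
    by (rule V.span_base) (rule highest_in_lattice)
  ultimately show ?thesis
    using highest_nonzero by auto
qed

section \<open>Denominators of root vectors on the lattice\<close>

lemma act_opposite: "\<gamma> \<in> \<Delta> \<Longrightarrow>
    \<rho> (x \<gamma>) (\<rho> (x (\<lambda>y. - \<gamma> y)) w) = \<rho> (x (\<lambda>y. - \<gamma> y)) (\<rho> (x \<gamma>) w) + \<rho> (h \<gamma>) w"
  by (simp add: act_commute[of "x \<gamma>" "x (\<lambda>y. - \<gamma> y)"] br_opposite)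

lemma act_coroot_opposite: "\<gamma> \<in> \<Delta> \<Longrightarrow>
    \<rho> (h \<gamma>) (\<rho> (x (\<lambda>y. - \<gamma> y)) w) = \<rho> (x (\<lambda>y. - \<gamma> y)) (\<rho> (h \<gamma>) w) - sv 2 (\<rho> (x (\<lambda>y. - \<gamma> y)) w)"
  by (simp add: act_commute[of "h \<gamma>"] br_root_vector[OF neg_root] coroot_in_H root_coroot act_scale_left)

lemma act_coroot_root: "\<gamma> \<in> \<Delta> \<Longrightarrow>
    \<rho> (h \<gamma>) (\<rho> (x \<gamma>) w) = \<rho> (x \<gamma>) (\<rho> (h \<gamma>) w) + sv 2 (\<rho> (x \<gamma>) w)"
  by (simp add: act_commute[of "h \<gamma>"] br_root_vector coroot_in_H root_coroot act_scale_left)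

text \<open>This is \<open>[f, [f, e]] = - 2 f\<close>, divided by -2. Each term contains
  \<open>e\<close> once and otherwise only divided powers of \<open>f\<close>, so a denominator of
  \<open>e\<close> passes to \<open>f\<close>.\<close>

lemma opposite_from_root_vector:
  assumes "\<gamma> \<in> \<Delta>"
  shows "\<rho> (x (\<lambda>y. - \<gamma> y)) w = \<rho> (x (\<lambda>y. - \<gamma> y)) (\<rho> (x \<gamma>) (\<rho> (x (\<lambda>y. - \<gamma> y)) w))
      - dp 2 (x (\<lambda>y. - \<gamma> y)) (\<rho> (x \<gamma>) w) - \<rho> (x \<gamma>) (dp 2 (x (\<lambda>y. - \<gamma> y)) w)"
proof -
  let ?e = "x \<gamma>" and ?f = "x (\<lambda>y. - \<gamma> y)"
  have half: "dp 2 ?f u = sv (1 / 2) (\<rho> ?f (\<rho> ?f u))" for u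
    by (simp add: numeral_2_eq_2 dp_Suc[of "Suc 0"])
  have "sv (1 / 2) (\<rho> ?f (\<rho> ?f (\<rho> ?e w))) + sv (1 / 2) (\<rho> ?e (\<rho> ?f (\<rho> ?f w))) =
      \<rho> ?f (\<rho> ?e (\<rho> ?f w)) - \<rho> ?f w"
  proof -
    have "\<rho> ?f (\<rho> ?f (\<rho> ?e w)) + \<rho> ?e (\<rho> ?f (\<rho> ?f w)) =
        sv 2 (\<rho> ?f (\<rho> ?e (\<rho> ?f w)) - \<rho> ?f w)"
      using assms by (simp add: act_opposite act_coroot_opposite act_add_right V.scale_right_distrib
          V.scale_right_diff_distrib V.scale_left_distrib[of 1 1, simplified])
    then show ?thesis
      by (simp flip: V.scale_right_distrib)
  qed
  then show ?thesis
    by (simp add: half act_scale_right algebra_simps)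
qed

text \<open>This is \<open>[e, [e, f]] = - 2 e\<close> up to sign. Three factors occur in each term,
  so denominators \<open>b\<close> of \<open>e\<close> and \<open>f\<close> combine to
  \<open>b ^ 3\<close>.\<close>

lemma root_vector_from_opposite:
  assumes "\<gamma> \<in> \<Delta>"
  shows "sv 2 (\<rho> (x \<gamma>) w) = sv 2 (\<rho> (x \<gamma>) (\<rho> (x (\<lambda>y. - \<gamma> y)) (\<rho> (x \<gamma>) w)))
      - \<rho> (x \<gamma>) (\<rho> (x \<gamma>) (\<rho> (x (\<lambda>y. - \<gamma> y)) w)) - \<rho> (x (\<lambda>y. - \<gamma> y)) (\<rho> (x \<gamma>) (\<rho> (x \<gamma>) w))"
  using assms by (simp add: act_opposite act_coroot_root act_add_right V.scale_right_distrib
      V.scale_left_distrib[of 1 1, simplified])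

text \<open>If \<open>x\<^sub>\<gamma> / b\<close> preserves the lattice then so does \<open>x\<^sub>-\<^sub>\<gamma> / b\<close>, hence also \<open>2 x\<^sub>\<gamma> / b\<^sup>3\<close>, which is up to sign
  an iterated bracket of these two.\<close>

lemma lattice_denominator_step:
  assumes \<gamma>: "\<gamma> \<in> \<Delta>" and b: "2 \<le> b"
    and e: "\<And>w. w \<in> lattice \<Longrightarrow> sv (1 / of_nat b) (\<rho> (x \<gamma>) w) \<in> lattice"
  obtains b' where "b < b'" "\<And>w. w \<in> lattice \<Longrightarrow> sv (1 / of_nat b') (\<rho> (x \<gamma>) w) \<in> lattice"
proof -
  let ?e = "x \<gamma>" and ?f = "x (\<lambda>y. - \<gamma> y)" and ?c = "1 / of_nat b :: complex"
  note f_lattice = lattice_root_vector[OF neg_root[OF \<gamma>]] and f2_lattice = lattice_dp[OF neg_root[OF \<gamma>]]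
  have f: "sv ?c (\<rho> ?f w) \<in> lattice" if w: "w \<in> lattice" for w
  proof -
    have "sv ?c (\<rho> ?f w) = \<rho> ?f (sv ?c (\<rho> ?e (\<rho> ?f w))) - dp 2 ?f (sv ?c (\<rho> ?e w)) - sv ?c (\<rho> ?e (dp 2 ?f w))"
      by (subst opposite_from_root_vector[OF \<gamma>]) (simp only: V.scale_right_diff_distrib act_scale_right dp_scale)
    also have "\<dots> \<in> lattice"
      by (intro lattice_diff f_lattice f2_lattice e w)
    finally show ?thesis .
  qed
  have e3: "sv (2 / of_nat (b ^ 3)) (\<rho> ?e w) \<in> lattice" if w: "w \<in> lattice" for w
  proof -
    let ?E = "\<lambda>w. sv ?c (\<rho> ?e w)" and ?F = "\<lambda>w. sv ?c (\<rho> ?f w)"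
    have "sv (2 / of_nat (b ^ 3)) (\<rho> ?e w) = sv (?c * (?c * ?c)) (sv 2 (\<rho> ?e w))"
      by (simp add: power3_eq_cube)
    also have "\<dots> = sv 2 (?E (?F (?E w))) - ?E (?E (?F w)) - ?F (?E (?E w))"
      unfolding root_vector_from_opposite[OF \<gamma>, of w] by (simp add: V.scale_right_diff_distrib act_scale_right mult_ac)
    also have "\<dots> \<in> lattice"
      by (intro lattice_diff lattice_scale e f w) simp
    finally show ?thesis .
  qed
  show ?thesis
  \<comment> \<open>The factor 2 in \<open>2 / b ^ 3\<close> is removed. For \<open>b = 2 d\<close>
    it cancels and leaves \<open>1 / (4 d ^ 3)\<close>; for odd \<open>b\<close>, an integral
    combination of 1 and \<open>2 / b ^ 3\<close> is \<open>1 / b ^ 3\<close>.\<close>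
  proof (cases "even b")
    case True
    then obtain d where d: "b = 2 * d" by (elim evenE)
    show ?thesis
    proof (rule that)
      have "0 < d" using b d by simp
      then have "d * 1 \<le> d * (d * d)"
        by (intro mult_le_mono) (simp_all add: Suc_le_eq)
      then show "b < 4 * d ^ 3"
        using d \<open>0 < d\<close> unfolding power3_eq_cube mult.assoc by linarith
      show "sv (1 / of_nat (4 * d ^ 3)) (\<rho> ?e w) \<in> lattice" if "w \<in> lattice" for w
        using e3[OF that] by (simp add: d power_mult_distrib)
    qed
  next
    case False
    then have "odd (b ^ 3)" by simp
    then obtain j where j: "b ^ 3 = 2 * j + 1" by (elim oddE)
    show ?thesis
    proof (rule that)
      show "b < b ^ 3"
        using b power_strict_increasing[of 1 3 b] by simp
      show "sv (1 / of_nat (b ^ 3)) (\<rho> ?e w) \<in> lattice" if w: "w \<in> lattice" for w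
      proof -
        have "(of_nat (b ^ 3) :: complex) \<noteq> 0" using b by simp
        then have "1 / of_nat (b ^ 3) = 1 - of_nat j * (2 / of_nat (b ^ 3) :: complex)"
          unfolding j by (simp add: field_simps)
        then have "sv (1 / of_nat (b ^ 3)) (\<rho> ?e w) = \<rho> ?e w - sv (of_nat j) (sv (2 / of_nat (b ^ 3)) (\<rho> ?e w))"
          by (simp only: V.scale_left_diff_distrib V.scale_scale V.scale_one)
        then show ?thesis
          using w by (simp only:) (intro lattice_diff lattice_scale e3 lattice_root_vector[OF \<gamma>] Ints_of_nat)
      qed
    qed
  qed
qed

text \<open>Were \<open>q\<close> not integral, its denominator could be enlarged without bound by
  \<open>lattice_denominator_step\<close>. By faithfulness and \<open>span_lattice\<close> some
  image of a lattice vector under \<open>x \<gamma>\<close> is nonzero, and its divisibility is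
  bounded.\<close>

lemma root_vector_primitive:
  assumes faithful: "faithful_module \<rho>" and \<gamma>: "\<gamma> \<in> \<Delta>"
    and q: "\<And>w. w \<in> lattice \<Longrightarrow> sv (of_rat q) (\<rho> (x \<gamma>) w) \<in> lattice"
  shows "q \<in> \<int>"
proof (rule ccontr)
  assume nonint: "q \<notin> \<int>"
  obtain a b where ab: "quotient_of q = (a, b)" by force
  have b: "0 < b" and cop: "coprime a b" and q_eq: "q = of_int a / of_int b"
    using ab quotient_of_denom_pos quotient_of_coprime quotient_of_div by blast+
  have "b \<noteq> 1"
    using nonint q_eq by auto
  have "of_rat q = (of_int a / of_int b :: complex)"
    by (simp add: q_eq of_rat_divide)
  obtain k l where kl: "k * a + l * b = 1"
    using bezout_int[of a b] cop by auto
  have start: "sv (1 / of_nat (nat b)) (\<rho> (x \<gamma>) w) \<in> lattice" if "w \<in> lattice" for w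
  proof -
    \<comment> \<open>Bezout's identity replaces the numerator \<open>a\<close> by 1, since
      \<open>x \<gamma>\<close> itself also preserves the lattice.\<close>
    have "of_int k * of_rat q + of_int l = (of_int (k * a + l * b) / of_int b :: complex)"
      using b \<open>of_rat q = _\<close> by (simp add: field_simps)
    also have "\<dots> = 1 / of_nat (nat b)"
      using b by (simp add: kl)
    finally have "sv (1 / of_nat (nat b)) (\<rho> (x \<gamma>) w) =
        sv (of_int k) (sv (of_rat q) (\<rho> (x \<gamma>) w)) + sv (of_int l) (\<rho> (x \<gamma>) w)"
      by (metis V.scale_left_distrib V.scale_scale)
    then show ?thesis
      using that by (simp only:) (intro lattice_add lattice_scale q lattice_root_vector[OF \<gamma>] Ints_of_int)
  qed
  have "\<exists>b'>N. \<forall>w\<in>lattice. sv (1 / of_nat b') (\<rho> (x \<gamma>) w) \<in> lattice" if "1 \<le> N" for N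
    using that
  proof (induction N rule: dec_induct)
    case base
    show ?case
      using start b \<open>b \<noteq> 1\<close> by (intro exI[of _ "nat b"]) auto
  next
    case (step N)
    then obtain b' where b': "N < b'" "\<And>w. w \<in> lattice \<Longrightarrow> sv (1 / of_nat b') (\<rho> (x \<gamma>) w) \<in> lattice"
      by blast
    have "2 \<le> b'" using b'(1) step.hyps(1) by simp
    obtain b'' where b'': "b' < b''" "\<And>w. w \<in> lattice \<Longrightarrow> sv (1 / of_nat b'') (\<rho> (x \<gamma>) w) \<in> lattice"
      by (rule lattice_denominator_step[OF \<gamma> \<open>2 \<le> b'\<close> b'(2)]) (assumption, rule that, assumption+)
    then show ?case
      using b'(1) by (intro exI[of _ b'']) auto
  qed
  note unbounded = this
  obtain w where w: "w \<in> lattice" "\<rho> (x \<gamma>) w \<noteq> 0"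
  proof -
    have "\<not> (\<forall>w\<in>lattice. \<rho> (x \<gamma>) w = 0)"
    proof
      assume *: "\<forall>w\<in>lattice. \<rho> (x \<gamma>) w = 0"
      have "V.subspace {w. \<rho> (x \<gamma>) w = 0}"
        by (auto simp: V.subspace_def act_add_right act_scale_right)
      then have "V.span lattice \<subseteq> {w. \<rho> (x \<gamma>) w = 0}"
        using * by (intro V.span_minimal) auto
      then have "\<forall>w. \<rho> (x \<gamma>) w = 0"
        using span_lattice by auto
      then show False
        using faithful root_vector_nonzero[OF \<gamma>] unfolding faithful_module_def by blast
    qed
    then show ?thesis using that by blast
  qed
  obtain B where B: "\<And>N. 0 < N \<Longrightarrow> sv (1 / of_nat N) (\<rho> (x \<gamma>) w) \<in> lattice \<Longrightarrow> N \<le> B"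
    by (rule lattice_divisibility_bounded[OF lattice_root_vector[OF \<gamma> w(1)] w(2)]) (rule that, assumption)
  obtain b' where "max 1 B < b'" "sv (1 / of_nat b') (\<rho> (x \<gamma>) w) \<in> lattice"
    using unbounded[of "max 1 B"] w(1) by auto
  then show False
    using B[of b'] by simp
qed

end

section \<open>Products of root group elements\<close>

lemma foldr_comp_Cons: "foldr (\<circ>) (f # fs) id w = f (foldr (\<circ>) fs id w)"
  by simp

text \<open>Subtracting \<open>w\<close> removes the term of degree 0, so only the divided powers of
  positive degree need to lie in \<open>W\<close>.\<close>

lemma (in lie_module) chi_minus_id_mem:
  assumes "locally_nilpotent y" "V.subspace W" "\<And>k. dp (Suc k) y w \<in> W"
  shows "chi sv \<rho> y t w - w \<in> W"
proof -
  obtain K where "\<And>n. K \<le> n \<Longrightarrow> dp n y w = 0"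
    using locally_nilpotentE[OF assms(1)] by metis
  \<comment> \<open>The bound \<open>Suc K\<close> makes the range nonempty, so that the term
    \<open>k = 0\<close> can be split off.\<close>
  then have "chi sv \<rho> y t w = (\<Sum>k<Suc K. sv (of_rat t ^ k) (dp k y w))"
    by (intro chi_eq) simp
  also have "\<dots> = w + (\<Sum>k<K. sv (of_rat t ^ Suc k) (dp (Suc k) y w))"
    by (subst sum.lessThan_Suc_shift) simp
  finally have "chi sv \<rho> y t w - w = (\<Sum>k<K. sv (of_rat t ^ Suc k) (dp (Suc k) y w))"
    by (simp only: add_diff_cancel_left')
  also have "\<dots> \<in> W"
    by (rule V.subspace_sum[OF assms(2)], rule V.subspace_scale[OF assms(2,3)])
  finally show ?thesis .
qed

context highest_weight_module
begin

lemma comb_shift: "(\<lambda>y. comb a y + of_nat k * comb b y) = comb (\<lambda>\<iota>. a \<iota> + int k * b \<iota>)"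
  by (rule ext) (simp add: comb_add comb_scale)

lemma comb_shift_sum: "(\<Sum>\<iota>\<in>S. a \<iota> + int k * b \<iota>) = (\<Sum>\<iota>\<in>S. a \<iota>) + int k * (\<Sum>\<iota>\<in>S. b \<iota>)"
  by (simp add: sum.distrib sum_distrib_left)

text \<open>Contains every nontrivial contribution to weights above \<open>\<mu>\<close> of the root groups that follow the one of
  \<open>\<alpha>\<close> in the height order.\<close>

definition above :: "('g \<Rightarrow> complex) \<Rightarrow> ('g \<Rightarrow> complex) \<Rightarrow> 'v set" where
  "above \<alpha> \<mu> = V.span (\<Union>a\<in>{a. height S \<alpha> \<le> (\<Sum>\<iota>\<in>S. a \<iota>) \<and> comb a \<noteq> \<alpha>}. weight_space H (\<lambda>y. \<mu> y + comb a y))"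

lemma subspace_above: "V.subspace (above \<alpha> \<mu>)"
  by (simp add: above_def)

lemma aboveI:
  assumes "w \<in> weight_space H (\<lambda>y. \<mu> y + comb a y)" "height S \<alpha> \<le> (\<Sum>\<iota>\<in>S. a \<iota>)" "comb a \<noteq> \<alpha>"
  shows "w \<in> above \<alpha> \<mu>"
  unfolding above_def by (rule V.span_base) (use assms in blast)

lemma above_induct [consumes 1, case_names zero step]:
  assumes "z \<in> above \<alpha> \<mu>" "P 0"
    and "\<And>c w z a. w \<in> weight_space H (\<lambda>y. \<mu> y + comb a y) \<Longrightarrow> height S \<alpha> \<le> (\<Sum>\<iota>\<in>S. a \<iota>) \<Longrightarrow>
      comb a \<noteq> \<alpha> \<Longrightarrow> P z \<Longrightarrow> P (sv c w + z)"
  shows "P z"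
  using assms(1) unfolding above_def by (induction rule: V.span_induct_alt) (use assms(2,3) in auto)

text \<open>Applied to \<open>w\<close>, a positive power of \<open>x \<gamma>\<close> adds at least
  the height of \<gamma>. The height of \<alpha> can only be met by the first power, where the added
  weight is \<gamma> and not \<alpha>. Starting inside \<open>above\<close>, a positive power even
  exceeds that height.\<close>

lemma chi_positive_above:
  assumes \<gamma>: "\<gamma> \<in> \<Phi>" "height S \<alpha> \<le> height S \<gamma>" "\<gamma> \<noteq> \<alpha>"
  shows "w \<in> weight_space H \<mu> \<Longrightarrow> chi sv \<rho> (x \<gamma>) t w - w \<in> above \<alpha> \<mu>"
    and "z \<in> above \<alpha> \<mu> \<Longrightarrow> chi sv \<rho> (x \<gamma>) t z \<in> above \<alpha> \<mu>"
proof -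
  note nil = root_vector_nilpotent[OF positive_root[OF \<gamma>(1)]]
  note dp_weight = weight_space_dp[OF root_vector[OF positive_root[OF \<gamma>(1)]]]
  obtain b where b: "\<gamma> = comb b"
    using \<gamma>(1) by (auto simp: positive_iff)
  have ht: "height S \<gamma> = (\<Sum>\<iota>\<in>S. b \<iota>)"
    by (simp add: b height_comb)
  have pos: "0 < height S \<gamma>"
    by (rule height_positive[OF \<gamma>(1)])
  {
    assume w: "w \<in> weight_space H \<mu>"
    show "chi sv \<rho> (x \<gamma>) t w - w \<in> above \<alpha> \<mu>"
    proof (rule chi_minus_id_mem[OF nil subspace_above])
      fix k
      let ?a = "\<lambda>\<iota>. int (Suc k) * b \<iota>"
      have sum: "(\<Sum>\<iota>\<in>S. ?a \<iota>) = height S \<gamma> + int k * height S \<gamma>"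
        by (simp add: ht sum.distrib sum_distrib_left algebra_simps)
      have comb: "comb ?a = (\<lambda>y. of_nat (Suc k) * \<gamma> y)"
        by (rule ext) (simp add: comb_scale b)
      show "dp (Suc k) (x \<gamma>) w \<in> above \<alpha> \<mu>"
      proof (rule aboveI)
        show "dp (Suc k) (x \<gamma>) w \<in> weight_space H (\<lambda>y. \<mu> y + comb ?a y)"
          using dp_weight[OF w, of "Suc k"] by (simp only: comb)
        have "0 \<le> int k * height S \<gamma>"
          using pos by simp
        then show "height S \<alpha> \<le> (\<Sum>\<iota>\<in>S. ?a \<iota>)"
          using \<gamma>(2) unfolding sum by linarith
        show "comb ?a \<noteq> \<alpha>"
        proof (cases k)
          case 0
          then show ?thesis using \<gamma>(3) comb by simp
        next
          case (Suc j)
          then have "0 < int k * height S \<gamma>"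
            using pos by simp
          then have "height S \<alpha> < height S (comb ?a)"
            using \<gamma>(2) unfolding height_comb sum by linarith
          then show ?thesis by auto
        qed
      qed
    qed
  next
    assume "z \<in> above \<alpha> \<mu>"
    then show "chi sv \<rho> (x \<gamma>) t z \<in> above \<alpha> \<mu>"
    proof (induction rule: above_induct)
      case (step c w z a)
      have "chi sv \<rho> (x \<gamma>) t w - w \<in> above \<alpha> \<mu>"
      proof (rule chi_minus_id_mem[OF nil subspace_above])
        fix k
        let ?a = "\<lambda>\<iota>. a \<iota> + int (Suc k) * b \<iota>"
        have sum: "(\<Sum>\<iota>\<in>S. ?a \<iota>) = (\<Sum>\<iota>\<in>S. a \<iota>) + int (Suc k) * height S \<gamma>"
          unfolding comb_shift_sum ht ..
        have less: "height S \<alpha> < (\<Sum>\<iota>\<in>S. ?a \<iota>)"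
          using step(2) pos unfolding sum by (smt (verit) mult_pos_pos of_nat_0_less_iff zero_less_Suc)
        show "dp (Suc k) (x \<gamma>) w \<in> above \<alpha> \<mu>"
        proof (rule aboveI)
          have "(\<lambda>y. \<mu> y + comb a y + of_nat (Suc k) * \<gamma> y) = (\<lambda>y. \<mu> y + comb ?a y)"
            by (simp only: comb_shift[symmetric] b add.assoc)
          then show "dp (Suc k) (x \<gamma>) w \<in> weight_space H (\<lambda>y. \<mu> y + comb ?a y)"
            using dp_weight[OF step(1), of "Suc k"] by (simp only:)
          show "height S \<alpha> \<le> (\<Sum>\<iota>\<in>S. ?a \<iota>)" using less by simp
          show "comb ?a \<noteq> \<alpha>" using less height_comb[of ?a] by force
        qed
      qed
      from V.subspace_add[OF subspace_above this aboveI[OF step(1-3)]]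
      have "chi sv \<rho> (x \<gamma>) t w \<in> above \<alpha> \<mu>" by simp
      then show ?case
        using step.IH by (simp add: chi_add[OF nil] chi_scale[OF nil] V.subspace_add[OF subspace_above]
            V.subspace_scale[OF subspace_above])
    qed (simp add: V.subspace_0[OF subspace_above])
  }
qed

text \<open>The error of the inner product stays in \<open>above\<close> under the next factor, and
  the next factor applied to \<open>w\<close> itself adds an error of the same kind.\<close>

lemma product_above:
  assumes "\<And>i. i \<in> set is \<Longrightarrow> \<beta> i \<in> \<Phi> \<and> height S \<alpha> \<le> height S (\<beta> i) \<and> \<beta> i \<noteq> \<alpha>"
    and w: "w \<in> weight_space H \<mu>"
  shows "foldr (\<circ>) (map (\<lambda>i. chi sv \<rho> (x (\<beta> i)) (q i)) is) id w - w \<in> above \<alpha> \<mu>"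
  using assms(1)
proof (induction "is")
  case Nil
  show ?case by (simp add: V.subspace_0[OF subspace_above])
next
  case (Cons i js)
  let ?z = "foldr (\<circ>) (map (\<lambda>i. chi sv \<rho> (x (\<beta> i)) (q i)) js) id w"
  have i: "\<beta> i \<in> \<Phi>" "height S \<alpha> \<le> height S (\<beta> i)" "\<beta> i \<noteq> \<alpha>"
    using Cons.prems by simp_all
  have "?z - w \<in> above \<alpha> \<mu>"
    by (rule Cons.IH) (use Cons.prems in simp)
  then have diff: "chi sv \<rho> (x (\<beta> i)) (q i) (?z - w) \<in> above \<alpha> \<mu>"
    by (rule chi_positive_above(2)[OF i])
  have w': "chi sv \<rho> (x (\<beta> i)) (q i) w - w \<in> above \<alpha> \<mu>"
    by (rule chi_positive_above(1)[OF i w])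
  show ?case
    using V.subspace_add[OF subspace_above diff w']
    by (simp only: chi_diff[OF root_vector_nilpotent[OF positive_root[OF i(1)]]] list.map foldr_comp_Cons
        add_diff_eq diff_add_cancel)
qed

text \<open>From \<open>w\<close>, only the first power of \<open>x \<alpha>\<close> reaches weight
  \<open>\<mu> + \<alpha>\<close>. From \<open>above\<close>, reaching it would force the power 0 by
  comparison of heights, and then the excluded equality \<open>comb a = \<alpha>\<close>.\<close>

lemma chi_off_weight:
  assumes \<alpha>: "\<alpha> \<in> \<Phi>" and \<mu>: "\<mu> \<in> dual_space s H"
  shows "w \<in> weight_space H \<mu> \<Longrightarrow>
      chi sv \<rho> (x \<alpha>) t w - sv (of_rat t) (\<rho> (x \<alpha>) w) \<in> off_weight H (\<lambda>y. \<mu> y + \<alpha> y)"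
    and "z \<in> above \<alpha> \<mu> \<Longrightarrow> chi sv \<rho> (x \<alpha>) t z \<in> off_weight H (\<lambda>y. \<mu> y + \<alpha> y)"
proof -
  note root = positive_root[OF \<alpha>]
  note nil = root_vector_nilpotent[OF root] and dp_weight = weight_space_dp[OF root_vector[OF root]]
  let ?off = "off_weight H (\<lambda>y. \<mu> y + \<alpha> y)"
  {
    assume w: "w \<in> weight_space H \<mu>"
    have off: "dp k (x \<alpha>) w \<in> ?off" if "k \<noteq> 1" for k
    proof (rule weight_space_off[OF dp_weight[OF w]])
      show "(\<lambda>y. \<mu> y + of_nat k * \<alpha> y) \<in> dual_space s H"
        by (intro dual_space_add dual_space_scale \<mu> root_dual root)
      show "(\<lambda>y. \<mu> y + of_nat k * \<alpha> y) \<noteq> (\<lambda>y. \<mu> y + \<alpha> y)"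
      proof
        assume eq: "(\<lambda>y. \<mu> y + of_nat k * \<alpha> y) = (\<lambda>y. \<mu> y + \<alpha> y)"
        show False
          using fun_cong[OF eq, of "h \<alpha>"] that by (simp add: root_coroot root)
      qed
    qed
    obtain K where "\<And>n. K \<le> n \<Longrightarrow> dp n (x \<alpha>) w = 0"
      using locally_nilpotentE[OF nil] by metis
    then have "chi sv \<rho> (x \<alpha>) t w = (\<Sum>k<Suc (Suc K). sv (of_rat t ^ k) (dp k (x \<alpha>) w))"
      by (intro chi_eq) simp
    also have "\<dots> = w + sv (of_rat t) (\<rho> (x \<alpha>) w) + (\<Sum>k<K. sv (of_rat t ^ Suc (Suc k)) (dp (Suc (Suc k)) (x \<alpha>) w))"
      unfolding sum.lessThan_Suc_shift by simp
    finally have "chi sv \<rho> (x \<alpha>) t w - sv (of_rat t) (\<rho> (x \<alpha>) w) =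
        w + (\<Sum>k<K. sv (of_rat t ^ Suc (Suc k)) (dp (Suc (Suc k)) (x \<alpha>) w))"
      by simp
    also have "\<dots> \<in> ?off"
      using off[of 0] off by (intro V.subspace_add[OF subspace_off_weight] V.subspace_sum[OF subspace_off_weight]
          V.subspace_scale[OF subspace_off_weight]) auto
    finally show "chi sv \<rho> (x \<alpha>) t w - sv (of_rat t) (\<rho> (x \<alpha>) w) \<in> ?off" .
  next
    assume "z \<in> above \<alpha> \<mu>"
    then show "chi sv \<rho> (x \<alpha>) t z \<in> ?off"
    proof (induction rule: above_induct)
      case (step c w z a)
      obtain b where b: "\<alpha> = comb b"
        using \<alpha> by (auto simp: positive_iff)
      have off: "dp k (x \<alpha>) w \<in> ?off" for k
      proof (rule weight_space_off[OF dp_weight[OF step(1)]])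
        show "(\<lambda>y. \<mu> y + comb a y + of_nat k * \<alpha> y) \<in> dual_space s H"
          by (intro dual_space_add dual_space_scale \<mu> comb_dual root_dual root)
        show "(\<lambda>y. \<mu> y + comb a y + of_nat k * \<alpha> y) \<noteq> (\<lambda>y. \<mu> y + \<alpha> y)"
        proof
          assume eq: "(\<lambda>y. \<mu> y + comb a y + of_nat k * \<alpha> y) = (\<lambda>y. \<mu> y + \<alpha> y)"
          have *: "\<alpha> = comb (\<lambda>\<iota>. a \<iota> + int k * b \<iota>)"
            using fun_cong[OF eq] by (auto simp: b comb_add comb_scale fun_eq_iff)
          have "height S \<alpha> = (\<Sum>\<iota>\<in>S. a \<iota>) + int k * height S \<alpha>"
            by (subst *) (simp only: height_comb comb_shift_sum b)
          moreover have "0 < height S \<alpha>"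
            by (rule height_positive[OF \<alpha>])
          ultimately have "int k * height S \<alpha> \<le> 0"
            using step(2) by linarith
          then have "k = 0"
            using \<open>0 < height S \<alpha>\<close> by (simp add: mult_le_0_iff)
          then show False
            using step(3) * by simp
        qed
      qed
      have "chi sv \<rho> (x \<alpha>) t w - w \<in> ?off"
        by (rule chi_minus_id_mem[OF nil subspace_off_weight off])
      from V.subspace_add[OF subspace_off_weight this] have "chi sv \<rho> (x \<alpha>) t w \<in> ?off"
        using off[of 0] by fastforce
      then show ?case
        using step.IH by (simp add: chi_add[OF nil] chi_scale[OF nil] V.subspace_add[OF subspace_off_weight]
            V.subspace_scale[OF subspace_off_weight])
    qed (simp add: V.subspace_0[OF subspace_off_weight])
  }
qed

text \<open>The component of weight \<open>\<mu> + \<alpha>\<close> of the image of a generator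
  \<open>w\<close> of weight \<mu> is exactly \<open>t\<close> times \<open>x \<alpha>\<close> on
  \<open>w\<close>. It lies in the lattice by \<open>lattice_component\<close>, so
  \<open>root_vector_primitive\<close> applies.\<close>

lemma first_factor_integral:
  assumes faithful: "faithful_module \<rho>" and \<alpha>: "\<alpha> \<in> \<Phi>"
    and u: "\<And>w \<mu>. w \<in> weight_space H \<mu> \<Longrightarrow> u w - w \<in> above \<alpha> \<mu>"
    and stable: "\<And>w. w \<in> lattice \<Longrightarrow> chi sv \<rho> (x \<alpha>) t (u w) \<in> lattice"
  shows "t \<in> \<int>"
proof (rule root_vector_primitive[OF faithful positive_root[OF \<alpha>]])
  note nil = root_vector_nilpotent[OF positive_root[OF \<alpha>]]
  fix w assume "w \<in> lattice"
  then show "sv (of_rat t) (\<rho> (x \<alpha>) w) \<in> lattice"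
  proof (induction rule: lattice_induct)
    case (lowering w a)
    let ?\<mu> = "wt a" and ?p = "sv (of_rat t) (\<rho> (x \<alpha>) w)"
    note w = lowering_weight[OF lowering]
    have "(chi sv \<rho> (x \<alpha>) t w - ?p) + chi sv \<rho> (x \<alpha>) t (u w - w) \<in> off_weight H (\<lambda>y. ?\<mu> y + \<alpha> y)"
      by (intro V.subspace_add[OF subspace_off_weight] chi_off_weight[OF \<alpha> wt_dual] w u)
    then have "chi sv \<rho> (x \<alpha>) t (u w) - ?p \<in> off_weight H (\<lambda>y. ?\<mu> y + \<alpha> y)"
      by (simp add: chi_diff[OF nil])
    moreover have "?p \<in> weight_space H (\<lambda>y. ?\<mu> y + \<alpha> y)"
      by (intro V.subspace_scale[OF subspace_weight_space] weight_space_shift w root_vector positive_root \<alpha>)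
    moreover have "?p + (chi sv \<rho> (x \<alpha>) t (u w) - ?p) \<in> lattice"
      using stable[OF lattice_lowering[OF lowering]] by simp
    moreover have "(\<lambda>y. ?\<mu> y + \<alpha> y) \<in> dual_space s H"
      by (intro dual_space_add wt_dual root_dual positive_root \<alpha>)
    ultimately show ?case
      by (blast intro: lattice_component)
  qed (auto simp: act_diff_right V.scale_right_diff_distrib intro: lattice_zero lattice_diff)
qed

text \<open>The head of the list is the factor applied last. Once its parameter is integral, its
  inverse preserves the lattice, so the remaining product does too and the induction
  continues.\<close>

lemma product_integral:
  assumes faithful: "faithful_module \<rho>"
  shows "\<lbrakk>\<forall>i\<in>set is. \<beta> i \<in> \<Phi>;
      sorted_wrt (\<lambda>i j. height S (\<beta> i) \<le> height S (\<beta> j) \<and> \<beta> j \<noteq> \<beta> i) is;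
      \<forall>w\<in>lattice. foldr (\<circ>) (map (\<lambda>i. chi sv \<rho> (x (\<beta> i)) (q i)) is) id w \<in> lattice\<rbrakk> \<Longrightarrow>
    \<forall>i\<in>set is. q i \<in> \<int>"
proof (induction "is")
  case (Cons i js)
  let ?u = "foldr (\<circ>) (map (\<lambda>i. chi sv \<rho> (x (\<beta> i)) (q i)) js) id"
  have root: "\<beta> i \<in> \<Delta>"
    using Cons.prems(1) positive_root by simp
  note nil = root_vector_nilpotent[OF root]
  have stable: "chi sv \<rho> (x (\<beta> i)) (q i) (?u w) \<in> lattice" if "w \<in> lattice" for w
    using Cons.prems(3)[rule_format, OF that] by (simp only: list.map foldr_comp_Cons)
  have q: "q i \<in> \<int>"
  proof (rule first_factor_integral[OF faithful _ _ stable])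
    show "\<beta> i \<in> \<Phi>" using Cons.prems(1) by simp
    show "?u w - w \<in> above (\<beta> i) \<mu>" if "w \<in> weight_space H \<mu>" for w \<mu>
      by (rule product_above[OF _ that]) (use Cons.prems(1,2) in auto)
  qed
  have "?u w \<in> lattice" if "w \<in> lattice" for w
  proof -
    have "chi sv \<rho> (x (\<beta> i)) (- q i) (chi sv \<rho> (x (\<beta> i)) (q i) (?u w)) \<in> lattice"
      by (rule lattice_chi[OF nil]) (use root lattice_dp stable[OF that] q in auto)
    then show ?thesis
      by (simp add: chi_inverse(1)[OF nil])
  qed
  then have "\<forall>i\<in>set js. q i \<in> \<int>"
    by (intro Cons.IH ballI) (use Cons.prems(1,2) in auto)[2]
  then show ?case using q by simp
qed simp

end

section \<open>The Kostant lattice\<close>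

interpretation free_ring: ring free_ring
proof (rule ringI)
  show "abelian_group (free_ring :: 'a free_algebra ring)"
  proof (rule abelian_groupI)
    fix t :: "'a free_algebra"
    show "\<exists>y\<in>carrier free_ring. y \<oplus>\<^bsub>free_ring\<^esub> t = \<zero>\<^bsub>free_ring\<^esub>"
      by (rule bexI[of _ "- t"]) (auto simp: free_ring_def)
  qed (auto simp: free_ring_def algebra_simps)
  show "monoid (free_ring :: 'a free_algebra ring)"
    by (rule monoidI) (auto simp: free_ring_def algebra_simps)
qed (auto simp: free_ring_def algebra_simps)

lemma free_ring_simps [simp]:
  "carrier free_ring = UNIV" "mult free_ring = (*)" "one free_ring = 1" "zero free_ring = 0"
  "add free_ring = (+)"
  by (simp_all add: free_ring_def)

lemma free_algebra_induct [case_names zero single add]: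
  fixes t :: "'a free_algebra"
  assumes "P 0" "\<And>u c. P (Poly_Mapping.single u c)" "\<And>a b. P a \<Longrightarrow> P b \<Longrightarrow> P (a + b)"
  shows "P t"
proof (induction t rule: update_induct)
  case (update f a b)
  have "Poly_Mapping.update a b f = Poly_Mapping.single a b + f"
    by (rule poly_mapping_eqI)
      (use update(1) in \<open>auto simp: lookup_add lookup_single lookup_update when_def in_keys_iff\<close>)
  then show ?case
    using assms(2,3) update.IH by simp
qed (rule assms(1))

section \<open>The action of the free algebra and its descent to the enveloping algebra\<close>

context lie_module
begin

lemma word_action_zero [simp]: "word_action \<rho> 0 w = w"
  by (simp add: zero_word_def)

lemma word_action_plus: "word_action \<rho> (u + u') w = word_action \<rho> u (word_action \<rho> u' w)"
  by (cases u; cases u') simp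

lemma word_action_add: "word_action \<rho> u (w + w') = word_action \<rho> u w + word_action \<rho> u w'"
proof (cases u)
  case (Word ys)
  have "foldr \<rho> ys (w + w') = foldr \<rho> ys w + foldr \<rho> ys w'"
    by (induction ys) (auto simp: act_add_right)
  then show ?thesis by (simp add: Word)
qed

lemma word_action_scale: "word_action \<rho> u (sv c w) = sv c (word_action \<rho> u w)"
proof (cases u)
  case (Word ys)
  have "foldr \<rho> ys (sv c w) = sv c (foldr \<rho> ys w)"
    by (induction ys) (auto simp: act_scale_right)
  then show ?thesis by (simp add: Word)
qed

lemma free_action_superset:
  assumes "finite F" "Poly_Mapping.keys t \<subseteq> F"
  shows "free_action sv \<rho> t w = (\<Sum>u\<in>F. sv (Poly_Mapping.lookup t u) (word_action \<rho> u w))"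
  unfolding free_action_def
  by (rule sum.mono_neutral_left) (use assms in \<open>auto simp: in_keys_iff\<close>)

lemma free_action_zero [simp]: "free_action sv \<rho> 0 w = 0"
  by (simp add: free_action_def)

lemma free_action_single [simp]: "free_action sv \<rho> (Poly_Mapping.single u c) w = sv c (word_action \<rho> u w)"
  using free_action_superset[of "{u}" "Poly_Mapping.single u c" w] by simp

lemma free_action_add: "free_action sv \<rho> (a + b) w = free_action sv \<rho> a w + free_action sv \<rho> b w"
proof -
  let ?F = "Poly_Mapping.keys a \<union> Poly_Mapping.keys b"
  have "Poly_Mapping.keys (a + b) \<subseteq> ?F"
    by (rule keys_add)
  then show ?thesis
    by (simp add: free_action_superset[of ?F] lookup_add V.scale_left_distrib sum.distrib)
qed

lemma free_action_minus: "free_action sv \<rho> (- a) w = - free_action sv \<rho> a w"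
  using free_action_add[of a "- a" w] by (simp add: eq_neg_iff_add_eq_0 add.commute)

lemma free_action_diff: "free_action sv \<rho> (a - b) w = free_action sv \<rho> a w - free_action sv \<rho> b w"
  using free_action_add[of a "- b" w] by (simp add: free_action_minus)

lemma free_action_add_right: "free_action sv \<rho> a (w + w') = free_action sv \<rho> a w + free_action sv \<rho> a w'"
  by (simp add: free_action_def word_action_add V.scale_right_distrib sum.distrib)

lemma free_action_scale_right: "free_action sv \<rho> a (sv c w) = sv c (free_action sv \<rho> a w)"
  by (simp add: free_action_def word_action_scale V.scale_sum_right mult.commute)

text \<open>Both sides are additive in \<open>a\<close> and in \<open>b\<close>, so it suffices to
  compare them on scaled words.\<close>

lemma free_action_mult: "free_action sv \<rho> (a * b) w = free_action sv \<rho> a (free_action sv \<rho> b w)"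
proof (induction a rule: free_algebra_induct)
  case (single u c)
  show ?case
  proof (induction b rule: free_algebra_induct)
    case (single u' c')
    then show ?case
      by (simp add: mult_single word_action_plus word_action_scale)
  next
    case (add b b')
    then show ?case
      by (simp add: distrib_left free_action_add word_action_add V.scale_right_distrib)
  qed (simp add: word_action_scale[of _ 0 0, simplified])
qed (simp_all add: distrib_right free_action_add)

lemma free_action_one [simp]: "free_action sv \<rho> 1 w = w"
  using free_action_single[of 0 1 w] by (simp add: single_one)

lemma free_action_gen [simp]: "free_action sv \<rho> (free_gen y) w = \<rho> y w"
  by (simp add: free_gen_def)

lemma free_action_const [simp]: "free_action sv \<rho> (free_const c) w = sv c w"
  by (simp add: free_const_def)

lemma free_action_of_nat: "free_action sv \<rho> (of_nat k) w = sv (of_nat k) w"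
  by (induction k) (simp_all add: free_action_add V.scale_left_distrib)

lemma free_action_divided_power: "free_action sv \<rho> (divided_power y m) w = dp m y w"
proof -
  have "free_action sv \<rho> (free_gen y ^ m) w = (\<rho> y ^^ m) w"
    by (induction m) (simp_all add: free_action_mult)
  then show ?thesis
    by (simp add: divided_power_def free_action_mult dp_def)
qed

lemma free_action_binomial:
  assumes "\<rho> y w = sv c w"
  shows "free_action sv \<rho> (binomial_element y m) w = sv (c gchoose m) w"
proof -
  have "free_action sv \<rho> (prod_list (map (\<lambda>k. free_gen y - of_nat k) ks)) w =
      sv (prod_list (map (\<lambda>k. c - of_nat k) ks)) w" for ks
    by (induction ks) (simp_all add: free_action_mult free_action_diff free_action_of_nat act_scale_right assms
        algebra_simps)
  then have "free_action sv \<rho> (binomial_element y m) w =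
      sv (1 / fact m * prod_list (map (\<lambda>k. c - of_nat k) [0..<m])) w"
    by (simp add: binomial_element_def free_action_mult)
  also have "prod_list (map (\<lambda>k. c - of_nat k) [0..<m]) = (\<Prod>i = 0..<m. c - of_nat i)"
    by (induction m) simp_all
  finally show ?thesis
    by (simp add: gbinomial_prod_rev)
qed

text \<open>The annihilator is an ideal; the defining relations lie in it by the module axioms, so
  it contains the whole enveloping ideal.\<close>

lemma ideal_free_action_kernel: "ideal {t. \<forall>w. free_action sv \<rho> t w = 0} free_ring"
proof (rule idealI[OF free_ring.ring_axioms])
  show "subgroup {t. \<forall>w. free_action sv \<rho> t w = 0} (add_monoid free_ring)"
  proof (rule group.subgroupI[OF free_ring.a_group])
    show "inv\<^bsub>add_monoid free_ring\<^esub> a \<in> {t. \<forall>w. free_action sv \<rho> t w = 0}"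
      if "a \<in> {t. \<forall>w. free_action sv \<rho> t w = 0}" for a
    proof -
      have "inv\<^bsub>add_monoid free_ring\<^esub> a = - a"
        by (rule group.inv_equality[OF free_ring.a_group]) auto
      then show ?thesis
        using that by (simp add: free_action_minus)
    qed
  qed (auto simp: free_action_add intro: exI[of _ 0])
  have "free_action sv \<rho> b 0 = 0" for b
    using free_action_scale_right[of b 0 0] by simp
  then show "b \<otimes>\<^bsub>free_ring\<^esub> a \<in> {t. \<forall>w. free_action sv \<rho> t w = 0}"
    if "a \<in> {t. \<forall>w. free_action sv \<rho> t w = 0}" for a b
    using that by (simp add: free_action_mult)
  show "a \<otimes>\<^bsub>free_ring\<^esub> b \<in> {t. \<forall>w. free_action sv \<rho> t w = 0}"
    if "a \<in> {t. \<forall>w. free_action sv \<rho> t w = 0}" for a b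
    using that by (simp add: free_action_mult)
qed

lemma enveloping_ideal_acts_zero: "t \<in> enveloping_ideal s br \<Longrightarrow> free_action sv \<rho> t w = 0"
proof -
  have "enveloping_ideal s br \<subseteq> {t. \<forall>w. free_action sv \<rho> t w = 0}"
    unfolding enveloping_ideal_def
    by (rule free_ring.genideal_minimal[OF ideal_free_action_kernel])
      (auto simp: free_action_diff free_action_mult act_add_left act_scale_left act_br)
  then show "t \<in> enveloping_ideal s br \<Longrightarrow> free_action sv \<rho> t w = 0"
    by blast
qed

lemma ideal_enveloping_ideal: "ideal (enveloping_ideal s br) free_ring"
  unfolding enveloping_ideal_def by (rule free_ring.genideal_ideal) simp

lemma ring_hom_enveloping_class:
  "ring_hom_ring free_ring (enveloping_algebra s br) (enveloping_class s br)"
  using ideal.rcos_ring_hom_ring[OF ideal_enveloping_ideal]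
  unfolding enveloping_algebra_def enveloping_class_def[abs_def] .

text \<open>All representatives of a coset act alike, so the image set in
  \<open>enveloping_action\<close> is a singleton and \<open>the_elem\<close> returns its
  element.\<close>

lemma enveloping_action_class: "enveloping_action sv \<rho> (enveloping_class s br t) w = free_action sv \<rho> t w"
proof -
  have coset_eq: "enveloping_class s br t = {i + t | i. i \<in> enveloping_ideal s br}"
    by (auto simp: enveloping_class_def a_r_coset_def r_coset_def)
  have "0 \<in> enveloping_ideal s br"
    using additive_subgroup.zero_closed[OF ideal.axioms(1)[OF ideal_enveloping_ideal]] by simp
  then have "(\<lambda>t. free_action sv \<rho> t w) ` enveloping_class s br t = {free_action sv \<rho> t w}"
    unfolding coset_eq by (fastforce simp: free_action_add enveloping_ideal_acts_zero image_iff)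
  then show ?thesis
    by (simp add: enveloping_action_def)
qed

end

section \<open>Identification of the two lattices\<close>

context highest_weight_module
begin

text \<open>Allows a test on the monomials only. For binomial elements this matters, since they act
  by a scalar only on weight vectors.\<close>

lemma lattice_free_action:
  assumes "\<And>w a. lowering w a \<Longrightarrow> free_action sv \<rho> t w \<in> lattice" "w \<in> lattice"
  shows "free_action sv \<rho> t w \<in> lattice"
  using assms(2)
proof (induction rule: lattice_induct)
  case zero
  then show ?case
    using free_action_scale_right[of t 0 0] lattice_zero by simp
next
  case (diff a b)
  then show ?case
    using free_action_add_right[of t "a - b" b] lattice_diff
    by (metis add_diff_cancel_right' diff_add_cancel)
qed (rule assms(1))

lemma lattice_binomial:
  assumes "\<alpha> \<in> S" "w \<in> lattice"
  shows "free_action sv \<rho> (binomial_element (h \<alpha>) m) w \<in> lattice"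
  by (rule lattice_free_action[OF _ assms(2)])
    (simp add: free_action_binomial[OF lowering_coroot[OF _ assms(1)]] lattice_scale gbinomial_Ints
      wt_coroot_int assms(1) lattice_lowering)

text \<open>Having a representative that preserves the lattice passes to sums, negatives and
  products, and it holds for the generators of the form.\<close>

lemma kostant_form_preserves_lattice:
  assumes "C \<in> kostant_form s br H S x h"
  obtains t where "C = enveloping_class s br t" "\<And>w. w \<in> lattice \<Longrightarrow> free_action sv \<rho> t w \<in> lattice"
proof -
  interpret hom: ring_hom_ring free_ring "enveloping_algebra s br" "enveloping_class s br"
    by (rule ring_hom_enveloping_class)
  have "\<exists>t. C = enveloping_class s br t \<and> (\<forall>w\<in>lattice. free_action sv \<rho> t w \<in> lattice)"
    using assms unfolding kostant_form_def
  proof (induction rule: generate_ring.induct)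
    case one
    show ?case
      using hom.hom_one by (intro exI[of _ 1]) simp
  next
    case (incl C)
    then show ?case
      by (auto simp: free_action_divided_power lattice_dp lattice_binomial)
  next
    case (a_inv C)
    then obtain t where t: "C = enveloping_class s br t" "\<forall>w\<in>lattice. free_action sv \<rho> t w \<in> lattice"
      by blast
    have "\<ominus>\<^bsub>free_ring\<^esub> t = - t"
      by (rule free_ring.minus_equality) simp_all
    then show ?case
      using hom.hom_a_inv[of t] t lattice_diff[OF lattice_zero]
      by (intro exI[of _ "- t"]) (simp add: free_action_minus)
  next
    case (eng_add C D)
    then obtain t t' where "C = enveloping_class s br t" "\<forall>w\<in>lattice. free_action sv \<rho> t w \<in> lattice"
      "D = enveloping_class s br t'" "\<forall>w\<in>lattice. free_action sv \<rho> t' w \<in> lattice" by blast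
    then show ?case
      using hom.hom_add[of t t'] by (intro exI[of _ "t + t'"]) (simp add: free_action_add lattice_add)
  next
    case (eng_mult C D)
    then obtain t t' where "C = enveloping_class s br t" "\<forall>w\<in>lattice. free_action sv \<rho> t w \<in> lattice"
      "D = enveloping_class s br t'" "\<forall>w\<in>lattice. free_action sv \<rho> t' w \<in> lattice" by blast
    then show ?case
      using hom.hom_mult[of t t'] by (intro exI[of _ "t * t'"]) (simp add: free_action_mult)
  qed
  then show ?thesis
    using that by blast
qed

text \<open>A monomial is a product of generators of the form applied to \<open>v\<close>, and the
  form is closed under products and differences.\<close>

lemma lattice_subset_kostant:
  assumes "w \<in> lattice"
  obtains t where "enveloping_class s br t \<in> kostant_form s br H S x h" "free_action sv \<rho> t v = w"
proof -
  interpret hom: ring_hom_ring free_ring "enveloping_algebra s br" "enveloping_class s br"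
    by (rule ring_hom_enveloping_class)
  let ?K = "kostant_form s br H S x h"
  have one: "enveloping_class s br 1 \<in> ?K"
    using generate_ring.one[of "enveloping_algebra s br"] hom.hom_one by (simp add: kostant_form_def)
  have mult: "enveloping_class s br (a * b) \<in> ?K"
    if "enveloping_class s br a \<in> ?K" "enveloping_class s br b \<in> ?K" for a b
    using generate_ring.eng_mult[OF that[unfolded kostant_form_def]] hom.hom_mult[of a b]
    by (simp add: kostant_form_def)
  have diff: "enveloping_class s br (a - b) \<in> ?K"
    if "enveloping_class s br a \<in> ?K" "enveloping_class s br b \<in> ?K" for a b
  proof -
    have "\<ominus>\<^bsub>free_ring\<^esub> b = - b"
      by (rule free_ring.minus_equality) simp_all
    then show ?thesis
      using generate_ring.eng_add[OF that(1)[unfolded kostant_form_def]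
          generate_ring.a_inv[OF that(2)[unfolded kostant_form_def]]]
        hom.hom_a_inv[of b] hom.hom_add[of a "- b"] by (simp add: kostant_form_def)
  qed
  have "\<exists>t. enveloping_class s br t \<in> ?K \<and> free_action sv \<rho> t v = w"
    using assms
  proof (induction rule: lattice_induct)
    case (lowering w a)
    then show ?case
    proof (induction rule: lowering.induct)
      case highest
      show ?case using one by (intro exI[of _ 1]) simp
    next
      case (lower w a \<alpha> m)
      then obtain t where t: "enveloping_class s br t \<in> ?K" "free_action sv \<rho> t v = w" by blast
      have "(\<lambda>y. - \<alpha> y) \<in> \<Delta>"
        by (rule neg_root[OF S_roots[OF lower.hyps(2)]])
      then have "enveloping_class s br (divided_power (x (\<lambda>y. - \<alpha> y)) m) \<in> ?K"
        unfolding kostant_form_def by (intro generate_ring.incl) blast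
      from mult[OF this t(1)] show ?case
        by (intro exI[of _ "divided_power (x (\<lambda>y. - \<alpha> y)) m * t"])
          (simp add: free_action_mult free_action_divided_power t(2))
    qed
  next
    case zero
    show ?case
      using diff[OF one one] by (intro exI[of _ 0]) simp
  next
    case (diff a b)
    then obtain t t' where "enveloping_class s br t \<in> ?K" "free_action sv \<rho> t v = a"
      "enveloping_class s br t' \<in> ?K" "free_action sv \<rho> t' v = b" by blast
    then show ?case
      using \<open>\<And>a b. _ \<Longrightarrow> _ \<Longrightarrow> enveloping_class s br (a - b) \<in> ?K\<close>[of t t']
      by (intro exI[of _ "t - t'"]) (simp add: free_action_diff)
  qed
  then show ?thesis
    using that by blast
qed

lemma kostant_lattice_eq: "kostant_lattice s br H S x h sv \<rho> v = lattice"
proof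
  show "kostant_lattice s br H S x h sv \<rho> v \<subseteq> lattice"
    unfolding kostant_lattice_def
  proof clarify
    fix C assume "C \<in> kostant_form s br H S x h"
    then show "enveloping_action sv \<rho> C v \<in> lattice"
      by (rule kostant_form_preserves_lattice) (simp add: enveloping_action_class highest_in_lattice)
  qed
  show "lattice \<subseteq> kostant_lattice s br H S x h sv \<rho> v"
    unfolding kostant_lattice_def using lattice_subset_kostant enveloping_action_class
    by (metis image_eqI subsetI)
qed

end

theorem theorem6p8:
  fixes s :: "complex \<Rightarrow> 'g::ab_group_add \<Rightarrow> 'g"
    and br :: "'g \<Rightarrow> 'g \<Rightarrow> 'g"
    and H :: "'g set"
    and S :: "('g \<Rightarrow> complex) set"
    and x h :: "('g \<Rightarrow> complex) \<Rightarrow> 'g"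
    and sv :: "complex \<Rightarrow> 'v::ab_group_add \<Rightarrow> 'v"
    and \<rho> :: "'g \<Rightarrow> 'v \<Rightarrow> 'v"
    and \<Lambda> :: "'g \<Rightarrow> complex"
    and v :: 'v
    and n :: nat
    and \<beta> :: "nat \<Rightarrow> 'g \<Rightarrow> complex"
    and q :: "nat \<Rightarrow> rat"
    and u :: "'v \<Rightarrow> 'v"
  assumes "fd_simple_lie_algebra s br"
    and "cartan_subalgebra s br H"
    and "simple_roots s br H S"
    and "chevalley_basis s br H S x h"
    and "fd_irreducible_highest_weight_module s br H S h sv \<rho> \<Lambda> v"
    and "\<Lambda> \<noteq> (\<lambda>_. 0)"
    and "faithful_module \<rho>"
    and "n = card (positive_roots s br H S)"
    and "bij_betw \<beta> {1..n} (positive_roots s br H S)"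
    and "\<forall>i\<in>{1..n}. \<forall>j\<in>{1..n}. height S (\<beta> i) < height S (\<beta> j) \<longrightarrow> i < j"
    and "u = foldr (\<circ>) (map (\<lambda>i. chi sv \<rho> (x (\<beta> i)) (q i)) [1..<Suc n]) id"
    and "u ` kostant_lattice s br H S x h sv \<rho> v \<subseteq> kostant_lattice s br H S x h sv \<rho> v"
  shows "\<forall>i\<in>{1..n}. q i \<in> \<int>"
proof -
  interpret highest_weight_module s br H S x h sv \<rho> \<Lambda> v
  proof (intro highest_weight_module.intro chevalley.intro chevalley_axioms.intro
      highest_weight_module_axioms.intro)
    show "lie_algebra s br" "\<exists>B. finite_dimensional_vector_space s B"
      using assms(1) by (auto simp: fd_simple_lie_algebra_def)
  qed (use assms(2-5) in \<open>auto simp: fd_irreducible_highest_weight_module_def\<close>)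
  have range: "\<beta> i \<in> \<Phi>" if "i \<in> {1..n}" for i
    using bij_betwE[OF assms(9)] that by blast
  \<comment> \<open>The enumeration is compatible with height, so heights never decrease along it;
    distinctness comes from injectivity of \<beta>.\<close>
  have sorted: "sorted_wrt (\<lambda>i j. height S (\<beta> i) \<le> height S (\<beta> j) \<and> \<beta> j \<noteq> \<beta> i) [1..<Suc n]"
  proof (rule sorted_wrt_mono_rel[OF _ sorted_wrt_upt])
    fix i j assume ij: "i \<in> set [1..<Suc n]" "j \<in> set [1..<Suc n]" "i < j"
    then have mem: "i \<in> {1..n}" "j \<in> {1..n}"
      by auto
    have "\<beta> j \<noteq> \<beta> i"
      using bij_betw_imp_inj_on[OF assms(9)] mem ij(3) by (metis inj_onD less_irrefl)
    moreover have "\<not> height S (\<beta> j) < height S (\<beta> i)"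
      using assms(10) mem ij(3) by (meson less_asym)
    ultimately show "height S (\<beta> i) \<le> height S (\<beta> j) \<and> \<beta> j \<noteq> \<beta> i"
      by simp
  qed
  \<comment> \<open>The hypothesis on the Kostant lattice is transferred to the lattice of
    monomials, for which \<open>product_integral\<close> is stated.\<close>
  have "\<forall>w\<in>lattice. u w \<in> lattice"
    using assms(12) unfolding kostant_lattice_eq by blast
  then have "\<forall>i\<in>set [1..<Suc n]. q i \<in> \<int>"
    using range unfolding assms(11) by (intro product_integral[OF assms(7) _ sorted]) auto
  then show ?thesis
    by auto
qed

end
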